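(* Let $q$ be a prime power, $t\geq 2$ and $k\geq 2$. In the André/Bruck-Bose setting described in the context (line $\ell\neq\ell_\infty$ of $\mathrm{PG}(2,q^t)$, $P_\infty=\ell\cap\ell_\infty$, $\pi_\infty=\mathcal{F}(P_\infty)$, $t$-space $\Pi\supset\pi_\infty$), a point set $\mathcal{S}\subseteq \ell\cong\mathrm{PG}(1,q^t)$ is an $\mathbb{F}_q$-linear club of rank $k$ containing $P_\infty$ and with head $H\neq P_\infty$ if and only if $\phi(\mathcal{S}\setminus\{P_\infty\})$ is the affine point set (the set of points not in $\pi_\infty$) of a cone in $\Pi$ with vertex the point $\phi(H)$ and base an $\mathcal{H}$-subspace of dimension $k-2$ contained in $\pi_\infty=\mathcal{F}(P_\infty)$.
   Context: Field reduction: viewing $\mathbb{F}_{q^t}^r$ as $\mathbb{F}_q^{rt}$, every point of $\mathrm{PG}(r-1,q^t)$ corresponds to a $(t-1)$-dimensional subspace of $\mathrm{PG}(rt-1,q)$ and every $(m-1)$-space to an $(mt-1)$-space; write $\mathcal{F}(X)$ for the image (for a point set, the union of the images of its points). The images of the points of $\mathrm{PG}(1,q^t)$ form the Desarguesian $(t-1)$-spread $\mathcal{D}$ of $\mathrm{PG}(2t-1,q)$. For a subspace $\pi$ of $\mathrm{PG}(2t-1,q)$, $\mathcal{B}(\pi)$ is the set of elements of $\mathcal{D}$ meeting $\pi$. A set $\mathcal{S}\subseteq\mathrm{PG}(1,q^t)$ is an $\mathbb{F}_q$-linear set of rank $k$ if $\mathcal{F}(\mathcal{S})=\mathcal{B}(\pi)$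 for a $(k-1)$-space $\pi$; it is then denoted $L_\pi$, and the weight of $P\in L_\pi$ is $\dim(\mathcal{F}(P)\cap\pi)+1$. A club of rank $k$ is an $L_\pi$ ($\pi$ a $(k-1)$-space) having one point of weight $k-1$ (the head) and all other points of weight $1$. André/Bruck-Bose (ABB) setting: in $\mathrm{PG}(2,q^t)$ fix a line $\ell_\infty$; $H_\infty=\mathcal{F}(\ell_\infty)$ is a $(2t-1)$-space of $\mathrm{PG}(3t-1,q)=\mathcal{F}(\mathrm{PG}(2,q^t))$, and $\mathcal{F}$ induces on it the Desarguesian $(t-1)$-spread $\mathcal{D}$. Fix a $2t$-space $\mu\supset H_\infty$. For an affine point $P$ (not on $\ell_\infty$) put $\phi(P)=\mathcal{F}(P)\cap\mu$, a point of $\mu\setminus H_\infty$. Let $\ell\neq\ell_\infty$ be a line, $P_\infty=\ell\cap\ell_\infty$, $\pi_\infty=\mathcal{F}(P_\infty)$, and $\Pi=\mathcal{F}(\ell)\cap\mu$, a $t$-space containing $\pi_\infty$ and all points $\phi(P)$, $P\in\ell\setminus\{P_\infty\}$. A cone with vertex a point $V$ and base a point set $K$ is the union of the lines joining $V$ to the points of $K$. Design $\mathcal{H}$ on $\pi_\infty$: regard $H_\infty\cong\mathrm{PG}(2t-1,q)$ as the subgeometry of $\mathrm{PG}(2t-1,q^t)$ fixed pointwise by a collineation $\sigma$ generating the group (isomorphic to $\mathrm{Aut}(\mathbb{F}_{q^t}/\mathbb{F}_q)$) fixing this subgeometry pointwise. The spread $\mathcal{D}$ has a unique indicator set: a line $\nu$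 of $\mathrm{PG}(2t-1,q^t)$ skew to $H_\infty$ such that the elements of $\mathcal{D}$ are the spaces $\langle P,P^\sigma,\dots,P^{\sigma^{t-1}}\rangle\cap H_\infty$, $P\in\nu$. Hence the $\mathbb{F}_{q^t}$-extension $\pi_\infty^*$ of $\pi_\infty$ is spanned by the $t$ conjugate points $R,R^\sigma,\dots,R^{\sigma^{t-1}}$, $R=\nu\cap\pi_\infty^*$. For each divisor $s$ of $t$, let $\Lambda_s$ be the set of points of $\pi_\infty^*$ fixed by $\sigma^s$ and $\Sigma_s=\langle R,R^{\sigma^s},\dots,R^{\sigma^{t-s}}\rangle$; the Desarguesian $(s-1)$-spread $\mathcal{D}_s$ of $\pi_\infty$ consists of the spaces $\langle X,X^\sigma,\dots,X^{\sigma^{s-1}}\rangle\cap\pi_\infty$ for $X\in\Sigma_s\cap\Lambda_s$; for $D\in\mathcal{D}_s$ its extension $\overline{D}$ meets $\Sigma_s,\Sigma_s^\sigma,\dots,\Sigma_s^{\sigma^{s-1}}$ in $s$ conjugate points ($\mathcal{D}_t=\{\pi_\infty\}$, with conjugate points $R,\dots,R^{\sigma^{t-1}}$). The incidence structure $\mathcal{H}$ has as points the points of $\pi_\infty$; for distinct points $P,Q$ let $s$ be the smallest divisor of $t$ such that $P,Q$ lie in a common element $D$ of $\mathcal{D}_s$; the unique block through $P,Q$ is the set of points of $\pi_\infty$ on the normal rational curve of degree $s-1$ through $P$, $Q$ and the $s$ intersection points of $\overline{D}$ with $\Sigma_s,\dots,\Sigma_s^{\sigma^{s-1}}$. An $\mathcal{H}$-subspace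 is a set of points containing the block through any two of its points; the point-block geometry of $\mathcal{H}$ is that of the points and lines of $\mathrm{PG}(t-1,q)$, so $\mathcal{H}$-subspaces have dimensions as projective subspaces (an $\mathcal{H}$-subspace of dimension $d$ has $(q^{d+1}-1)/(q-1)$ points).
   Formalization: The condition that S contains P_∞ is added to the cone side of the equivalence: φ(S∖{P_∞}) does not determine whether P_∞ lies in S, so the converse fails literally for a club with P_∞ removed. *)

theory Defs
  imports "HOL-Analysis.Analysis"
begin

(* Conventions.  A projective space PG(V) is given by a vector space V with scalar multiplication sc.
   A projective subspace is represented by the underlying linear subspace, i.e. by a set of vectors,
   and a point is a one-dimensional linear subspace.  A set of points is a set of such subspaces.
   The field with q elements is a type 'k, its extension of degree t is a type 'K, and
   emb :: 'k => 'K is the inclusion. *)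

section \<open>Projective geometry\<close>

definition pg_subspace ::
  "('f::field \<Rightarrow> 'v::ab_group_add \<Rightarrow> 'v) \<Rightarrow> nat \<Rightarrow> 'v set \<Rightarrow> bool" where
  "pg_subspace sc d U \<longleftrightarrow> module.subspace sc U \<and> vector_space.dim sc U = d + 1"
  (* d is the projective dimension *)

definition pg_points ::
  "('f::field \<Rightarrow> 'v::ab_group_add \<Rightarrow> 'v) \<Rightarrow> 'v set \<Rightarrow> 'v set set" where
  "pg_points sc U = {X. pg_subspace sc 0 X \<and> X \<subseteq> U}"

definition proj_cone ::
  "('f::field \<Rightarrow> 'v::ab_group_add \<Rightarrow> 'v) \<Rightarrow> 'v set \<Rightarrow> 'v set set \<Rightarrow> 'v set set" where
  "proj_cone sc V K = (\<Union>X\<in>K. pg_points sc (module.span sc (V \<union> X)))"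

definition field_embedding :: "('k::field \<Rightarrow> 'K::field) \<Rightarrow> bool" where
  "field_embedding f \<longleftrightarrow>
     f 1 = 1 \<and> (\<forall>x y. f (x + y) = f x + f y) \<and> (\<forall>x y. f (x * y) = f x * f y)"

(* A collineation of PG(n-1,'K) is given by a bijective semilinear map f; it maps the subspace X
   to f ` X. *)
definition collineation :: "(('K::field)^'n \<Rightarrow> 'K^'n) \<Rightarrow> bool" where
  "collineation f \<longleftrightarrow> bij f \<and> (\<forall>x y. f (x + y) = f x + f y) \<and>
     (\<exists>\<theta>. field_embedding \<theta> \<and> bij \<theta> \<and> (\<forall>c x. f (c *s x) = \<theta> c *s f x))"

(* The image, under the projectivity given by v, of the standard curve consisting of the points
   (b^d, a b^(d-1), ..., a^d); it spans a d-dimensional projective subspace. *)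
definition normal_rational_curve :: "nat \<Rightarrow> (('K::field)^'n) set set \<Rightarrow> bool" where
  "normal_rational_curve d C \<longleftrightarrow>
     (\<exists>v :: nat \<Rightarrow> 'K^'n. inj_on v {..d} \<and> vec.independent (v ` {..d}) \<and>
        C = {vec.span {\<Sum>i\<le>d. (a ^ i * b ^ (d - i)) *s v i} | a b. (a, b) \<noteq> (0, 0)})"

context
  fixes emb :: "'k::field \<Rightarrow> 'K::field"
begin

section \<open>Field reduction, linear sets and clubs\<close>

definition sub_scale :: "'k \<Rightarrow> 'K^'r \<Rightarrow> 'K^'r" where
  "sub_scale c v = emb c *s v"

(* Field reduction maps a subspace to the same set of vectors, now regarded as a vector space under
   sub_scale; so it needs no notation on subspaces.  This is its effect on sets of points. *)
definition field_reduction :: "('K^'r) set set \<Rightarrow> ('K^'r) set set" where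
  "field_reduction S = (\<Union>P\<in>S. pg_points sub_scale P)"

(* The spread of the field reduction of the line l; its elements are vector sets. *)
definition desarguesian_spread :: "('K^'r) set \<Rightarrow> ('K^'r) set set" where
  "desarguesian_spread l = pg_points (*s) l"

definition spread_meeting :: "('K^'r) set \<Rightarrow> ('K^'r) set \<Rightarrow> ('K^'r) set set" where
  "spread_meeting l \<pi> = {D \<in> desarguesian_spread l. pg_points sub_scale (D \<inter> \<pi>) \<noteq> {}}"

(* S is the linear set L_pi of rank k on the line l. *)
definition is_linear_set ::
  "('K^'r) set \<Rightarrow> nat \<Rightarrow> ('K^'r) set \<Rightarrow> ('K^'r) set set \<Rightarrow> bool" where
  "is_linear_set l k \<pi> S \<longleftrightarrow>
     pg_subspace sub_scale (k - 1) \<pi> \<and> \<pi> \<subseteq> l \<and> S \<subseteq> pg_points (*s) l \<and>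
     field_reduction S = (\<Union>D\<in>spread_meeting l \<pi>. pg_points sub_scale D)"

(* The linear dimension, i.e. the projective dimension plus one. *)
definition weight :: "('K^'r) set \<Rightarrow> ('K^'r) set \<Rightarrow> nat" where
  "weight \<pi> P = vector_space.dim sub_scale (P \<inter> \<pi>)"

definition club_with_head ::
  "('K^'r) set \<Rightarrow> nat \<Rightarrow> ('K^'r) set set \<Rightarrow> ('K^'r) set \<Rightarrow> bool" where
  "club_with_head l k S H \<longleftrightarrow>
     (\<exists>\<pi>. is_linear_set l k \<pi> S \<and> H \<in> S \<and> weight \<pi> H = k - 1 \<and>
          (\<forall>P\<in>S - {H}. weight \<pi> P = 1))"

section \<open>Subgeometries and indicator sets\<close>

(* iota identifies the space U over 'k with a subgeometry of PG(n-1,'K): it is linear over 'k and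
   maps bases of U to bases of the whole space over 'K. *)
definition subgeometry_embedding :: "('K^'r) set \<Rightarrow> ('K^'r \<Rightarrow> 'K^'n) \<Rightarrow> bool" where
  "subgeometry_embedding U \<iota> \<longleftrightarrow>
     (\<forall>x\<in>U. \<forall>y\<in>U. \<iota> (x + y) = \<iota> x + \<iota> y) \<and>
     (\<forall>c. \<forall>x\<in>U. \<iota> (sub_scale c x) = sub_scale c (\<iota> x)) \<and>
     (\<forall>B\<subseteq>U. \<not> module.dependent sub_scale B \<longrightarrow> inj_on \<iota> B \<and> vec.independent (\<iota> ` B)) \<and>
     vec.span (\<iota> ` U) = UNIV"

definition extension :: "('K^'r \<Rightarrow> 'K^'n) \<Rightarrow> ('K^'r) set \<Rightarrow> ('K^'n) set" where
  "extension \<iota> X = vec.span (\<iota> ` X)"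

(* The intersection of the subspace Y over 'K with (the subgeometry given by) U. *)
definition subgeometry_part :: "('K^'r \<Rightarrow> 'K^'n) \<Rightarrow> ('K^'r) set \<Rightarrow> ('K^'n) set \<Rightarrow> ('K^'r) set" where
  "subgeometry_part \<iota> U Y = {v \<in> U. \<iota> v \<in> Y}"

definition fixes_subgeometry ::
  "('K^'r) set \<Rightarrow> ('K^'r \<Rightarrow> 'K^'n) \<Rightarrow> ('K^'n \<Rightarrow> 'K^'n) \<Rightarrow> bool" where
  "fixes_subgeometry U \<iota> f \<longleftrightarrow>
     (\<forall>X\<in>pg_points sub_scale U. f ` extension \<iota> X = extension \<iota> X)"

(* sigma generates the group of collineations fixing the subgeometry pointwise.  Collineations are
   compared by their action on points, since proportional semilinear maps give the same one. *)
definition subgeometry_generator ::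
  "('K^'r) set \<Rightarrow> ('K^'r \<Rightarrow> 'K^'n) \<Rightarrow> ('K^'n \<Rightarrow> 'K^'n) \<Rightarrow> bool" where
  "subgeometry_generator U \<iota> \<sigma> \<longleftrightarrow>
     collineation \<sigma> \<and> fixes_subgeometry U \<iota> \<sigma> \<and>
     (\<forall>f. collineation f \<and> fixes_subgeometry U \<iota> f \<longrightarrow>
          (\<exists>i. \<forall>X\<in>pg_points (*s) UNIV. f ` X = (\<sigma> ^^ i) ` X))"

(* The span of X, X^sigma, ..., X^(sigma^(m-1)). *)
definition conjugate_span :: "('K^'n \<Rightarrow> 'K^'n) \<Rightarrow> nat \<Rightarrow> ('K^'n) set \<Rightarrow> ('K^'n) set" where
  "conjugate_span \<sigma> m X = vec.span (\<Union>i<m. (\<sigma> ^^ i) ` X)"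

definition indicator_set ::
  "nat \<Rightarrow> ('K^'r) set \<Rightarrow> ('K^'r \<Rightarrow> 'K^'n) \<Rightarrow> ('K^'n \<Rightarrow> 'K^'n) \<Rightarrow> ('K^'n) set \<Rightarrow> bool" where
  "indicator_set t l \<iota> \<sigma> \<nu> \<longleftrightarrow>
     pg_subspace (*s) 1 \<nu> \<and>
     (\<forall>X\<in>pg_points sub_scale l. \<not> extension \<iota> X \<subseteq> \<nu>) \<and>
     desarguesian_spread l = (\<lambda>P. subgeometry_part \<iota> l (conjugate_span \<sigma> t P)) ` pg_points (*s) \<nu>"

section \<open>The design\<close>

(* Here p is the spread element on which the design lives. *)
context
  fixes t :: nat
    and \<iota> :: "'K^'r \<Rightarrow> 'K^'n"
    and \<sigma> :: "'K^'n \<Rightarrow> 'K^'n"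
    and \<nu> :: "('K^'n) set"
    and p :: "('K^'r) set"
begin

definition fixed_points :: "nat \<Rightarrow> ('K^'n) set set" where
  "fixed_points s = {X \<in> pg_points (*s) (extension \<iota> p). (\<sigma> ^^ s) ` X = X}"

(* The conjugates of R = nu Int extension p under the powers of sigma^s. *)
definition sigma_space :: "nat \<Rightarrow> ('K^'n) set" where
  "sigma_space s = conjugate_span (\<sigma> ^^ s) (t div s) (\<nu> \<inter> extension \<iota> p)"

definition subspread :: "nat \<Rightarrow> ('K^'r) set set" where
  "subspread s =
     (\<lambda>X. subgeometry_part \<iota> p (conjugate_span \<sigma> s X)) ` {X \<in> fixed_points s. X \<subseteq> sigma_space s}"

definition level :: "('K^'r) set \<Rightarrow> ('K^'r) set \<Rightarrow> nat" where
  "level P Q = (LEAST s. s dvd t \<and> (\<exists>D\<in>subspread s. P \<subseteq> D \<and> Q \<subseteq> D))"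

definition common_element :: "('K^'r) set \<Rightarrow> ('K^'r) set \<Rightarrow> ('K^'r) set" where
  "common_element P Q = (THE D. D \<in> subspread (level P Q) \<and> P \<subseteq> D \<and> Q \<subseteq> D)"

definition block_curve :: "('K^'r) set \<Rightarrow> ('K^'r) set \<Rightarrow> ('K^'n) set set" where
  "block_curve P Q =
     (THE C. normal_rational_curve (level P Q - 1) C \<and>
        extension \<iota> P \<in> C \<and> extension \<iota> Q \<in> C \<and>
        (\<forall>i<level P Q.
           extension \<iota> (common_element P Q) \<inter> (\<sigma> ^^ i) ` sigma_space (level P Q) \<in> C))"

definition block :: "('K^'r) set \<Rightarrow> ('K^'r) set \<Rightarrow> ('K^'r) set set" where
  "block P Q = {X \<in> pg_points sub_scale p. extension \<iota> X \<in> block_curve P Q}"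

definition H_subspace :: "('K^'r) set set \<Rightarrow> bool" where
  "H_subspace T \<longleftrightarrow> T \<subseteq> pg_points sub_scale p \<and>
     (\<forall>P\<in>T. \<forall>Q\<in>T. P \<noteq> Q \<longrightarrow> block P Q \<subseteq> T)"

(* As in any projective space: one less than the least number of points that generate T. *)
definition H_dim :: "('K^'r) set set \<Rightarrow> int" where
  "H_dim T = int (LEAST m. \<exists>A\<subseteq>T. finite A \<and> card A = m \<and> H_subspace hull A = T) - 1"

end

end

section \<open>The Andre/Bruck-Bose map\<close>

definition abb_map :: "('K^'r) set \<Rightarrow> ('K^'r) set \<Rightarrow> ('K^'r) set" where
  "abb_map \<mu> P = P \<inter> \<mu>"

end

theory Submission
  imports Defs "HOL-Computational_Algebra.Polynomial" "HOL-Computational_Algebra.Primes"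
    "HOL-Algebra.Sylow" "HOL-Algebra.FiniteProduct"
begin

text \<open>
  Identify \<open>\<pi>\<^sub>\<infinity>\<close> with the field \<open>K\<close> of order \<open>q ^ t\<close> over its subfield \<open>k\<close> of order \<open>q\<close>.  The automorphism
  \<open>\<theta>\<close> accompanying \<open>\<sigma>\<close> generates the automorphism group of \<open>K\<close> over \<open>k\<close>, and since the indicator line is a
  common transversal of the extended spread elements, the point \<open>R\<close> is one of the \<open>t\<close> eigenpoints of
  multiplication by elements of \<open>K\<close>.  Hence the extended point with coordinate \<open>y\<close> is
  \<open>(y, \<theta> y, \<dots>, (\<theta> ^^ (t - 1)) y)\<close> in a basis of conjugates of \<open>R\<close>.  The elements of \<open>\<D>\<^sub>s\<close> are
  then the lines over the fixed field of \<open>\<theta> ^^ s\<close>, the normal rational curves of the design are the images of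
  lines under \<open>y \<mapsto> 1 / y\<close>, and so the subspaces of the design are the sets \<open>{<1 / w> | w \<in> W, w \<noteq> 0}\<close> with
  \<open>W\<close> a subspace of \<open>K\<close> over \<open>k\<close>.

  A club with head \<open><h>\<close> that contains \<open>P\<^sub>\<infinity> = <v>\<close> comes from a space \<open>U h + k w\<close> with \<open>w\<close> a multiple of \<open>v\<close>; its
  points other than \<open>P\<^sub>\<infinity>\<close> are \<open><h>\<close> and the points \<open><h + w / u>\<close>, which is the same inversion.
\<close>

section \<open>Finite fields\<close>

text \<open>The curve and the common element in the design are given by definite descriptions, so a
  block can be computed only after existence and uniqueness are known. For the curve this is the
  classical fact that \<open>d + 3\<close> points in general position of a \<open>d\<close>-space
  carry exactly one normal rational curve; Lagrange interpolation of binary forms proves it.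

  That \<open>\<theta>\<close> generates the automorphism group is not assumed. Raising coordinates
  to the power \<open>q\<close> in a basis of the subgeometry gives a collineation fixing it
  pointwise, so the generator property of \<open>\<sigma>\<close> makes \<open>x ^ q\<close> a power
  of \<open>\<theta>\<close>, and counting roots and linear maps does the rest.

  The point \<open>R\<close> is only known to be some one of the \<open>t\<close> eigenpoints. A
  twist \<open>\<tau>\<close> of the coordinate, a power of \<open>\<theta>\<close>, makes it the
  first one; the twist is harmless in the end because it permutes the subspaces of \<open>K\<close>
  over \<open>k\<close> and keeps their sizes.

  The convention that the inverse of 0 is 0 carries meaning: the vector 0 of \<open>W\<close> then
  stands for the head of the club and for the vertex of the cone.\<close>

lemma (in vector_space) card_subspace:
  assumes "finite (UNIV :: 'a set)" and "finite U" and "subspace U"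
  shows "card U = CARD('a) ^ dim U"
proof -
  obtain B where B: "B \<subseteq> U" "independent B" "U \<subseteq> span B" "card B = dim U"
    by (rule basis_exists)
  have fB: "finite B" using B(1) assms(2) finite_subset by blast
  have spB: "span B = U" using B assms(3) span_minimal by blast
  have "bij_betw (\<lambda>c. \<Sum>b\<in>B. scale (c b) b) (B \<rightarrow>\<^sub>E UNIV) (span B)"
  proof (rule bij_betwI')
    fix c d :: "'b \<Rightarrow> 'a" assume cd: "c \<in> B \<rightarrow>\<^sub>E UNIV" "d \<in> B \<rightarrow>\<^sub>E UNIV"
    show "((\<Sum>b\<in>B. scale (c b) b) = (\<Sum>b\<in>B. scale (d b) b)) = (c = d)"
    proof
      assume "(\<Sum>b\<in>B. scale (c b) b) = (\<Sum>b\<in>B. scale (d b) b)"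
      hence "(\<Sum>b\<in>B. scale (c b - d b) b) = 0"
        by (simp add: scale_left_diff_distrib sum_subtractf)
      hence "\<forall>b\<in>B. c b - d b = 0"
        using independentD[OF B(2) fB subset_refl, of "\<lambda>b. c b - d b"] by blast
      thus "c = d" using cd by (intro PiE_ext[of c B "\<lambda>_. UNIV" d]) auto
    qed simp
  next
    fix c :: "'b \<Rightarrow> 'a"
    show "(\<Sum>b\<in>B. scale (c b) b) \<in> span B"
      by (intro span_sum span_scale span_base)
  next
    fix x assume "x \<in> span B"
    then obtain u where "x = (\<Sum>v\<in>B. scale (u v) v)"
      unfolding span_finite[OF fB] by auto
    thus "\<exists>c\<in>B \<rightarrow>\<^sub>E UNIV. x = (\<Sum>b\<in>B. scale (c b) b)"
      by (intro bexI[of _ "restrict u B"]) auto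
  qed
  hence "card (span B) = card (B \<rightarrow>\<^sub>E (UNIV :: 'a set))"
    by (simp add: bij_betw_same_card)
  thus ?thesis using card_PiE[OF fB, of "\<lambda>_. UNIV :: 'a set"] B(4) spB by simp
qed

text \<open>Multiplication by a nonzero \<open>x\<close> permutes the nonzero elements; comparing
  their product before and after gives \<open>x ^ (CARD('a) - 1) = 1\<close>.\<close>

lemma power_card_eq_same: "x ^ CARD('a) = (x :: 'a::{field,finite})"
proof (cases "x = 0")
  case False
  have "prod (\<lambda>y. x * y) (UNIV - {0}) = prod (\<lambda>y. y) (UNIV - {0})"
    by (rule prod.reindex_bij_witness[of _ "\<lambda>y. y / x" "\<lambda>y. x * y"]) (use False in auto)
  hence "x ^ (CARD('a) - 1) * prod (\<lambda>y. y) (UNIV - {0 :: 'a}) = prod (\<lambda>y. y) (UNIV - {0 :: 'a})"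
    by (simp add: prod.distrib)
  hence "x ^ (CARD('a) - 1) = 1" by simp
  thus ?thesis
    by (metis One_nat_def Suc_pred mult.right_neutral power_Suc zero_less_card_finite)
qed (simp add: power_0_left)

lemma prime_CHAR_finite_field: "prime CHAR('a::{field,finite})"
  by (intro prime_CHAR_semidom finite_imp_CHAR_pos) auto

text \<open>Cauchy's theorem, as the exponent 1 case of Sylow, in the additive group: a prime
  divisor \<open>r\<close> of the order yields a nonzero \<open>x\<close> with
  \<open>of_nat r * x = 0\<close>, so \<open>r\<close> is the characteristic. This is what makes the
  \<open>q\<close>-th power map additive.\<close>

lemma card_field_eq_CHAR_power:
  obtains n where "CARD('a::{field,finite}) = CHAR('a) ^ n"
proof -
  define G where "G = \<lparr> carrier = (UNIV :: 'a set), monoid.mult = (+), one = (0 :: 'a) \<rparr>"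
  interpret group G
    by (rule groupI) (auto simp: G_def add_ac intro: exI[of _ "- x" for x])
  have pow: "x [^]\<^bsub>G\<^esub> (n::nat) = of_nat n * x" for x n
    by (induction n) (auto simp: G_def nat_pow_def algebra_simps)
  have "r = CHAR('a)" if r: "prime r" "r dvd CARD('a)" for r
  proof (rule ccontr)
    assume ne: "r \<noteq> CHAR('a)"
    obtain m where m: "CARD('a) = r * m" using r(2) by (auto elim: dvdE)
    obtain H where H: "subgroup H G" "card H = r"
      using sylow_thm[OF r(1) is_group, of 1 m] m by (auto simp: order_def G_def)
    interpret HG: comm_group "G\<lparr>carrier := H\<rparr>"
      by (rule group.group_comm_groupI[OF subgroup_imp_group[OF H(1)]]) (simp add: G_def add.commute)
    have "H \<noteq> {0}" using H(2) r(1) by auto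
    moreover have "0 \<in> H" using subgroup.one_closed[OF H(1)] by (simp add: G_def)
    ultimately obtain x where x: "x \<in> H" "x \<noteq> 0" by auto
    have "x [^]\<^bsub>G\<lparr>carrier := H\<rparr>\<^esub> r = \<one>\<^bsub>G\<lparr>carrier := H\<rparr>\<^esub>"
      using HG.power_order_eq_one[of x] finite[of H] x H(2) by (simp add: order_def)
    hence "of_nat r * x = 0"
      using pow[of x r] nat_pow_consistent[of x r H] by (simp add: G_def)
    hence "CHAR('a) dvd r" using x by (simp add: of_nat_eq_0_iff_char_dvd)
    thus False
      using ne r(1) prime_CHAR_finite_field[where 'a='a] primes_dvd_imp_eq by blast
  qed
  hence sub: "prime_factors CARD('a) \<subseteq> {CHAR('a)}" by (auto simp: in_prime_factors_iff)
  have "CARD('a) = (\<Prod>p\<in>prime_factors CARD('a). p ^ multiplicity p CARD('a))"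
    by (intro prime_factorization_nat) simp
  also have "\<dots> = (\<Prod>p\<in>{CHAR('a)}. p ^ multiplicity p CARD('a))"
    using sub by (intro prod.mono_neutral_left) (auto simp: prime_factors_multiplicity prime_CHAR_finite_field)
  finally have "CARD('a) = CHAR('a) ^ multiplicity CHAR('a) CARD('a)" by simp
  thus thesis by (rule that)
qed

text \<open>Dedekind's independence of characters, with vector coefficients and modulo a subspace
  \<open>W\<close>. Subtracting \<open>ch j y\<close> times the relation at \<open>x\<close> from
  the relation at \<open>y * x\<close> removes the term of \<open>j\<close>. A span taken as
  \<open>W\<close> shows that it contains the coefficient vectors; a subfield taken as
  \<open>M\<close> suffices once the characters differ on it.\<close>

lemma (in vector_space) dedekind_independence:
  fixes ch :: "'i \<Rightarrow> 'm::monoid_mult \<Rightarrow> 'a"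
  assumes "finite I" and "subspace W"
    and M: "1 \<in> M" "\<And>x y. x \<in> M \<Longrightarrow> y \<in> M \<Longrightarrow> x * y \<in> M"
    and "\<And>i x y. i \<in> I \<Longrightarrow> ch i (x * y) = ch i x * ch i y" and "\<And>i. i \<in> I \<Longrightarrow> ch i 1 = 1"
    and "\<And>i j. i \<in> I \<Longrightarrow> j \<in> I \<Longrightarrow> i \<noteq> j \<Longrightarrow> \<exists>y\<in>M. ch i y \<noteq> ch j y"
    and "\<And>x. x \<in> M \<Longrightarrow> (\<Sum>i\<in>I. scale (ch i x) (h i)) \<in> W"
  shows "i \<in> I \<Longrightarrow> h i \<in> W"
  using assms(1,5-)
proof (induction I arbitrary: h i rule: finite_induct)
  case empty
  thus ?case by simp
next
  case (insert j I)
  have h: "h i \<in> W" if i: "i \<in> I" for i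
  proof -
    obtain y where y: "y \<in> M" "ch i y \<noteq> ch j y"
      using insert.prems(4)[of i j] insert.hyps(2) i by auto
    have "(\<Sum>i\<in>I. scale (ch i x) (scale (ch i y - ch j y) (h i))) \<in> W" if x: "x \<in> M" for x
    proof -
      have "(\<Sum>i\<in>insert j I. scale (ch i (y * x)) (h i))
          - scale (ch j y) (\<Sum>i\<in>insert j I. scale (ch i x) (h i)) \<in> W"
        by (rule subspace_diff[OF assms(2) insert.prems(5)[OF M(2)[OF y(1) x]]
              subspace_scale[OF assms(2) insert.prems(5)[OF x]]])
      moreover have "(\<Sum>i\<in>insert j I. scale (ch i (y * x)) (h i))
          - scale (ch j y) (\<Sum>i\<in>insert j I. scale (ch i x) (h i))
          = (\<Sum>i\<in>insert j I. scale (ch i x) (scale (ch i y - ch j y) (h i)))"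
        unfolding scale_sum_right sum_subtractf[symmetric]
        by (intro sum.cong refl)
          (simp add: insert.prems(2) scale_left_diff_distrib scale_right_diff_distrib mult.commute)
      ultimately show ?thesis using insert.hyps by simp
    qed
    hence "scale (ch i y - ch j y) (h i) \<in> W"
      using insert.IH[of i "\<lambda>i. scale (ch i y - ch j y) (h i)"] insert.prems i by auto
    hence "scale (inverse (ch i y - ch j y)) (scale (ch i y - ch j y) (h i)) \<in> W"
      by (rule subspace_scale[OF assms(2)])
    thus ?thesis using y by simp
  qed
  have "(\<Sum>i\<in>insert j I. scale (ch i 1) (h i)) \<in> W" using insert.prems(5)[OF M(1)] .
  hence "(h j + (\<Sum>i\<in>I. h i)) \<in> W"
    using insert.prems(3) insert.hyps by simp
  moreover have "(\<Sum>i\<in>I. h i) \<in> W" using h assms(2) by (intro subspace_sum) auto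
  ultimately have "h j \<in> W" 
    using subspace_diff[OF assms(2), of "h j + (\<Sum>i\<in>I. h i)" "\<Sum>i\<in>I. h i"] by simp
  thus ?case using h insert.prems(1) by auto
qed

section \<open>Automorphisms of a finite field over a subfield\<close>

locale field_extension =
  fixes emb :: "'k::{field,finite} \<Rightarrow> 'K::{field,finite}" and q t :: nat
  assumes card_base: "CARD('k) = q" and card_ext: "CARD('K) = q ^ t"
    and emb: "field_embedding emb" and t_pos: "t > 0"
begin

lemma emb_1 [simp]: "emb 1 = 1"
  and emb_add: "emb (a + b) = emb a + emb b"
  and emb_mult: "emb (a * b) = emb a * emb b"
  using emb by (auto simp: field_embedding_def)

lemma emb_0 [simp]: "emb 0 = 0"
  using emb_add[of 0 0] by (metis add.right_neutral add_cancel_left_right)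

lemma emb_uminus: "emb (- a) = - emb a"
  using emb_add[of a "- a"] by (simp add: eq_neg_iff_add_eq_0 add.commute)

lemma emb_diff: "emb (a - b) = emb a - emb b"
  using emb_add[of a "- b"] by (simp add: emb_uminus)

lemma emb_inverse: "emb (inverse a) = inverse (emb a)"
proof (cases "a = 0")
  case False
  hence "emb a * emb (inverse a) = 1" by (simp flip: emb_mult)
  thus ?thesis by (simp add: inverse_unique)
qed simp

lemma emb_eq_0_iff [simp]: "emb a = 0 \<longleftrightarrow> a = 0"
proof
  assume "emb a = 0"
  hence "emb (a * inverse a) = 0" by (simp only: emb_mult mult_zero_left)
  thus "a = 0" by (cases "a = 0") auto
qed simp

lemma emb_eq_iff [simp]: "emb a = emb b \<longleftrightarrow> a = b"
  using emb_diff[of a b] emb_eq_0_iff[of "a - b"] by auto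

lemma inj_emb: "inj emb"
  by (simp add: inj_on_def)

lemma q_gt_1: "q > 1"
proof -
  have "card {0, 1 :: 'k} \<le> CARD('k)" by (intro card_mono) auto
  thus ?thesis using card_base by simp
qed

text \<open>Bijectivity is left out: field homomorphisms are injective and the field is finite, see
  \<open>aut_bij\<close>.\<close>

definition aut :: "('K \<Rightarrow> 'K) \<Rightarrow> bool" where
  "aut \<theta> \<longleftrightarrow> field_embedding \<theta> \<and> (\<forall>c. \<theta> (emb c) = emb c)"

lemma aut_1: "aut \<theta> \<Longrightarrow> \<theta> 1 = 1"
  and aut_add: "aut \<theta> \<Longrightarrow> \<theta> (x + y) = \<theta> x + \<theta> y"
  and aut_mult: "aut \<theta> \<Longrightarrow> \<theta> (x * y) = \<theta> x * \<theta> y"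
  and aut_emb: "aut \<theta> \<Longrightarrow> \<theta> (emb c) = emb c"
  by (auto simp: aut_def field_embedding_def)

lemma aut_0: "aut \<theta> \<Longrightarrow> \<theta> 0 = 0"
  using aut_emb[of \<theta> 0] by simp

lemma aut_uminus: "aut \<theta> \<Longrightarrow> \<theta> (- x) = - \<theta> x"
  using aut_add[of \<theta> x "- x"] by (simp add: eq_neg_iff_add_eq_0 add.commute aut_0)

lemma aut_diff: "aut \<theta> \<Longrightarrow> \<theta> (x - y) = \<theta> x - \<theta> y"
  using aut_add[of \<theta> x "- y"] by (simp add: aut_uminus)

lemma aut_eq_0_iff: "aut \<theta> \<Longrightarrow> \<theta> x = 0 \<longleftrightarrow> x = 0"
  using aut_mult[of \<theta> x "inverse x"] aut_1[of \<theta>] by (cases "x = 0") (auto simp: aut_0)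

lemma aut_inverse: "aut \<theta> \<Longrightarrow> \<theta> (inverse x) = inverse (\<theta> x)"
  using aut_mult[of \<theta> x "inverse x"] aut_1[of \<theta>]
  by (cases "x = 0") (auto simp: aut_0 inverse_unique)

lemma aut_divide: "aut \<theta> \<Longrightarrow> \<theta> (x / y) = \<theta> x / \<theta> y"
  by (simp add: divide_inverse aut_mult aut_inverse)

lemma aut_inj: "aut \<theta> \<Longrightarrow> inj \<theta>"
  using aut_diff[of \<theta>] aut_eq_0_iff[of \<theta>] by (metis eq_iff_diff_eq_0 injI)

lemma aut_bij: "aut \<theta> \<Longrightarrow> bij \<theta>"
  by (simp add: aut_inj bij_def finite_UNIV_inj_surj)

lemma aut_funpow: "aut \<theta> \<Longrightarrow> aut (\<theta> ^^ n)"
  by (induction n) (auto simp: aut_def field_embedding_def)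

lemma funpow_id_mod:
  assumes "f ^^ n = id"
  shows "f ^^ m = f ^^ (m mod n)"
proof -
  have "f ^^ m = f ^^ (n * (m div n) + m mod n)" by simp
  also have "\<dots> = ((f ^^ n) ^^ (m div n)) \<circ> f ^^ (m mod n)"
    by (simp only: funpow_add funpow_mult)
  finally show ?thesis by (simp add: assms)
qed

text \<open>Additivity is the freshman's dream, since \<open>q\<close> is a power of the common
  characteristic of both fields; elements of the base field are roots of
  \<open>X^q - X\<close>.\<close>

lemma aut_frobenius: "aut (\<lambda>x. x ^ q)"
proof -
  obtain n where n: "CARD('k) = CHAR('k) ^ n" by (rule card_field_eq_CHAR_power)
  have emb_nat: "emb (of_nat m) = of_nat m" for m by (induction m) (auto simp: emb_add)
  have "CHAR('K) = CHAR('k)"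
  proof (rule CHAR_eqI)
    show "of_nat CHAR('k) = (0 :: 'K)" using emb_nat[of "CHAR('k)"] by simp
    show "CHAR('k) dvd x" if "of_nat x = (0 :: 'K)" for x
      using emb_nat[of x] that by (simp add: of_nat_eq_0_iff_char_dvd)
  qed
  hence "(x + y) ^ q = x ^ q + y ^ q" for x y :: 'K
    using n card_base by (intro freshmans_dream' prime_CHAR_finite_field) auto
  moreover have "emb c ^ q = emb c" for c
  proof -
    have "emb (c ^ m) = emb c ^ m" for m by (induction m) (auto simp: emb_mult)
    from this[of q] show ?thesis using power_card_eq_same[of c] card_base by simp
  qed
  ultimately show ?thesis by (simp add: aut_def field_embedding_def power_mult_distrib)
qed

lemma funpow_frobenius: "((\<lambda>x. x ^ q) ^^ i) x = (x :: 'K) ^ (q ^ i)"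
  by (induction i) (auto simp flip: power_mult simp: mult.commute)

lemma card_power_fixed:
  assumes "n > 1"
  shows "card {x :: 'K. x ^ n = x} \<le> n"
proof -
  let ?p = "monom 1 n - monom 1 1 :: 'K poly"
  have c: "coeff ?p n = 1" using assms by simp
  have "card {x. poly ?p x = 0} \<le> degree ?p"
    by (rule card_poly_roots_bound) (use c in \<open>metis coeff_0 zero_neq_one\<close>)
  also have "\<dots> \<le> n" using assms by (intro degree_diff_le) (auto simp: degree_monom_eq)
  finally show ?thesis by (simp add: poly_monom)
qed

text \<open>The polynomial \<open>X^q - X\<close> has at most \<open>q\<close> roots, and the base
  field already supplies that many.\<close>

lemma frobenius_fixed:
  assumes "x ^ q = (x :: 'K)"
  shows "x \<in> range emb"
proof -
  have "range emb \<subseteq> {x. x ^ q = x}" using aut_emb[OF aut_frobenius] by auto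
  moreover have "card {x :: 'K. x ^ q = x} \<le> card (range emb)"
    using card_power_fixed[OF q_gt_1] card_base inj_emb by (simp add: card_image)
  ultimately have "range emb = {x. x ^ q = x}" by (intro card_seteq) auto
  thus ?thesis using assms by simp
qed

sublocale over_base: vector_space "\<lambda>c x. emb c * x"
  by unfold_locales (auto simp: emb_add emb_mult algebra_simps)

definition base_linear :: "('K \<Rightarrow> 'K) \<Rightarrow> bool" where
  "base_linear f \<longleftrightarrow> (\<forall>x y. f (x + y) = f x + f y) \<and> (\<forall>c x. f (emb c * x) = emb c * f x)"

text \<open>A linear map is determined by its values on a basis of \<open>t\<close> elements.
  Combinations of automorphisms will turn out to attain the bound.\<close>

lemma card_base_linear: "card {f. base_linear f} \<le> CARD('K) ^ t"
proof -
  obtain B where B: "over_base.independent B" "UNIV \<subseteq> over_base.span B" "card B = over_base.dim UNIV"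
    by (rule over_base.basis_exists[of UNIV])
  have "q ^ over_base.dim UNIV = q ^ t"
    using over_base.card_subspace[of UNIV] card_base card_ext by simp
  hence cB: "card B = t" using B(3) q_gt_1 by simp
  have "inj_on (\<lambda>f. restrict f B) {f. base_linear f}"
  proof (rule inj_onI, clarify)
    fix f g assume f: "base_linear f" and g: "base_linear g" and eq: "restrict f B = restrict g B"
    have "f x = g x" for x
    proof -
      have "x \<in> over_base.span B" using B(2) by auto
      thus ?thesis
      proof (induction rule: over_base.span_induct_alt)
        case base
        have "f 0 = 0" "g 0 = 0" using f g unfolding base_linear_def by (metis add_cancel_right_right)+
        thus ?case by simp
      next
        case (step c x y)
        have "f x = g x" using eq step(1) by (metis restrict_apply')
        thus ?case using f g step by (simp add: base_linear_def)
      qed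
    qed
    thus "f = g" by auto
  qed
  moreover have "(\<lambda>f. restrict f B) ` {f. base_linear f} \<subseteq> B \<rightarrow>\<^sub>E (UNIV :: 'K set)" by auto
  ultimately have "card {f. base_linear f} \<le> card (B \<rightarrow>\<^sub>E (UNIV :: 'K set))"
    by (intro card_inj_on_le finite_PiE) auto
  thus ?thesis using card_PiE[of B "\<lambda>_. UNIV :: 'K set"] cB by simp
qed

lemma base_linear_sum_aut:
  assumes "\<And>i. i \<in> I \<Longrightarrow> aut (ch i)"
  shows "base_linear (\<lambda>x. \<Sum>i\<in>I. ch i x * c i)"
  unfolding base_linear_def sum_distrib_left sum.distrib[symmetric]
  by (auto simp: aut_add[OF assms] aut_mult[OF assms] aut_emb[OF assms] distrib_right mult.assoc
      intro!: sum.cong)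

lemma aut_combinations:
  assumes I: "finite I" and "inj_on ch I" and aut: "\<And>i. i \<in> I \<Longrightarrow> aut (ch i)"
  shows "inj_on (\<lambda>c x. \<Sum>i\<in>I. ch i x * c i) (I \<rightarrow>\<^sub>E UNIV)"
proof (rule inj_onI)
  fix c d :: "'a \<Rightarrow> 'K"
  assume cd: "c \<in> I \<rightarrow>\<^sub>E UNIV" "d \<in> I \<rightarrow>\<^sub>E UNIV"
    and eq: "(\<lambda>x. \<Sum>i\<in>I. ch i x * c i) = (\<lambda>x. \<Sum>i\<in>I. ch i x * d i)"
  have "(\<Sum>i\<in>I. ch i x * (c i - d i)) = 0" for x
    using fun_cong[OF eq, of x] by (simp add: algebra_simps sum_subtractf)
  moreover have "\<exists>y\<in>UNIV. ch i y \<noteq> ch j y" if "i \<in> I" "j \<in> I" "i \<noteq> j" for i j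
    using inj_onD[OF assms(2) _ that(1,2)] that(3) by auto
  ultimately have "c i - d i \<in> {0}" if "i \<in> I" for i
    using vector_space_over_itself.dedekind_independence[of I "{0}" UNIV ch "\<lambda>i. c i - d i" i] that assms
    by (auto simp: aut_mult aut_1 vector_space_over_itself.subspace_0 vector_space_over_itself.subspace_single_0)
  thus "c = d" using cd by (intro PiE_ext[of c I "\<lambda>_. UNIV" d]) auto
qed

text \<open>By Dedekind's lemma, different coefficient families give different linear maps, so
  \<open>CARD('K) ^ card I\<close> is at most the number of all linear maps.\<close>

lemma card_auts_le:
  assumes I: "finite I" and "inj_on ch I" and aut: "\<And>i. i \<in> I \<Longrightarrow> aut (ch i)"
  shows "card I \<le> t"
proof -
  have "card (I \<rightarrow>\<^sub>E (UNIV :: 'K set)) \<le> card {f. base_linear f}"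
    using aut_combinations[OF assms] base_linear_sum_aut[of I ch] aut
    by (intro card_inj_on_le[of "\<lambda>c x. \<Sum>i\<in>I. ch i x * c i"]) auto
  hence "CARD('K) ^ card I \<le> CARD('K) ^ t"
    using card_base_linear card_PiE[OF I, of "\<lambda>_. UNIV :: 'K set"] by simp
  moreover have "CARD('K) > 1" using q_gt_1 t_pos card_ext one_less_power by metis
  ultimately show ?thesis by (blast intro: power_le_imp_le_exp)
qed

end

text \<open>The order of \<open>\<theta>\<close> is not prescribed. That the Frobenius map is one of
  its powers is what the generator property of the collineation delivers, and it forces both the
  order \<open>t\<close> and the fixed field \<open>range emb\<close>.\<close>

locale cyclic_extension = field_extension emb q t
  for emb :: "'k::{field,finite} \<Rightarrow> 'K::{field,finite}" and q t :: nat +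
  fixes \<theta> :: "'K \<Rightarrow> 'K"
  assumes aut_theta: "aut \<theta>" and frobenius: "\<exists>i. \<forall>x. x ^ q = (\<theta> ^^ i) x"
begin

lemma aut_power: "aut (\<theta> ^^ i)"
  using aut_theta by (rule aut_funpow)

lemmas th_add = aut_add[OF aut_power] and th_mult = aut_mult[OF aut_power]
  and th_1 = aut_1[OF aut_power] and th_0 = aut_0[OF aut_power] and th_emb = aut_emb[OF aut_power]
 
  and th_divide = aut_divide[OF aut_power] and th_eq_0_iff = aut_eq_0_iff[OF aut_power]

lemma fixed_in_base:
  assumes "\<theta> x = x"
  shows "x \<in> range emb"
proof -
  obtain i where i: "\<forall>x. x ^ q = (\<theta> ^^ i) x" using frobenius by auto
  have "(\<theta> ^^ i) x = x" using assms by (induction i) auto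
  thus ?thesis using i frobenius_fixed by metis
qed

text \<open>A trivial power \<open>\<theta> ^^ j\<close> makes the \<open>j\<close>-th power of
  Frobenius trivial as well, and then \<open>X^(q^j) - X\<close> would have \<open>q ^ t\<close>
  roots.\<close>

lemma power_ne_id:
  assumes "0 < j" "j < t"
  shows "\<theta> ^^ j \<noteq> id"
proof
  assume j: "\<theta> ^^ j = id"
  obtain i where i: "\<forall>x. x ^ q = (\<theta> ^^ i) x" using frobenius by auto
  hence "(\<lambda>x. x ^ q) = \<theta> ^^ i" by auto
  hence "((\<lambda>x. x ^ q) ^^ j) = (\<theta> ^^ j) ^^ i" by (simp add: funpow_mult mult.commute)
  hence "x ^ (q ^ j) = x" for x :: 'K using j funpow_frobenius[of j x] by simp
  hence "{x :: 'K. x ^ (q ^ j) = x} = UNIV" by auto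
  moreover have "q ^ j > 1" using q_gt_1 assms one_less_power by blast
  ultimately have "CARD('K) \<le> q ^ j" using card_power_fixed by metis
  thus False using assms q_gt_1 card_ext by simp
qed

lemma inj_on_powers: "inj_on (\<lambda>i. \<theta> ^^ i) {..<t}"
proof -
  have "False" if "i < j" "j < t" "\<theta> ^^ i = \<theta> ^^ j" for i j
  proof -
    have "\<theta> ^^ i \<circ> \<theta> ^^ (j - i) = \<theta> ^^ i"
      unfolding funpow_add[symmetric] using that by simp
    hence "(\<theta> ^^ i) ((\<theta> ^^ (j - i)) x) = (\<theta> ^^ i) x" for x by (metis comp_apply)
    hence "\<theta> ^^ (j - i) = id" using aut_inj[OF aut_power[of i]] by (auto simp: inj_def)
    thus False using power_ne_id[of "j - i"] that by simp
  qed
  thus ?thesis by (intro linorder_inj_onI) force+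
qed

text \<open>The \<open>t + 1\<close> powers up to \<open>t\<close> cannot all differ, while the
  first \<open>t\<close> do. If power \<open>t\<close> equals power \<open>j\<close>, then power
  \<open>t - j\<close> is trivial, and so \<open>j = 0\<close>.\<close>

lemma power_t: "\<theta> ^^ t = id"
proof -
  have "\<not> inj_on (\<lambda>i. \<theta> ^^ i) {..t}"
    using card_auts_le[of "{..t}" "\<lambda>i. \<theta> ^^ i"] aut_power by auto
  then obtain j where j: "j < t" "\<theta> ^^ t = \<theta> ^^ j"
    using inj_on_powers by (auto simp: lessThan_Suc_atMost[symmetric] lessThan_Suc)
  have "\<theta> ^^ j \<circ> \<theta> ^^ (t - j) = \<theta> ^^ j"
    unfolding funpow_add[symmetric] using j by simp
  hence "(\<theta> ^^ j) ((\<theta> ^^ (t - j)) x) = (\<theta> ^^ j) x" for x by (metis comp_apply)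
  hence "\<theta> ^^ (t - j) = id" using aut_inj[OF aut_power[of j]] by (auto simp: inj_def)
  thus ?thesis using power_ne_id[of "t - j"] j by (cases "j = 0") auto
qed

lemma power_mod_t: "\<theta> ^^ i = \<theta> ^^ (i mod t)"
  using power_t by (rule funpow_id_mod)

text \<open>The combinations of the \<open>t\<close> powers of \<open>\<theta>\<close> are pairwise
  different and number \<open>CARD('K) ^ t\<close>, so they exhaust the linear maps.\<close>

lemma base_linear_expansion:
  assumes "base_linear f"
  obtains c where "\<And>x. f x = (\<Sum>i<t. (\<theta> ^^ i) x * c i)"
proof -
  let ?F = "\<lambda>c x. \<Sum>i<t. (\<theta> ^^ i) x * c i"
  let ?E = "{..<t} \<rightarrow>\<^sub>E (UNIV :: 'K set)"
  have "inj_on ?F ?E" by (intro aut_combinations inj_on_powers aut_power) auto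
  hence "card (?F ` ?E) = CARD('K) ^ t" using card_PiE[of "{..<t}" "\<lambda>_. UNIV :: 'K set"] by (simp add: card_image)
  hence "?F ` ?E = {f. base_linear f}"
    using card_base_linear base_linear_sum_aut[OF aut_power] by (intro card_seteq) auto
  hence "f \<in> ?F ` ?E" using assms by simp
  thus thesis using that by auto
qed

text \<open>Applied to the embedding of a spread element, this produces the vectors
  \<open>w i\<close> that span its conjugate points.\<close>

lemma base_linear_vec_expansion:
  fixes f :: "'K \<Rightarrow> 'K^'n"
  assumes "\<And>x y. f (x + y) = f x + f y" and "\<And>c x. f (emb c * x) = emb c *s f x"
  obtains w where "\<And>x. f x = (\<Sum>i<t. (\<theta> ^^ i) x *s w i)"
proof -
  have "\<forall>m. \<exists>c. \<forall>x. f x $ m = (\<Sum>i<t. (\<theta> ^^ i) x * c i)"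
  proof
    fix m
    have "base_linear (\<lambda>x. f x $ m)" using assms by (simp add: base_linear_def)
    then obtain c where "\<And>x. f x $ m = (\<Sum>i<t. (\<theta> ^^ i) x * c i)"
      by (rule base_linear_expansion) auto
    thus "\<exists>c. \<forall>x. f x $ m = (\<Sum>i<t. (\<theta> ^^ i) x * c i)" by auto
  qed
  then obtain c where "\<And>m x. f x $ m = (\<Sum>i<t. (\<theta> ^^ i) x * c m i)" by metis
  thus thesis by (intro that[of "\<lambda>i. \<chi> m. c m i"]) (simp add: vec_eq_iff)
qed

lemma sum_powers_in_subspace:
  fixes h :: "nat \<Rightarrow> 'K^'n"
  assumes "vec.subspace W" and "\<And>x. (\<Sum>i<t. (\<theta> ^^ i) x *s h i) \<in> W" and "i < t"
  shows "h i \<in> W"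
proof -
  have "\<exists>y\<in>UNIV. (\<theta> ^^ i) y \<noteq> (\<theta> ^^ j) y" if "i \<in> {..<t}" "j \<in> {..<t}" "i \<noteq> j" for i j
    using inj_onD[OF inj_on_powers _ that(1,2)] that(3) by auto
  thus ?thesis
    using vec.dedekind_independence[of "{..<t}" W UNIV "\<lambda>i. \<theta> ^^ i" h i] assms
    by (auto simp: th_mult th_1)
qed

end

section \<open>Normal rational curves\<close>

lemma span_singleton_eq_iff:
  fixes x y :: "('a::field)^'n"
  assumes "x \<noteq> 0"
  shows "vec.span {x} = vec.span {y} \<longleftrightarrow> (\<exists>c. c \<noteq> 0 \<and> x = c *s y)"
proof
  assume "vec.span {x} = vec.span {y}"
  hence "x \<in> vec.span {y}" using vec.span_base[of x "{x}"] by simp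
  thus "\<exists>c. c \<noteq> 0 \<and> x = c *s y" using assms by (auto simp: vec.span_singleton)
next
  assume "\<exists>c. c \<noteq> 0 \<and> x = c *s y"
  then obtain c where c: "c \<noteq> 0" "x = c *s y" by auto
  have "a *s y = (a / c) *s x" for a using c by simp
  hence "a *s y \<in> range (\<lambda>k. k *s x)" for a by blast
  moreover have "a *s x \<in> range (\<lambda>k. k *s y)" for a using c by auto
  ultimately show "vec.span {x} = vec.span {y}" unfolding vec.span_singleton by auto
qed

lemma span_singleton_scale:
  "c \<noteq> 0 \<Longrightarrow> vec.span {c *s (y :: ('a::field)^'n)} = vec.span {y}"
  by (cases "y = 0") (auto simp: span_singleton_eq_iff)

section \<open>Binary forms and Lagrange interpolation\<close>

definition form :: "nat \<Rightarrow> ('a::field \<Rightarrow> 'a \<Rightarrow> 'a) \<Rightarrow> bool" where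
  "form d F \<longleftrightarrow> (\<exists>c. \<forall>a b. F a b = (\<Sum>i\<le>d. c i * (a ^ i * b ^ (d - i))))"

lemma form_monomials: "form d (\<lambda>a b. \<Sum>i\<le>d. (a ^ i * b ^ (d - i)) * c i)"
  unfolding form_def by (intro exI[of _ c]) (simp add: mult.commute)

lemma form_diff: "form d F \<Longrightarrow> form d G \<Longrightarrow> form d (\<lambda>a b. F a b - G a b)"
  unfolding form_def
proof (elim exE)
  fix c c' assume "\<forall>a b. F a b = (\<Sum>i\<le>d. c i * (a ^ i * b ^ (d - i)))"
    "\<forall>a b. G a b = (\<Sum>i\<le>d. c' i * (a ^ i * b ^ (d - i)))"
  thus "\<exists>c. \<forall>a b. F a b - G a b = (\<Sum>i\<le>d. c i * (a ^ i * b ^ (d - i)))"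
    by (intro exI[of _ "\<lambda>i. c i - c' i"]) (simp add: left_diff_distrib sum_subtractf)
qed

lemma form_sum:
  assumes "finite J" and "\<And>j. j \<in> J \<Longrightarrow> form d (F j)"
  shows "form d (\<lambda>a b. \<Sum>j\<in>J. k j * F j a b)"
proof -
  have "\<forall>j\<in>J. \<exists>c. \<forall>a b. F j a b = (\<Sum>i\<le>d. c i * (a ^ i * b ^ (d - i)))"
    using assms(2) by (simp add: form_def)
  then obtain c where c: "\<And>j a b. j \<in> J \<Longrightarrow> F j a b = (\<Sum>i\<le>d. c j i * (a ^ i * b ^ (d - i)))"
    by metis
  have "(\<Sum>j\<in>J. k j * F j a b) = (\<Sum>i\<le>d. (\<Sum>j\<in>J. k j * c j i) * (a ^ i * b ^ (d - i)))" for a b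
    using sum.swap[of "\<lambda>i j. k j * c j i * (a ^ i * b ^ (d - i))" J "{..d}"]
    by (simp add: c sum_distrib_left sum_distrib_right mult.assoc)
  thus ?thesis
    unfolding form_def by (intro exI[of _ "\<lambda>i. \<Sum>j\<in>J. k j * c j i"]) simp
qed

lemma form_linear_mult:
  assumes "form d F"
  shows "form (Suc d) (\<lambda>a b. (u * a + v * b) * F a b)"
proof -
  obtain c where c: "\<And>a b. F a b = (\<Sum>i\<le>d. c i * (a ^ i * b ^ (d - i)))"
    using assms by (auto simp: form_def)
  define e where "e i = (if i = 0 then 0 else u * c (i - 1)) + (if i \<le> d then v * c i else 0)" for i
  have "(u * a + v * b) * F a b = (\<Sum>i\<le>Suc d. e i * (a ^ i * b ^ (Suc d - i)))" for a b
  proof -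
    have "(\<Sum>i\<le>Suc d. e i * (a ^ i * b ^ (Suc d - i)))
        = (\<Sum>i\<le>Suc d. (if i = 0 then 0 else u * c (i - 1)) * (a ^ i * b ^ (Suc d - i)))
        + (\<Sum>i\<le>Suc d. (if i \<le> d then v * c i else 0) * (a ^ i * b ^ (Suc d - i)))"
      by (simp only: e_def distrib_right sum.distrib)
    also have "(\<Sum>i\<le>Suc d. (if i = 0 then 0 else u * c (i - 1)) * (a ^ i * b ^ (Suc d - i)))
        = (\<Sum>i\<le>d. u * a * (c i * (a ^ i * b ^ (d - i))))"
      by (subst sum.atMost_Suc_shift) (simp add: mult_ac)
    also have "(\<Sum>i\<le>Suc d. (if i \<le> d then v * c i else 0) * (a ^ i * b ^ (Suc d - i)))
        = (\<Sum>i\<le>d. v * b * (c i * (a ^ i * b ^ (d - i))))"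
      unfolding sum.atMost_Suc by (simp, intro sum.cong refl) (simp add: Suc_diff_le mult_ac)
    finally show ?thesis by (simp only: c distrib_right sum_distrib_left sum.distrib)
  qed
  thus ?thesis unfolding form_def by blast
qed

lemma form_prod:
  "finite I \<Longrightarrow> form (card I) (\<lambda>a b. \<Prod>i\<in>I. u i * a + v i * b)"
proof (induction I rule: finite_induct)
  case empty
  thus ?case by (auto simp: form_def intro: exI[of _ "\<lambda>_. 1"])
next
  case (insert j I)
  thus ?case using form_linear_mult[OF insert.IH, of "u j" "v j"] by simp
qed

text \<open>Dehomogenise at the points with \<open>b \<noteq> 0\<close>. If all \<open>d + 1\<close>
  points are affine, a polynomial of degree at most \<open>d\<close> has too many roots. A point at
  infinity annihilates the top coefficient, and the remaining \<open>d\<close> affine roots are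
  again too many.\<close>

lemma form_eq_0:
  assumes F: "form d F"
    and pts: "\<And>i j. i \<le> d \<Longrightarrow> j \<le> d \<Longrightarrow> i \<noteq> j \<Longrightarrow> a i * b j \<noteq> a j * b i"
    and nz: "\<And>i. i \<le> d \<Longrightarrow> (a i, b i) \<noteq> (0, 0)"
    and F0: "\<And>i. i \<le> d \<Longrightarrow> F (a i) (b i) = 0"
  shows "F x y = (0 :: 'a::field)"
proof -
  obtain c where c: "\<And>a b. F a b = (\<Sum>i\<le>d. c i * (a ^ i * b ^ (d - i)))"
    using F by (auto simp: form_def)
  define p where "p = (\<Sum>i\<le>d. monom (c i) i)"
  have coeff_p: "coeff p i = (if i \<le> d then c i else 0)" for i
    by (simp add: p_def coeff_sum)
  have poly_p: "F a b = b ^ d * poly p (a / b)" if "b \<noteq> 0" for a b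
    using that unfolding c p_def poly_sum poly_monom sum_distrib_left
    by (intro sum.cong refl) (simp add: power_divide power_diff)
  define J where "J = {i. i \<le> d \<and> b i \<noteq> 0}"
  have inj: "inj_on (\<lambda>i. a i / b i) J"
    using pts by (intro inj_onI) (auto simp: J_def field_simps)
  have "finite J" by (simp add: J_def)
  have roots: "(\<lambda>i. a i / b i) ` J \<subseteq> {x. poly p x = 0}"
  proof (clarsimp simp: J_def)
    fix i assume "i \<le> d" "b i \<noteq> 0"
    thus "poly p (a i / b i) = 0" using poly_p[of "b i" "a i"] F0[of i] by simp
  qed
  have p0: "p = 0" if "degree p < card J"
  proof (rule ccontr)
    assume "p \<noteq> 0"
    hence "card {x. poly p x = 0} \<le> degree p" by (rule card_poly_roots_bound)
    moreover have "card J \<le> card {x. poly p x = 0}"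
      using card_mono[OF poly_roots_finite[OF \<open>p \<noteq> 0\<close>] roots] card_image[OF inj] by simp
    ultimately show False using that by simp
  qed
  have "p = 0"
  proof (cases "\<exists>m\<le>d. b m = 0")
    case False
    hence "J = {..d}" by (auto simp: J_def)
    moreover have "degree p \<le> d" by (intro degree_le) (simp add: coeff_p)
    ultimately show ?thesis using p0 by simp
  next
    case True
    then obtain m where m: "m \<le> d" "b m = 0" by auto
    hence am: "a m \<noteq> 0" using nz by auto
    have um: "i = m" if "i \<le> d" "b i = 0" for i using pts[OF that(1) m(1)] that m by auto
    have J: "J = {..d} - {m}" using m by (auto simp: J_def dest: um)
    \<comment> \<open>At the point at infinity only the monomial \<open>a ^ d\<close> survives, as
      \<open>0 ^ 0 = 1\<close>.\<close>
    have "(\<Sum>i\<le>d. c i * (a m ^ i * b m ^ (d - i))) = (\<Sum>i\<in>{d}. c i * (a m ^ i * b m ^ (d - i)))"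
      using m by (intro sum.mono_neutral_right) (auto simp: power_0_left)
    hence "c d = 0" using F0[OF m(1)] am by (simp add: c)
    hence cp: "coeff p i = 0" if "i \<ge> d" for i using that by (auto simp: coeff_p)
    show ?thesis
    proof (cases d)
      case 0
      thus ?thesis using cp by (auto simp: poly_eq_iff)
    next
      case (Suc d')
      hence "degree p \<le> d'" using cp by (intro degree_le) auto
      thus ?thesis using p0 J m Suc by simp
    qed
  qed
  hence "c i = 0" if "i \<le> d" for i using coeff_p[of i] that by simp
  thus ?thesis by (simp add: c)
qed

text \<open>The product of the factors \<open>x * b i - y * a i\<close> over
  \<open>i \<noteq> j\<close> vanishes at every node except the \<open>j\<close>-th: these are the
  homogeneous Lagrange basis forms. The difference of both sides is a form with \<open>d + 1\<close>
  zeros.\<close>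

lemma form_lagrange:
  assumes F: "form d F"
    and pts: "\<And>i j. i \<le> d \<Longrightarrow> j \<le> d \<Longrightarrow> i \<noteq> j \<Longrightarrow> a i * b j \<noteq> a j * b i"
    and nz: "\<And>i. i \<le> d \<Longrightarrow> (a i, b i) \<noteq> (0, 0)"
  shows "F x y = (\<Sum>j\<le>d. (F (a j) (b j) / (\<Prod>i\<in>{..d}-{j}. a j * b i - b j * a i))
      * (\<Prod>i\<in>{..d}-{j}. x * b i - y * a i))"
proof -
  define k where "k j = F (a j) (b j) / (\<Prod>i\<in>{..d}-{j}. a j * b i - b j * a i)" for j
  define L where "L j x y = (\<Prod>i\<in>{..d}-{j}. x * b i - y * a i)" for j x y
  have "form d (L j)" if "j \<le> d" for j
    using form_prod[of "{..d}-{j}" b "\<lambda>i. - a i"] that by (simp add: L_def[abs_def] mult.commute)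
  hence fm: "form d (\<lambda>x y. F x y - (\<Sum>j\<le>d. k j * L j x y))"
    by (intro form_diff form_sum F) auto
  have van: "F (a m) (b m) - (\<Sum>j\<le>d. k j * L j (a m) (b m)) = 0" if m: "m \<le> d" for m
  proof -
    have "L j (a m) (b m) = 0" if "j \<noteq> m" for j
      using m that unfolding L_def by (intro prod_zero bexI[of _ m]) (auto simp: mult.commute)
    hence "(\<Sum>j\<le>d. k j * L j (a m) (b m)) = (\<Sum>j\<in>{m}. k j * L j (a m) (b m))"
      using m by (intro sum.mono_neutral_right) auto
    moreover have "L m (a m) (b m) \<noteq> 0"
      using pts[OF m] by (auto simp: L_def mult.commute)
    ultimately show ?thesis by (simp add: k_def L_def)
  qed
  have "F x y - (\<Sum>j\<le>d. k j * L j x y) = 0"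
    by (rule form_eq_0[where F = "\<lambda>x y. F x y - (\<Sum>j\<le>d. k j * L j x y)" and a = a and b = b, OF fm])
      (erule (2) pts, erule nz, erule van)
  thus ?thesis by (simp add: k_def L_def)
qed

definition rational_curve_point :: "nat \<Rightarrow> (nat \<Rightarrow> ('a::field)^'n) \<Rightarrow> 'a \<Rightarrow> 'a \<Rightarrow> 'a^'n" where
  "rational_curve_point d v a b = (\<Sum>i\<le>d. (a ^ i * b ^ (d - i)) *s v i)"

lemma rational_curve_point_lagrange:
  fixes v :: "nat \<Rightarrow> ('a::field)^'n"
  assumes "\<And>i j. i \<le> d \<Longrightarrow> j \<le> d \<Longrightarrow> i \<noteq> j \<Longrightarrow> a i * b j \<noteq> a j * b i"
    and "\<And>i. i \<le> d \<Longrightarrow> (a i, b i) \<noteq> (0, 0)"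
  shows "rational_curve_point d v x y =
    (\<Sum>j\<le>d. ((\<Prod>i\<in>{..d}-{j}. x * b i - y * a i) / (\<Prod>i\<in>{..d}-{j}. a j * b i - b j * a i))
       *s rational_curve_point d v (a j) (b j))"
proof (rule vec_eq_iff[THEN iffD2], rule allI)
  fix m
  show "rational_curve_point d v x y $ m =
    (\<Sum>j\<le>d. ((\<Prod>i\<in>{..d}-{j}. x * b i - y * a i) / (\<Prod>i\<in>{..d}-{j}. a j * b i - b j * a i))
       *s rational_curve_point d v (a j) (b j)) $ m"
    using form_lagrange[where F = "\<lambda>a b. \<Sum>i\<le>d. (a ^ i * b ^ (d - i)) * v i $ m" and x = x and y = y,
        OF form_monomials assms]
    by (simp add: rational_curve_point_def mult.commute)
qed

text \<open>Independence of an indexed family instead of a set, so that coefficients can be compared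
  index by index; repeated vectors count as dependent.\<close>

definition lin_indep :: "nat \<Rightarrow> (nat \<Rightarrow> ('a::field)^'n) \<Rightarrow> bool" where
  "lin_indep m f \<longleftrightarrow> (\<forall>c. (\<Sum>j<m. c j *s f j) = 0 \<longrightarrow> (\<forall>j<m. c j = 0))"

lemma lin_indepD: "lin_indep m f \<Longrightarrow> (\<Sum>j<m. c j *s f j) = 0 \<Longrightarrow> j < m \<Longrightarrow> c j = 0"
  by (auto simp: lin_indep_def)

lemma lin_indep_eqD:
  assumes "lin_indep m f" and "(\<Sum>j<m. c j *s f j) = (\<Sum>j<m. e j *s f j)" and "j < m"
  shows "c j = e j"
proof -
  have "(\<Sum>j<m. (c j - e j) *s f j) = 0"
    using assms(2) by (simp add: vec.scale_left_diff_distrib sum_subtractf)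
  thus ?thesis using lin_indepD[OF assms(1) _ assms(3), of "\<lambda>j. c j - e j"] by simp
qed

lemma lin_indep_iff:
  "lin_indep m f \<longleftrightarrow> inj_on f {..<m} \<and> vec.independent (f ` {..<m})"
proof
  assume f: "lin_indep m f"
  have inj: "inj_on f {..<m}"
  proof (rule inj_onI, rule ccontr)
    fix i j assume ij: "i \<in> {..<m}" "j \<in> {..<m}" "f i = f j" "i \<noteq> j"
    have "(\<Sum>l<m. (if l = i then 1 else 0) *s f l) = (\<Sum>l<m. (if l = j then 1 else 0) *s f l)"
      using ij by (simp add: if_distrib[of "\<lambda>c. c *s _"] cong: if_cong)
    from lin_indep_eqD[OF f this, of i] ij show False by simp
  qed
  moreover have "vec.independent (f ` {..<m})"
  proof (rule vec.independent_if_scalars_zero)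
    fix g x assume "(\<Sum>x\<in>f ` {..<m}. g x *s x) = 0" and "x \<in> f ` {..<m}"
    thus "g x = 0" using lin_indepD[OF f, of "\<lambda>i. g (f i)"] inj by (auto simp: sum.reindex)
  qed simp
  ultimately show "inj_on f {..<m} \<and> vec.independent (f ` {..<m})" by simp
next
  assume "inj_on f {..<m} \<and> vec.independent (f ` {..<m})"
  hence inj: "inj_on f {..<m}" and ind: "vec.independent (f ` {..<m})" by auto
  show "lin_indep m f" unfolding lin_indep_def
  proof (intro allI impI)
    fix c j assume c: "(\<Sum>j<m. c j *s f j) = 0" and j: "j < m"
    have "(\<Sum>x\<in>f ` {..<m}. c (the_inv_into {..<m} f x) *s x) = 0"
      unfolding sum.reindex[OF inj] c[symmetric]
      by (intro sum.cong refl) (simp add: the_inv_into_f_f[OF inj])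
    from vec.independentD[OF ind _ _ this, of "f j"] show "c j = 0"
      using j inj by (simp add: the_inv_into_f_f)
  qed
qed

text \<open>A dimension count: \<open>m\<close> vectors whose span contains \<open>m\<close>
  independent ones cannot be dependent or repeated.\<close>

lemma lin_indepI_spanning:
  assumes f: "lin_indep m f" and sp: "\<And>j. j < m \<Longrightarrow> f j \<in> vec.span (v ` {..<m})"
  shows "lin_indep m v"
proof -
  have fi: "inj_on f {..<m}" "vec.independent (f ` {..<m})" using f by (auto simp: lin_indep_iff)
  have "m \<le> card (v ` {..<m})"
    using vec.independent_span_bound[of "v ` {..<m}" "f ` {..<m}"] fi sp by (auto simp: card_image)
  moreover have "card (v ` {..<m}) \<le> m" using card_image_le[of "{..<m}" v] by simp
  ultimately have card: "card (v ` {..<m}) = m" by simp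
  hence "inj_on v {..<m}" by (intro eq_card_imp_inj_on) auto
  moreover have "m \<le> vec.dim (vec.span (v ` {..<m}))"
    using vec.independent_card_le_dim[of "f ` {..<m}" "vec.span (v ` {..<m})"] fi sp
    by (auto simp: card_image)
  hence "vec.independent (v ` {..<m})"
    using card by (intro vec.card_le_dim_spanning[of _ "vec.span (v ` {..<m})"] vec.span_superset) auto
  ultimately show ?thesis by (simp add: lin_indep_iff)
qed

lemma prod_remove_inverse:
  fixes m :: "nat \<Rightarrow> 'a::field"
  assumes "j \<le> d" and "m j \<noteq> 0"
  shows "(\<Prod>i\<in>{..d}-{j}. m i) = (\<Prod>i\<le>d. m i) / m j"
  using assms by (simp add: prod.remove[of "{..d}" j])

text \<open>
  In the basis \<open>f\<close> the curve below is \<open>(1 / (A + B / x\<^sub>0) : \<dots> : 1 / (A + B / x\<^sub>d))\<close> with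
  denominators cleared.
\<close>

definition curve_vector :: "nat \<Rightarrow> (nat \<Rightarrow> ('a::field)^'n) \<Rightarrow> (nat \<Rightarrow> 'a) \<Rightarrow> 'a \<Rightarrow> 'a \<Rightarrow> 'a^'n" where
  "curve_vector d f x A B = (\<Sum>j\<le>d. (\<Prod>i\<in>{..d}-{j}. A + B / x i) *s f j)"

definition standard_curve :: "nat \<Rightarrow> (nat \<Rightarrow> ('a::field)^'n) \<Rightarrow> (nat \<Rightarrow> 'a) \<Rightarrow> ('a^'n) set set" where
  "standard_curve d f x = {vec.span {curve_vector d f x A B} | A B. (A, B) \<noteq> (0, 0)}"

text \<open>The data of \<open>d + 3\<close> points: the frame points, the point with all
  coordinates 1, and the point with coordinates \<open>x j\<close>. Distinct nonzero
  \<open>x j\<close> say that they are in general position.\<close>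

locale curve_frame =
  fixes d :: nat and f :: "nat \<Rightarrow> ('a::field)^'n" and x :: "nat \<Rightarrow> 'a"
  assumes d_pos: "d > 0" and indep: "lin_indep (Suc d) f"
    and x_inj: "inj_on x {..d}" and x_nz: "\<And>j. j \<le> d \<Longrightarrow> x j \<noteq> 0"
begin

lemma indep_eqD: "(\<Sum>j\<le>d. c j *s f j) = (\<Sum>j\<le>d. e j *s f j) \<Longrightarrow> j \<le> d \<Longrightarrow> c j = e j"
  using lin_indep_eqD[OF indep, of c e j] by (simp add: lessThan_Suc_atMost)

lemma frame_nz: "j \<le> d \<Longrightarrow> f j \<noteq> 0"
  using indep_eqD[of "\<lambda>i. if i = j then 1 else 0" "\<lambda>_. 0" j]
  by (auto simp: if_distrib[of "\<lambda>c. c *s _"] cong: if_cong)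

lemma curve_vector_1_0: "curve_vector d f x 1 0 = (\<Sum>j\<le>d. f j)"
  by (simp add: curve_vector_def)

lemma curve_vector_0_1: "curve_vector d f x 0 1 = (\<Prod>i\<le>d. 1 / x i) *s (\<Sum>j\<le>d. x j *s f j)"
  unfolding curve_vector_def vec.scale_sum_right
  by (intro sum.cong refl) (simp add: prod_remove_inverse x_nz)

text \<open>The parameter is the zero of the factor with index \<open>j\<close>, and this factor
  occurs in every coefficient except that of \<open>f j\<close>.\<close>

lemma curve_vector_frame:
  assumes "j \<le> d"
  obtains c where "c \<noteq> 0" "curve_vector d f x (- 1 / x j) 1 = c *s f j"
proof -
  let ?p = "\<lambda>j'. \<Prod>i\<in>{..d}-{j'}. - 1 / x j + 1 / x i"
  have "?p j' = 0" if "j' \<noteq> j" for j'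
    using assms that by (intro prod_zero bexI[of _ j]) auto
  hence "curve_vector d f x (- 1 / x j) 1 = (\<Sum>j'\<in>{j}. ?p j' *s f j')"
    unfolding curve_vector_def using assms by (intro sum.mono_neutral_right) auto
  hence "curve_vector d f x (- 1 / x j) 1 = ?p j *s f j" by simp
  moreover have "?p j \<noteq> 0"
    using assms x_inj x_nz by (auto simp: field_simps inj_on_def)
  ultimately show thesis using that by blast
qed

text \<open>Expanding the coefficients in monomials of \<open>A\<close> and \<open>B\<close> yields
  the vectors of the parametrisation. They are independent because the frame points lie on the curve
  and hence in their span.\<close>

lemma standard_curve_nrc: "normal_rational_curve d (standard_curve d f x)"
proof -
  have "form d (\<lambda>A B. \<Prod>i\<in>{..d}-{j}. A + B / x i)" if "j \<le> d" for j
    using form_prod[of "{..d}-{j}" "\<lambda>_. 1" "\<lambda>i. 1 / x i"] that by simp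
  hence "\<forall>j\<in>{..d}. \<exists>c. \<forall>A B. (\<Prod>i\<in>{..d}-{j}. A + B / x i) = (\<Sum>i\<le>d. c i * (A ^ i * B ^ (d - i)))"
    by (simp add: form_def)
  then obtain c where c:
    "\<And>j A B. j \<le> d \<Longrightarrow> (\<Prod>i\<in>{..d}-{j}. A + B / x i) = (\<Sum>i\<le>d. c j i * (A ^ i * B ^ (d - i)))"
    by (metis atMost_iff)
  define v where "v i = (\<Sum>j\<le>d. c j i *s f j)" for i
  have eq: "curve_vector d f x A B = (\<Sum>i\<le>d. (A ^ i * B ^ (d - i)) *s v i)" for A B
  proof -
    have "curve_vector d f x A B = (\<Sum>j\<le>d. \<Sum>i\<le>d. (A ^ i * B ^ (d - i)) *s (c j i *s f j))"
      unfolding curve_vector_def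
      by (intro sum.cong refl) (simp add: c vec.scale_sum_left mult.commute)
    also have "\<dots> = (\<Sum>i\<le>d. \<Sum>j\<le>d. (A ^ i * B ^ (d - i)) *s (c j i *s f j))"
      by (rule sum.swap)
    finally show ?thesis by (simp only: v_def vec.scale_sum_right)
  qed
  have "lin_indep (Suc d) v"
  proof (rule lin_indepI_spanning[OF indep])
    fix j assume "j < Suc d"
    then obtain e where e: "e \<noteq> 0" "curve_vector d f x (- 1 / x j) 1 = e *s f j"
      using curve_vector_frame[of j] by auto
    have "curve_vector d f x (- 1 / x j) 1 \<in> vec.span (v ` {..<Suc d})"
      unfolding eq by (intro vec.span_sum vec.span_scale vec.span_base) auto
    hence "inverse e *s (e *s f j) \<in> vec.span (v ` {..<Suc d})"
      unfolding e by (rule vec.span_scale)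
    thus "f j \<in> vec.span (v ` {..<Suc d})" using e(1) by simp
  qed
  hence v: "inj_on v {..d}" "vec.independent (v ` {..d})"
    by (auto simp: lin_indep_iff lessThan_Suc_atMost)
  thus ?thesis unfolding normal_rational_curve_def standard_curve_def eq by blast
qed

lemma standard_curve_points:
  shows "vec.span {\<Sum>j\<le>d. f j} \<in> standard_curve d f x"
    and "vec.span {\<Sum>j\<le>d. x j *s f j} \<in> standard_curve d f x"
    and "j \<le> d \<Longrightarrow> vec.span {f j} \<in> standard_curve d f x"
proof -
  show "vec.span {\<Sum>j\<le>d. f j} \<in> standard_curve d f x"
    unfolding standard_curve_def curve_vector_1_0[symmetric] by force
  have "(\<Prod>i\<le>d. 1 / x i) \<noteq> 0" using x_nz by auto
  hence "vec.span {\<Sum>j\<le>d. x j *s f j} = vec.span {curve_vector d f x 0 1}"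
    unfolding curve_vector_0_1 by (rule span_singleton_scale[symmetric])
  thus "vec.span {\<Sum>j\<le>d. x j *s f j} \<in> standard_curve d f x"
    unfolding standard_curve_def by force
  show "vec.span {f j} \<in> standard_curve d f x" if j: "j \<le> d"
  proof -
    obtain c where "c \<noteq> 0" "curve_vector d f x (- 1 / x j) 1 = c *s f j"
      using curve_vector_frame[OF j] .
    hence "vec.span {f j} = vec.span {curve_vector d f x (- 1 / x j) 1}"
      by (simp add: span_singleton_scale)
    thus ?thesis unfolding standard_curve_def by force
  qed
qed

text \<open>Interpolation at the parameters of the frame points writes coordinate \<open>j\<close>
  of a point of \<open>C\<close> as \<open>\<kappa> j\<close> times the linear factors
  \<open>m\<close> of index other than \<open>j\<close>. The first extra point determines
  \<open>\<kappa>\<close>, the second the ratios of the factors, and a linear change of parameters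
  then turns \<open>C\<close> into the standard curve.\<close>

lemma nrc_unique:
  assumes nrc: "normal_rational_curve d C"
    and fC: "\<And>j. j \<le> d \<Longrightarrow> vec.span {f j} \<in> C"
    and PC: "vec.span {\<Sum>j\<le>d. f j} \<in> C" and QC: "vec.span {\<Sum>j\<le>d. x j *s f j} \<in> C"
  shows "C = standard_curve d f x"
proof -
  obtain v where v: "inj_on v {..d}" "vec.independent (v ` {..d})"
    and C0: "C = {vec.span {\<Sum>i\<le>d. (a ^ i * b ^ (d - i)) *s v i} | a b. (a, b) \<noteq> (0, 0)}"
    using nrc by (auto simp: normal_rational_curve_def)
  define z where "z = rational_curve_point d v"
  have C: "C = {vec.span {z a b} | a b. (a, b) \<noteq> (0, 0)}"
    by (simp only: C0 z_def rational_curve_point_def)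
  have vi: "lin_indep (Suc d) v" using v by (simp add: lin_indep_iff lessThan_Suc_atMost)
  have z_scale: "z (k * a) (k * b) = k ^ d *s z a b" for k a b
    unfolding z_def rational_curve_point_def vec.scale_sum_right
    by (intro sum.cong refl) (simp add: power_mult_distrib power_add[symmetric] mult_ac)
  have point: "\<exists>a b c. (a, b) \<noteq> (0, 0) \<and> c \<noteq> 0 \<and> z a b = c *s y"
    if y: "vec.span {y} \<in> C" "y \<noteq> 0" for y
  proof -
    obtain a b where ab: "(a, b) \<noteq> (0, 0)" "vec.span {y} = vec.span {z a b}" using y C by auto
    then obtain c where "c \<noteq> 0" "y = c *s z a b" using y(2) span_singleton_eq_iff by blast
    thus ?thesis using ab by (intro exI[of _ a] exI[of _ b] exI[of _ "1 / c"]) auto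
  qed
  have "\<forall>j\<in>{..d}. \<exists>a b c. (a, b) \<noteq> (0, 0) \<and> c \<noteq> 0 \<and> z a b = c *s f j"
    using point fC frame_nz by simp
  then obtain a b l where ab: "\<And>j. j \<le> d \<Longrightarrow> (a j, b j) \<noteq> (0, 0)"
    and l: "\<And>j. j \<le> d \<Longrightarrow> l j \<noteq> 0" and z: "\<And>j. j \<le> d \<Longrightarrow> z (a j) (b j) = l j *s f j"
    by (metis atMost_iff)
  \<comment> \<open>Proportional parameters give proportional vectors because \<open>z\<close> is
    homogeneous, which the independence of \<open>f\<close> excludes.\<close>
  have pts: "a i * b j \<noteq> a j * b i" if ij: "i \<le> d" "j \<le> d" "i \<noteq> j" for i j
  proof
    assume eq: "a i * b j = a j * b i"
    obtain k where k: "a i = k * a j" "b i = k * b j"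
    proof (cases "a j = 0")
      case True
      thus thesis using eq ab[OF ij(2)] by (intro that[of "b i / b j"]) auto
    next
      case False
      thus thesis using eq by (intro that[of "a i / a j"]) (auto simp: field_simps)
    qed
    hence "l i *s f i = (k ^ d * l j) *s f j" using z_scale[of k "a j" "b j"] z[OF ij(1)] z[OF ij(2)]
      unfolding k[symmetric] by simp
    hence "(\<Sum>m\<le>d. (if m = i then l i else 0) *s f m) = (\<Sum>m\<le>d. (if m = j then k ^ d * l j else 0) *s f m)"
      using ij by (simp add: if_distrib[of "\<lambda>c. c *s _"] cong: if_cong)
    from indep_eqD[OF this ij(1)] show False using l ij by simp
  qed
  define \<kappa> where "\<kappa> j = l j / (\<Prod>i\<in>{..d}-{j}. a j * b i - b j * a i)" for j
  define m where "m a' b' i = a' * b i - b' * a i" for a' b' i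
  have \<kappa>: "\<kappa> j \<noteq> 0" if "j \<le> d" for j
    using that pts[OF that] l[OF that] by (auto simp: \<kappa>_def mult.commute)
  have zm: "z a' b' = (\<Sum>j\<le>d. (\<kappa> j * (\<Prod>i\<in>{..d}-{j}. m a' b' i)) *s f j)" for a' b'
  proof -
    have "z a' b' = (\<Sum>j\<le>d. ((\<Prod>i\<in>{..d}-{j}. a' * b i - b' * a i) / (\<Prod>i\<in>{..d}-{j}. a j * b i - b j * a i))
        *s z (a j) (b j))"
      unfolding z_def by (rule rational_curve_point_lagrange[OF pts ab])
    also have "\<dots> = (\<Sum>j\<le>d. (\<kappa> j * (\<Prod>i\<in>{..d}-{j}. m a' b' i)) *s f j)"
      by (intro sum.cong refl) (simp add: z \<kappa>_def m_def)
    finally show ?thesis .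
  qed
  \<comment> \<open>A vanishing factor kills every coordinate except its own, and
    \<open>d > 0\<close> provides another coordinate.\<close>
  have m_nz: "m a' b' i \<noteq> 0"
    if h: "z a' b' = (\<Sum>j\<le>d. c j *s f j)" "\<And>j. j \<le> d \<Longrightarrow> c j \<noteq> 0" "i \<le> d" for a' b' i c
  proof
    assume 0: "m a' b' i = 0"
    obtain j where j: "j \<le> d" "j \<noteq> i" using d_pos h(3) by (metis le0 neq0_conv order_refl)
    have "(\<Prod>i\<in>{..d}-{j}. m a' b' i) = 0" using 0 j h(3) by (intro prod_zero bexI[of _ i]) auto
    hence "c j = 0" using indep_eqD[OF h(1)[symmetric, unfolded zm] j(1)] by simp
    thus False using h(2) j(1) by simp
  qed
  have "(\<Sum>j\<le>d. f j) \<noteq> 0" using indep_eqD[of "\<lambda>_. 1" "\<lambda>_. 0" 0] by auto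
  from point[OF PC this] obtain a1 b1 \<rho> where \<rho>: "\<rho> \<noteq> 0" "z a1 b1 = (\<Sum>j\<le>d. \<rho> *s f j)"
    by (auto simp: vec.scale_sum_right)
  have "(\<Sum>j\<le>d. x j *s f j) \<noteq> 0" using indep_eqD[of x "\<lambda>_. 0" 0] x_nz by auto
  from point[OF QC this] obtain a2 b2 \<rho>' where \<rho>': "\<rho>' \<noteq> 0" "z a2 b2 = (\<Sum>j\<le>d. (\<rho>' * x j) *s f j)"
    by (auto simp: vec.scale_sum_right)
  define m1 m2 where "m1 = m a1 b1" and "m2 = m a2 b2"
  have m1: "m1 j \<noteq> 0" if "j \<le> d" for j unfolding m1_def by (rule m_nz[OF \<rho>(2) _ that]) (rule \<rho>(1))
  have m2: "m2 j \<noteq> 0" if "j \<le> d" for j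
    unfolding m2_def by (rule m_nz[OF \<rho>'(2) _ that]) (use \<rho>'(1) x_nz in auto)
  define M1 M2 where "M1 = (\<Prod>i\<le>d. m1 i)" and "M2 = (\<Prod>i\<le>d. m2 i)"
  have M: "M1 \<noteq> 0" "M2 \<noteq> 0" using m1 m2 by (auto simp: M1_def M2_def)
  have k1: "\<kappa> j * (M1 / m1 j) = \<rho>" if "j \<le> d" for j
    using indep_eqD[OF \<rho>(2)[unfolded zm] that] prod_remove_inverse[of j d m1] that m1
    by (simp add: m1_def M1_def)
  have k2: "\<kappa> j * (M2 / m2 j) = \<rho>' * x j" if "j \<le> d" for j
    using indep_eqD[OF \<rho>'(2)[unfolded zm] that] prod_remove_inverse[of j d m2] that m2
    by (simp add: m2_def M2_def)
  \<comment> \<open>Equating the two expressions for \<open>\<kappa> j\<close> from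
    \<open>k1\<close> and \<open>k2\<close> gives \<open>m2 j * x j = \<eta> * m1 j\<close>, with a
    factor that does not depend on \<open>j\<close>.\<close>
  define \<eta> where "\<eta> = \<rho> * M2 / (M1 * \<rho>')"
  have \<eta>: "\<eta> \<noteq> 0" using \<rho> \<rho>' M by (simp add: \<eta>_def)
  have m21: "m2 j = \<eta> * m1 j / x j" if j: "j \<le> d" for j
  proof -
    have "\<kappa> j = \<rho> * m1 j / M1" using k1[OF j] m1[OF j] M by (simp add: field_simps)
    moreover have "\<kappa> j = \<rho>' * x j * m2 j / M2" using k2[OF j] m2[OF j] M by (simp add: field_simps)
    ultimately show ?thesis using M \<rho>' x_nz[OF j] by (simp add: \<eta>_def field_simps)
  qed
  \<comment> \<open>The factors \<open>m\<close> are linear in the parameters, so the combination of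
    both parameter pairs with weights \<open>A\<close> and \<open>B / \<eta>\<close> has the factors
    \<open>m1 i * (A + B / x i)\<close>.\<close>
  have z_curve: "z (A * a1 + B / \<eta> * a2) (A * b1 + B / \<eta> * b2) = \<rho> *s curve_vector d f x A B" for A B
  proof -
    have m: "m (A * a1 + B / \<eta> * a2) (A * b1 + B / \<eta> * b2) i = m1 i * (A + B / x i)" if "i \<le> d" for i
    proof -
      have "m (A * a1 + B / \<eta> * a2) (A * b1 + B / \<eta> * b2) i = A * m1 i + B / \<eta> * m2 i"
        by (simp add: m_def m1_def m2_def algebra_simps)
      thus ?thesis using m21[OF that] \<eta> by (simp add: field_simps)
    qed
    have "\<kappa> j * (\<Prod>i\<in>{..d}-{j}. m (A * a1 + B / \<eta> * a2) (A * b1 + B / \<eta> * b2) i)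
        = \<kappa> j * (\<Prod>i\<in>{..d}-{j}. m1 i * (A + B / x i))" for j
      by (intro arg_cong2[where f = "(*)"] prod.cong refl m) simp
    moreover have "\<kappa> j * (\<Prod>i\<in>{..d}-{j}. m1 i * (A + B / x i)) = \<rho> * (\<Prod>i\<in>{..d}-{j}. A + B / x i)"
      if "j \<le> d" for j
      unfolding prod.distrib prod_remove_inverse[of j d m1, OF that m1[OF that]] M1_def[symmetric]
      by (simp only: mult.assoc[symmetric] k1[OF that])
    ultimately show ?thesis
      unfolding zm curve_vector_def vec.scale_sum_right by (intro sum.cong refl) (simp only: vec.scale_scale atMost_iff)
  qed
  \<comment> \<open>The determinant of the parameter change; if it were zero, \<open>m21\<close>
    would give \<open>x 0 = x 1\<close>.\<close>
  define D where "D = a1 * b2 - a2 * b1"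
  have D: "D \<noteq> 0"
  proof
    assume "D = 0"
    moreover have "m1 0 * m2 1 - m1 1 * m2 0 = D * (a 0 * b 1 - a 1 * b 0)"
      by (simp add: m1_def m2_def m_def D_def algebra_simps)
    ultimately have "m1 0 * m2 1 = m1 1 * m2 0" by simp
    hence "x 0 = x 1" using m21[of 0] m21[of 1] m1[of 0] m1[of 1] x_nz[of 0] x_nz[of 1] \<eta> d_pos
      by (simp add: field_simps)
    thus False using x_inj d_pos inj_onD[of x "{..d}" 0 1] by simp
  qed
  show ?thesis
  proof (intro equalityI subsetI)
    fix X assume "X \<in> C"
    then obtain a' b' where X: "X = vec.span {z a' b'}" "(a', b') \<noteq> (0, 0)" using C by auto
    \<comment> \<open>Cramer's rule for the parameter change.\<close>
    define A B where "A = (a' * b2 - b' * a2) / D" and "B = \<eta> * (a1 * b' - b1 * a') / D"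
    have "A * a1 + B / \<eta> * a2 = (a' * (a1 * b2 - a2 * b1)) / D"
      unfolding A_def B_def using \<eta> D by (simp add: field_simps)
    hence a': "A * a1 + B / \<eta> * a2 = a'" using D by (simp add: D_def)
    have "A * b1 + B / \<eta> * b2 = (b' * (a1 * b2 - a2 * b1)) / D"
      unfolding A_def B_def using \<eta> D by (simp add: field_simps)
    hence b': "A * b1 + B / \<eta> * b2 = b'" using D by (simp add: D_def)
    have "(A, B) \<noteq> (0, 0)" using X(2) a' b' by auto
    moreover have "X = vec.span {curve_vector d f x A B}"
      using z_curve[of A B] \<rho>(1) X(1) a' b' by (simp add: span_singleton_scale)
    ultimately show "X \<in> standard_curve d f x" unfolding standard_curve_def by blast
  next
    fix X assume "X \<in> standard_curve d f x"
    then obtain A B where X: "X = vec.span {curve_vector d f x A B}" "(A, B) \<noteq> (0, 0)"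
      by (auto simp: standard_curve_def)
    let ?a = "A * a1 + B / \<eta> * a2" and ?b = "A * b1 + B / \<eta> * b2"
    have "?a * b2 - ?b * a2 = A * D" "a1 * ?b - b1 * ?a = B / \<eta> * D"
      by (simp_all add: D_def algebra_simps)
    hence "(?a, ?b) \<noteq> (0, 0)" using X(2) D \<eta> by auto
    moreover have "X = vec.span {z ?a ?b}" using z_curve \<rho>(1) X(1) by (simp add: span_singleton_scale)
    ultimately show "X \<in> C" unfolding C by blast
  qed
qed

end

section \<open>Points over the base field\<close>

lemma pg_points_vec:
  "pg_points (*s) U = {vec.span {x} | x :: ('a::field)^'n. x \<noteq> 0 \<and> vec.span {x} \<subseteq> U}"
proof -
  have "pg_subspace (*s) 0 X \<longleftrightarrow> (\<exists>x. x \<noteq> 0 \<and> X = vec.span {x})" for X :: "('a^'n) set"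
  proof
    assume X: "pg_subspace (*s) 0 X"
    obtain B where "B \<subseteq> X" "vec.independent B" "X \<subseteq> vec.span B" "card B = vec.dim X"
      by (rule vec.basis_exists)
    moreover from this obtain x where "B = {x}"
      using X by (auto simp: pg_subspace_def card_1_singleton_iff)
    ultimately show "\<exists>x. x \<noteq> 0 \<and> X = vec.span {x}"
      using X vec.span_minimal[of B X] by (auto simp: pg_subspace_def)
  next
    assume "\<exists>x. x \<noteq> 0 \<and> X = vec.span {x}"
    thus "pg_subspace (*s) 0 X" by (auto simp: pg_subspace_def)
  qed
  thus ?thesis by (auto simp: pg_points_def)
qed

context field_extension
begin

lemma vector_space_sub_scale: "vector_space (sub_scale emb :: 'k \<Rightarrow> 'K^'r \<Rightarrow> 'K^'r)"
  by unfold_locales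
    (auto simp: sub_scale_def emb_add emb_mult vec.scale_right_distrib vec.scale_left_distrib)

lemma base_subspace_iff:
  "module.subspace (sub_scale emb) (U :: ('K^'r) set) \<longleftrightarrow>
    0 \<in> U \<and> (\<forall>x\<in>U. \<forall>y\<in>U. x + y \<in> U) \<and> (\<forall>c. \<forall>x\<in>U. emb c *s x \<in> U)"
proof -
  interpret sub: vector_space "sub_scale emb :: 'k \<Rightarrow> 'K^'r \<Rightarrow> 'K^'r" by (rule vector_space_sub_scale)
  show ?thesis by (auto simp: sub.subspace_def sub_scale_def)
qed

lemma card_base_subspace:
  assumes "module.subspace (sub_scale emb) (U :: ('K^'r) set)"
  shows "card U = q ^ vector_space.dim (sub_scale emb) U"
proof -
  interpret sub: vector_space "sub_scale emb :: 'k \<Rightarrow> 'K^'r \<Rightarrow> 'K^'r" by (rule vector_space_sub_scale)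
  show ?thesis using sub.card_subspace[of U] assms card_base by simp
qed

text \<open>Over a finite field with more than one element, dimension and cardinality determine each
  other; ranks and weights are checked below by counting.\<close>

lemma base_dim_iff:
  assumes "module.subspace (sub_scale emb) (U :: ('K^'r) set)"
  shows "vector_space.dim (sub_scale emb) U = d \<longleftrightarrow> card U = q ^ d"
  using card_base_subspace[OF assms] q_gt_1 by simp

lemma pg_subspace_base_iff:
  "pg_subspace (sub_scale emb) d (U :: ('K^'r) set) \<longleftrightarrow>
    module.subspace (sub_scale emb) U \<and> card U = q ^ (d + 1)"
  using base_dim_iff[of U "d + 1"] by (auto simp: pg_subspace_def)

definition base_point :: "'K^'r \<Rightarrow> ('K^'r) set" where
  "base_point x = range (\<lambda>a. emb a *s x)"

lemma base_point_self [simp]: "x \<in> base_point x"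
  unfolding base_point_def by (intro range_eqI[of _ _ 1]) simp

lemma base_point_scale: "a \<noteq> 0 \<Longrightarrow> base_point (emb a *s x) = base_point x"
proof -
  assume a: "a \<noteq> 0"
  have "emb b *s x = emb (b / a) *s (emb a *s x)" for b
    using a by (simp flip: emb_mult)
  hence "emb b *s x \<in> base_point (emb a *s x)" for b
    unfolding base_point_def by (rule range_eqI)
  moreover have "emb b *s (emb a *s x) = emb (b * a) *s x" for b
    by (simp add: emb_mult)
  hence "emb b *s (emb a *s x) \<in> base_point x" for b
    unfolding base_point_def by (rule range_eqI)
  ultimately show ?thesis by (auto simp: base_point_def)
qed

lemma base_point_eq_iff:
  assumes "x \<noteq> 0"
  shows "base_point x = base_point y \<longleftrightarrow> (\<exists>a. a \<noteq> 0 \<and> x = emb a *s y)"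
proof
  assume "base_point x = base_point y"
  hence "x \<in> base_point y" using base_point_self[of x] by simp
  thus "\<exists>a. a \<noteq> 0 \<and> x = emb a *s y" using assms by (auto simp: base_point_def)
qed (auto simp: base_point_scale)

lemma subspace_base_point: "module.subspace (sub_scale emb) (base_point x)"
  unfolding base_subspace_iff base_point_def
  by (auto simp flip: emb_mult emb_add vec.scale_left_distrib intro: range_eqI[of _ _ 0])

lemma base_point_subset:
  "module.subspace (sub_scale emb) U \<Longrightarrow> base_point x \<subseteq> U \<longleftrightarrow> x \<in> U"
  using base_point_self[of x] by (auto simp: base_subspace_iff base_point_def)

lemma card_base_point: "x \<noteq> 0 \<Longrightarrow> card (base_point x) = q"
  unfolding base_point_def by (subst card_image) (auto simp: inj_on_def card_base)

abbreviation "base_points \<equiv> pg_points (sub_scale emb)"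

lemma pg_points_base:
  "base_points U = {base_point x | x :: 'K^'r. x \<noteq> 0 \<and> base_point x \<subseteq> U}"
proof -
  have "pg_subspace (sub_scale emb) 0 X \<longleftrightarrow> (\<exists>x. x \<noteq> 0 \<and> X = base_point x)" for X :: "('K^'r) set"
  proof
    assume X: "pg_subspace (sub_scale emb) 0 X"
    hence sub: "module.subspace (sub_scale emb) X" and card: "card X = q"
      by (auto simp: pg_subspace_base_iff)
    have "\<not> X \<subseteq> {0}" using card q_gt_1 card_mono[of "{0}" X] by auto
    then obtain x where x: "x \<in> X" "x \<noteq> 0" by auto
    have "base_point x = X"
      using base_point_subset[OF sub] x card_base_point[of x] card by (intro card_seteq) auto
    thus "\<exists>x. x \<noteq> 0 \<and> X = base_point x" using x by auto
  next
    assume "\<exists>x. x \<noteq> 0 \<and> X = base_point x"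
    thus "pg_subspace (sub_scale emb) 0 X"
      by (auto simp: pg_subspace_base_iff subspace_base_point card_base_point)
  qed
  thus ?thesis by (auto simp: pg_points_def)
qed

lemma span_base_points:
  "module.span (sub_scale emb) (base_point x \<union> base_point y) = {emb a *s x + emb b *s y | a b. True}"
proof -
  interpret sub: vector_space "sub_scale emb :: 'k \<Rightarrow> 'K^'r \<Rightarrow> 'K^'r" by (rule vector_space_sub_scale)
  have bp: "base_point z = sub.span {z}" for z
    by (simp add: sub.span_singleton base_point_def sub_scale_def)
  have "sub.span (base_point x \<union> base_point y) = {u + v | u v. u \<in> base_point x \<and> v \<in> base_point y}"
    unfolding bp sub.span_Un sub.span_span by auto
  thus ?thesis by (auto simp: base_point_def)
qed

end

section \<open>The design in coordinates\<close>

text \<open>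
  Coordinates on the spread element \<open>p\<close>: the vector with coordinate \<open>y\<close> is \<open>\<tau> y *s v\<^sub>0\<close>, and in the
  extension it becomes \<open>(y, y\<^sup>\<theta>, y\<^sup>\<theta>\<^sup>\<theta>, \<dots>)\<close> with respect to the conjugate points \<open>E\<^sub>0, E\<^sub>1, \<dots>\<close> of
  \<open>R = E\<^sub>0\<close>.
\<close>

locale design = cyclic_extension emb q t \<theta>
  for emb :: "'k::{field,finite} \<Rightarrow> 'K::{field,finite}" and q t :: nat and \<theta> :: "'K \<Rightarrow> 'K" +
  fixes \<iota> :: "'K^'r \<Rightarrow> 'K^'n" and \<sigma> :: "'K^'n \<Rightarrow> 'K^'n" and \<nu> :: "('K^'n) set" and p :: "('K^'r) set"
    and \<tau> :: "'K \<Rightarrow> 'K" and v\<^sub>0 :: "'K^'r" and E :: "nat \<Rightarrow> 'K^'n" and c :: 'K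
  assumes aut_tau: "aut \<tau>" and v0_nz: "v\<^sub>0 \<noteq> 0" and p_eq: "p = range (\<lambda>y. y *s v\<^sub>0)"
    and iota: "\<And>y. \<iota> (\<tau> y *s v\<^sub>0) = (\<Sum>i<t. (\<theta> ^^ i) y *s E i)"
    and E_indep: "lin_indep t E" and E_periodic: "\<And>i. E (i + t) = E i"
    and sigma_E: "\<And>i. \<sigma> (E i) = c *s E (Suc i)" and c_nz: "c \<noteq> 0"
    and sigma_add: "\<And>x y. \<sigma> (x + y) = \<sigma> x + \<sigma> y" and sigma_scale: "\<And>a x. \<sigma> (a *s x) = \<theta> a *s \<sigma> x"
    and indicator_point: "\<nu> \<inter> extension \<iota> p = vec.span {E 0}"
begin

definition vec_of :: "'K \<Rightarrow> 'K^'r" where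
  "vec_of y = \<tau> y *s v\<^sub>0"

definition pt :: "'K \<Rightarrow> ('K^'r) set" where
  "pt y = base_point (vec_of y)"

definition ext_vec :: "'K \<Rightarrow> 'K^'n" where
  "ext_vec y = (\<Sum>i<t. (\<theta> ^^ i) y *s E i)"

lemma iota_vec_of: "\<iota> (vec_of y) = ext_vec y"
  by (simp add: vec_of_def iota ext_vec_def)

lemma vec_of_emb: "vec_of (emb a * y) = emb a *s vec_of y"
  by (simp add: vec_of_def aut_mult[OF aut_tau] aut_emb[OF aut_tau])

lemma vec_of_eq_iff [simp]: "vec_of x = vec_of y \<longleftrightarrow> x = y"
  using v0_nz inj_onD[OF aut_inj[OF aut_tau]] by (auto simp: vec_of_def)

lemma vec_of_eq_0_iff [simp]: "vec_of y = 0 \<longleftrightarrow> y = 0"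
  using v0_nz by (simp add: vec_of_def aut_eq_0_iff[OF aut_tau])

lemma p_eq_range: "p = range vec_of"
proof -
  have "p = (\<lambda>y. y *s v\<^sub>0) ` range \<tau>"
    using bij_is_surj[OF aut_bij[OF aut_tau]] by (simp add: p_eq)
  thus ?thesis by (simp add: image_image vec_of_def[abs_def])
qed

lemma pt_subset_p: "pt y \<subseteq> p"
  unfolding pt_def base_point_def p_eq_range by (auto simp flip: vec_of_emb)

lemma points_p: "base_points p = {pt y | y. y \<noteq> 0}"
proof (intro equalityI subsetI)
  fix X assume "X \<in> base_points p"
  then obtain x where x: "X = base_point x" "x \<noteq> 0" "base_point x \<subseteq> p" by (auto simp: pg_points_base)
  hence "x \<in> p" using base_point_self by blast
  then obtain y where "x = vec_of y" unfolding p_eq_range by auto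
  thus "X \<in> {pt y | y. y \<noteq> 0}" using x by (auto simp: pt_def)
next
  fix X assume "X \<in> {pt y | y. y \<noteq> 0}"
  then obtain y where "X = pt y" "y \<noteq> 0" by auto
  thus "X \<in> base_points p"
    using pt_subset_p[of y] unfolding pg_points_base pt_def by auto
qed

lemma pt_eq_iff: "x \<noteq> 0 \<Longrightarrow> pt x = pt y \<longleftrightarrow> (\<exists>a. a \<noteq> 0 \<and> x = emb a * y)"
  unfolding pt_def by (subst base_point_eq_iff) (auto simp flip: vec_of_emb)

lemma E_eqD: "(\<Sum>i<t. a i *s E i) = (\<Sum>i<t. b i *s E i) \<Longrightarrow> i < t \<Longrightarrow> a i = b i"
  using lin_indep_eqD[OF E_indep] .

lemma E_mod: "E (i mod t) = E i"
proof -
  have "E (j + n * t) = E j" for j n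
  proof (induction n)
    case (Suc n)
    have "E (j + Suc n * t) = E ((j + n * t) + t)" by (simp add: algebra_simps)
    thus ?case using Suc E_periodic by simp
  qed simp
  from this[of "i mod t" "i div t"] show ?thesis by simp
qed

lemma sigma_0 [simp]: "\<sigma> 0 = 0"
  using sigma_add[of 0 0] by (metis add.right_neutral add_cancel_left_right)

lemma sigma_power_add: "(\<sigma> ^^ i) (x + y) = (\<sigma> ^^ i) x + (\<sigma> ^^ i) y"
  by (induction i) (auto simp: sigma_add)

lemma sigma_power_scale: "(\<sigma> ^^ i) (a *s x) = (\<theta> ^^ i) a *s (\<sigma> ^^ i) x"
  by (induction i) (auto simp: sigma_scale)

lemma sigma_power_0 [simp]: "(\<sigma> ^^ i) 0 = 0"
  by (induction i) auto

lemma sigma_power_sum: "(\<sigma> ^^ i) (\<Sum>j\<in>J. f j) = (\<Sum>j\<in>J. (\<sigma> ^^ i) (f j))"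
  by (induction J rule: infinite_finite_induct) (auto simp: sigma_power_add)

text \<open>The factor \<open>C\<close> is the same for all \<open>j\<close>, so a power of
  \<open>\<sigma>\<close> acts on combinations of the conjugates as an index shift with twisted
  coefficients, up to one common scalar.\<close>

lemma sigma_power_E: "\<exists>C. C \<noteq> 0 \<and> (\<forall>j. (\<sigma> ^^ i) (E j) = C *s E (i + j))"
proof (induction i)
  case 0
  thus ?case by (intro exI[of _ 1]) auto
next
  case (Suc i)
  then obtain C where C: "C \<noteq> 0" "\<And>j. (\<sigma> ^^ i) (E j) = C *s E (i + j)" by auto
  thus ?case
    by (intro exI[of _ "\<theta> C * c"])
      (auto simp: sigma_scale sigma_E c_nz aut_eq_0_iff[OF aut_theta])
qed

lemma sigma_power_combination:
  obtains C where "C \<noteq> 0"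
    "\<And>J a g. (\<sigma> ^^ i) (\<Sum>j\<in>J. a j *s E (g j)) = C *s (\<Sum>j\<in>J. (\<theta> ^^ i) (a j) *s E (i + g j))"
proof -
  obtain C where C: "C \<noteq> 0" "\<And>j. (\<sigma> ^^ i) (E j) = C *s E (i + j)" using sigma_power_E by blast
  show thesis
  proof (rule that[OF C(1)])
    show "(\<sigma> ^^ i) (\<Sum>j\<in>J. a j *s E (g j)) = C *s (\<Sum>j\<in>J. (\<theta> ^^ i) (a j) *s E (i + g j))" for J a and g :: "'c \<Rightarrow> nat"
      by (simp add: sigma_power_sum sigma_power_scale C(2) vec.scale_sum_right mult.commute)
  qed
qed

lemma sigma_power_span: "(\<sigma> ^^ i) ` vec.span {x} = vec.span {(\<sigma> ^^ i) x}"
proof -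
  have "surj (\<theta> ^^ i)" by (rule bij_is_surj[OF aut_bij[OF aut_power]])
  hence "range (\<lambda>a. a *s (\<sigma> ^^ i) x) = (\<lambda>a. a *s (\<sigma> ^^ i) x) ` range (\<theta> ^^ i)"
    by simp
  also have "\<dots> = range (\<lambda>a. (\<theta> ^^ i) a *s (\<sigma> ^^ i) x)" by (simp only: image_image)
  finally have "range (\<lambda>a. a *s (\<sigma> ^^ i) x) = range (\<lambda>a. (\<theta> ^^ i) a *s (\<sigma> ^^ i) x)" .
  thus ?thesis by (simp add: vec.span_singleton image_image sigma_power_scale)
qed

text \<open>Dedekind's lemma recovers every \<open>E i\<close> from the vectors
  \<open>ext_vec y\<close>.\<close>

lemma extension_p: "extension \<iota> p = vec.span (E ` {..<t})"
proof -
  have "E i \<in> vec.span (\<iota> ` p)" if "i < t" for i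
  proof (rule sum_powers_in_subspace[OF vec.subspace_span _ that])
    fix y
    have "ext_vec y \<in> \<iota> ` p" unfolding p_eq_range iota_vec_of[symmetric] by auto
    thus "(\<Sum>i<t. (\<theta> ^^ i) y *s E i) \<in> vec.span (\<iota> ` p)"
      unfolding ext_vec_def by (rule vec.span_base)
  qed
  moreover have "ext_vec y \<in> vec.span (E ` {..<t})" for y
    unfolding ext_vec_def by (intro vec.span_sum vec.span_scale vec.span_base) auto
  hence "\<iota> ` p \<subseteq> vec.span (E ` {..<t})" unfolding p_eq_range by (auto simp: iota_vec_of)
  ultimately show ?thesis unfolding extension_def
    by (intro equalityI vec.span_minimal) auto
qed

end

lemma span_family:
  "vec.span (f ` {..<n}) = {\<Sum>j<n. d j *s f j | d. True}" for f :: "nat \<Rightarrow> ('a::field)^'n"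
proof
  have "vec.subspace {\<Sum>j<n. d j *s f j | d. True}"
  proof (rule vec.subspaceI)
    show "0 \<in> {\<Sum>j<n. d j *s f j | d. True}" by (intro CollectI exI[of _ "\<lambda>_. 0"]) simp
  next
    fix x y assume "x \<in> {\<Sum>j<n. d j *s f j | d. True}" "y \<in> {\<Sum>j<n. d j *s f j | d. True}"
    then obtain d e where "x = (\<Sum>j<n. d j *s f j)" "y = (\<Sum>j<n. e j *s f j)" by auto
    thus "x + y \<in> {\<Sum>j<n. d j *s f j | d. True}"
      by (intro CollectI exI[of _ "\<lambda>j. d j + e j"]) (simp add: sum.distrib vec.scale_left_distrib)
  next
    fix k x assume "x \<in> {\<Sum>j<n. d j *s f j | d. True}"
    then obtain d where "x = (\<Sum>j<n. d j *s f j)" by auto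
    thus "k *s x \<in> {\<Sum>j<n. d j *s f j | d. True}"
      by (intro CollectI exI[of _ "\<lambda>j. k * d j"]) (simp add: vec.scale_sum_right)
  qed
  moreover have "f ` {..<n} \<subseteq> {\<Sum>j<n. d j *s f j | d. True}"
  proof clarify
    fix i assume "i < n"
    thus "\<exists>d. f i = (\<Sum>j<n. d j *s f j) \<and> True"
      by (intro exI[of _ "\<lambda>j. if j = i then 1 else 0"])
        (simp add: if_distrib[of "\<lambda>c. c *s _"] cong: if_cong)
  qed
  ultimately show "vec.span (f ` {..<n}) \<subseteq> {\<Sum>j<n. d j *s f j | d. True}"
    by (intro vec.span_minimal)
next
  show "{\<Sum>j<n. d j *s f j | d. True} \<subseteq> vec.span (f ` {..<n})"
    by (auto intro!: vec.span_sum vec.span_scale intro: vec.span_base)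
qed

lemma sum_split_residues:
  fixes F :: "nat \<Rightarrow> 'b::comm_monoid_add"
  assumes "s dvd t"
  shows "(\<Sum>m<t. F m) = (\<Sum>j<s. \<Sum>i<t div s. F (i * s + j))"
proof -
  have "(\<Sum>m<t. F m) = (\<Sum>m<t div s * s. F m)" using assms by simp
  also have "\<dots> = (\<Sum>i<t div s. \<Sum>m\<in>{i * s..<i * s + s}. F m)"
    by (rule sum.nat_group[symmetric])
  also have "\<dots> = (\<Sum>i<t div s. \<Sum>j<s. F (i * s + j))"
  proof (rule sum.cong[OF refl])
    fix i
    show "(\<Sum>m\<in>{i * s..<i * s + s}. F m) = (\<Sum>j<s. F (i * s + j))"
      by (rule sum.reindex_bij_witness[of _ "\<lambda>j. i * s + j" "\<lambda>m. m - i * s"]) auto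
  qed
  also have "\<dots> = (\<Sum>j<s. \<Sum>i<t div s. F (i * s + j))" by (rule sum.swap)
  finally show ?thesis .
qed

section \<open>The subspreads and the level of two points\<close>

context design
begin

abbreviation "level_of \<equiv> level t \<iota> \<sigma> \<nu> p"
abbreviation "subspread_of \<equiv> subspread t \<iota> \<sigma> \<nu> p"
abbreviation "sigma_space_of \<equiv> sigma_space t \<iota> \<sigma> \<nu> p"

text \<open>The part of \<open>ext_vec z\<close> in the residue class \<open>j\<close> modulo
  \<open>s\<close>. For \<open>j < s\<close> these vectors span the points in which the extended
  element of \<open>subspread_of s\<close> through \<open>z\<close> meets the conjugates of
  \<open>sigma_space_of s\<close>.\<close>

definition frame :: "nat \<Rightarrow> 'K \<Rightarrow> nat \<Rightarrow> 'K^'n" where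
  "frame s z j = (\<Sum>i<t div s. (\<theta> ^^ (i * s + j)) z *s E (i * s + j))"

lemma split_eqD:
  assumes "s dvd t"
    and "(\<Sum>j<s. \<Sum>i<t div s. a j i *s E (i * s + j)) = (\<Sum>j<s. \<Sum>i<t div s. b j i *s E (i * s + j))"
    and "j < s" "i < t div s"
  shows "a j i = b j i"
proof -
  have *: "(\<Sum>j<s. \<Sum>i<t div s. g j i *s E (i * s + j)) = (\<Sum>m<t. g (m mod s) (m div s) *s E m)" for g
    unfolding sum_split_residues[OF assms(1)] by (intro sum.cong refl) simp
  have "i * s + j < (i + 1) * s" using assms(3) by simp
  also have "(i + 1) * s \<le> t div s * s" using assms(4) by (intro mult_le_mono1) simp
  also have "\<dots> = t" using assms(1) by simp
  finally have "i * s + j < t" .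
  from E_eqD[OF assms(2)[unfolded *] this] show ?thesis using assms(3) by simp
qed

lemma ext_vec_frame: "s dvd t \<Longrightarrow> ext_vec y = (\<Sum>j<s. frame s y j)"
  unfolding ext_vec_def frame_def by (rule sum_split_residues)

lemma fixed_power_mult:
  assumes "(\<theta> ^^ s) w = w"
  shows "(\<theta> ^^ (i * s + j)) w = (\<theta> ^^ j) w"
proof -
  have "(\<theta> ^^ (i * s)) w = w"
  proof (induction i)
    case (Suc i)
    have "(\<theta> ^^ (Suc i * s)) w = (\<theta> ^^ s) ((\<theta> ^^ (i * s)) w)"
      by (simp add: funpow_add)
    thus ?case using Suc assms by simp
  qed simp
  thus ?thesis using funpow_add[of j "i * s" \<theta>] by (simp add: add.commute)
qed

text \<open>For \<open>w\<close> in the fixed field of \<open>\<theta> ^^ s\<close> the conjugates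
  of \<open>w\<close> agree along a residue class and can be pulled out, so the frame vectors are
  eigenvectors of multiplication by that field.\<close>

lemma frame_mult: "(\<theta> ^^ s) w = w \<Longrightarrow> frame s (w * z) j = (\<theta> ^^ j) w *s frame s z j"
  unfolding frame_def vec.scale_sum_right by (simp add: th_mult fixed_power_mult)

lemma div_pos: "s dvd t \<Longrightarrow> 0 < t div s"
  using t_pos dvd_imp_le[of s t] by (auto simp: div_greater_zero_iff)

lemma one_less_div:
  assumes "s dvd t" and "s \<noteq> t"
  shows "1 < t div s"
proof -
  have "t div s \<noteq> 1" using assms by (metis dvd_mult_div_cancel mult.right_neutral)
  thus ?thesis using div_pos[OF assms(1)] by simp
qed

lemma frame_indep:
  assumes "s dvd t" and "z \<noteq> 0"
  shows "lin_indep s (frame s z)"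
  unfolding lin_indep_def
proof (intro allI impI)
  fix d j assume 0: "(\<Sum>j<s. d j *s frame s z j) = 0" and j: "j < s"
  have "(\<Sum>j<s. \<Sum>i<t div s. (d j * (\<theta> ^^ (i * s + j)) z) *s E (i * s + j))
      = (\<Sum>j<s. \<Sum>i<t div s. 0 *s E (i * s + j))"
    using 0 by (simp add: frame_def vec.scale_sum_right)
  from split_eqD[OF assms(1) this j div_pos[OF assms(1)]] show "d j = 0"
    using assms(2) by (simp add: th_eq_0_iff)
qed

lemma sigma_space_eq:
  assumes "s dvd t"
  shows "sigma_space_of s = {\<Sum>i<t div s. a i *s E (i * s) | a. True}"
proof -
  have "((\<sigma> ^^ s) ^^ i) ` vec.span {E 0} = vec.span {E (i * s)}" for i
  proof -
    obtain C where "C \<noteq> 0" "(\<sigma> ^^ (s * i)) (E 0) = C *s E (s * i)"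
      using sigma_power_E[of "s * i"] by auto
    thus ?thesis by (simp add: funpow_mult sigma_power_span span_singleton_scale mult.commute)
  qed
  hence "sigma_space_of s = vec.span (\<Union>i<t div s. vec.span {E (i * s)})"
    by (simp add: sigma_space_def conjugate_span_def indicator_point)
  also have "\<dots> = vec.span ((\<lambda>i. E (i * s)) ` {..<t div s})"
  proof (intro equalityI vec.span_minimal vec.subspace_span)
    show "(\<Union>i<t div s. vec.span {E (i * s)}) \<subseteq> vec.span ((\<lambda>i. E (i * s)) ` {..<t div s})"
      by (intro UN_least vec.span_mono) auto
    show "(\<lambda>i. E (i * s)) ` {..<t div s} \<subseteq> vec.span (\<Union>i<t div s. vec.span {E (i * s)})"
      by (auto intro!: vec.span_base)
  qed
  finally show ?thesis by (simp only: span_family)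
qed

lemma sigma_power_sigma_space:
  assumes "s dvd t"
  shows "(\<sigma> ^^ j) ` sigma_space_of s = {\<Sum>i<t div s. a i *s E (i * s + j) | a. True}"
proof -
  obtain C where C: "C \<noteq> 0"
    "\<And>J a g. (\<sigma> ^^ j) (\<Sum>i\<in>(J :: nat set). a i *s E (g i)) = C *s (\<Sum>i\<in>J. (\<theta> ^^ j) (a i) *s E (j + g i))"
    by (rule sigma_power_combination[of j]) blast
  show ?thesis
  proof (intro equalityI subsetI)
    fix x assume "x \<in> (\<sigma> ^^ j) ` sigma_space_of s"
    then obtain a where "x = (\<sigma> ^^ j) (\<Sum>i<t div s. a i *s E (i * s))"
      by (auto simp: sigma_space_eq[OF assms])
    hence "x = (\<Sum>i<t div s. (C * (\<theta> ^^ j) (a i)) *s E (i * s + j))"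
      by (simp add: C(2) vec.scale_sum_right add.commute)
    thus "x \<in> {\<Sum>i<t div s. a i *s E (i * s + j) | a. True}"
      by (intro CollectI exI[of _ "\<lambda>i. C * (\<theta> ^^ j) (a i)"]) simp
  next
    fix x assume "x \<in> {\<Sum>i<t div s. a i *s E (i * s + j) | a. True}"
    then obtain a where x: "x = (\<Sum>i<t div s. a i *s E (i * s + j))" by auto
    \<comment> \<open>Preimages under \<open>\<theta> ^^ j\<close> undo the twist of the
      coefficients, and the division by \<open>C\<close> undoes the common scalar.\<close>
    define b where "b i = inv_into UNIV (\<theta> ^^ j) (a i / C)" for i
    have "(\<theta> ^^ j) (b i) = a i / C" for i
      unfolding b_def by (rule surj_f_inv_f[OF bij_is_surj[OF aut_bij[OF aut_power]]])
    hence "x = (\<sigma> ^^ j) (\<Sum>i<t div s. b i *s E (i * s))"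
      unfolding C(2) x vec.scale_sum_right using C(1) by (simp add: add.commute)
    thus "x \<in> (\<sigma> ^^ j) ` sigma_space_of s"
      unfolding sigma_space_eq[OF assms] by blast
  qed
qed

lemma conjugate_span_eq:
  "conjugate_span \<sigma> s (vec.span {\<Sum>i<t div s. a i *s E (i * s)})
    = {\<Sum>j<s. d j *s (\<Sum>i<t div s. (\<theta> ^^ j) (a i) *s E (i * s + j)) | d. True}"
proof -
  let ?w = "\<Sum>i<t div s. a i *s E (i * s)"
  let ?h = "\<lambda>j. \<Sum>i<t div s. (\<theta> ^^ j) (a i) *s E (i * s + j)"
  have "(\<sigma> ^^ j) ` vec.span {?w} = vec.span {?h j}" for j
  proof -
    obtain C where C: "C \<noteq> 0"
      "\<And>J a g. (\<sigma> ^^ j) (\<Sum>i\<in>(J :: nat set). a i *s E (g i)) = C *s (\<Sum>i\<in>J. (\<theta> ^^ j) (a i) *s E (j + g i))"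
      by (rule sigma_power_combination[of j]) blast
    have "(\<sigma> ^^ j) ?w = C *s ?h j" unfolding C(2) by (simp add: add.commute)
    thus ?thesis using C(1) by (simp add: sigma_power_span span_singleton_scale)
  qed
  hence "conjugate_span \<sigma> s (vec.span {?w}) = vec.span (\<Union>j<s. vec.span {?h j})"
    by (simp add: conjugate_span_def)
  also have "\<dots> = vec.span (?h ` {..<s})"
  proof (intro equalityI vec.span_minimal vec.subspace_span)
    show "(\<Union>j<s. vec.span {?h j}) \<subseteq> vec.span (?h ` {..<s})"
      by (intro UN_least vec.span_mono) auto
    show "?h ` {..<s} \<subseteq> vec.span (\<Union>j<s. vec.span {?h j})"
      by (intro image_subsetI vec.span_base UN_I) (auto intro: vec.span_base)
  qed
  finally show ?thesis by (simp only: span_family)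
qed

text \<open>With \<open>F\<close> the fixed field of \<open>\<theta> ^^ s\<close>, this is the
  \<open>F\<close>-space of dimension one (for nonzero \<open>z\<close>) spanned by
  \<open>z\<close>.\<close>

definition subline :: "nat \<Rightarrow> 'K \<Rightarrow> ('K^'r) set" where
  "subline s z = {vec_of (w * z) | w. (\<theta> ^^ s) w = w}"

definition frame_point :: "nat \<Rightarrow> 'K \<Rightarrow> ('K^'n) set" where
  "frame_point s z = vec.span {\<Sum>i<t div s. (\<theta> ^^ (i * s)) z *s E (i * s)}"

text \<open>Membership of \<open>ext_vec y\<close> in the conjugate span means that the conjugates
  of \<open>y / z\<close> are constant along each residue class, that is, that
  \<open>\<theta> ^^ s\<close> fixes \<open>y / z\<close>.\<close>

lemma subgeometry_part_frame_point:
  assumes s: "s dvd t" and z: "z \<noteq> 0"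
  shows "subgeometry_part \<iota> p (conjugate_span \<sigma> s (frame_point s z)) = subline s z"
proof -
  have cs: "conjugate_span \<sigma> s (frame_point s z) = {\<Sum>j<s. d j *s frame s z j | d. True}"
    unfolding frame_point_def conjugate_span_eq frame_def by (simp add: funpow_add add.commute)
  have s0: "s > 0" using s t_pos by (auto intro: Nat.gr0I)
  have "ext_vec y \<in> conjugate_span \<sigma> s (frame_point s z) \<longleftrightarrow> (\<theta> ^^ s) (y / z) = y / z" for y
  proof
    assume "ext_vec y \<in> conjugate_span \<sigma> s (frame_point s z)"
    then obtain d where "ext_vec y = (\<Sum>j<s. d j *s frame s z j)" unfolding cs by auto
    hence "(\<Sum>j<s. \<Sum>i<t div s. (\<theta> ^^ (i * s + j)) y *s E (i * s + j))
       = (\<Sum>j<s. \<Sum>i<t div s. (d j * (\<theta> ^^ (i * s + j)) z) *s E (i * s + j))"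
      by (simp add: ext_vec_frame[OF s] frame_def vec.scale_sum_right)
    from split_eqD[OF s this s0]
    have eq: "(\<theta> ^^ (i * s)) (y / z) = d 0" if "i < t div s" for i
      using that z by (simp add: th_divide th_eq_0_iff field_simps)
    show "(\<theta> ^^ s) (y / z) = y / z"
    \<comment> \<open>For \<open>s = t\<close> a residue class has a single index and the claim is
      \<open>power_t\<close>; otherwise indices 0 and 1 of the class are compared.\<close>
    proof (cases "s = t")
      case True
      thus ?thesis by (simp add: power_t)
    next
      case False
      thus ?thesis using one_less_div[OF s] eq[of 1] eq[of 0] by simp
    qed
  next
    assume fx: "(\<theta> ^^ s) (y / z) = y / z"
    have "ext_vec y = ext_vec (y / z * z)" using z by simp
    also have "\<dots> = (\<Sum>j<s. (\<theta> ^^ j) (y / z) *s frame s z j)"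
      using fx by (simp only: ext_vec_frame[OF s] frame_mult)
    finally show "ext_vec y \<in> conjugate_span \<sigma> s (frame_point s z)" unfolding cs
      by (intro CollectI exI[of _ "\<lambda>j. (\<theta> ^^ j) (y / z)"]) simp
  qed
  hence "subgeometry_part \<iota> p (conjugate_span \<sigma> s (frame_point s z))
      = {vec_of y | y. (\<theta> ^^ s) (y / z) = y / z}"
    unfolding subgeometry_part_def p_eq_range by (auto simp: iota_vec_of)
  also have "\<dots> = subline s z"
  proof -
    have "vec_of y = vec_of (y / z * z)" for y using z by simp
    moreover have "w * z / z = w" for w using z by simp
    ultimately show ?thesis unfolding subline_def by fastforce
  qed
  finally show ?thesis .
qed

lemma frame_point_fixed:
  assumes s: "s dvd t" and z: "z \<noteq> 0"
  shows "frame_point s z \<in> fixed_points \<iota> \<sigma> p s" and "frame_point s z \<subseteq> sigma_space_of s"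
proof -
  let ?w = "\<Sum>i<t div s. (\<theta> ^^ (i * s)) z *s E (i * s)"
  obtain C where C: "C \<noteq> 0"
    "\<And>J a g. (\<sigma> ^^ s) (\<Sum>i\<in>(J :: nat set). a i *s E (g i)) = C *s (\<Sum>i\<in>J. (\<theta> ^^ s) (a i) *s E (s + g i))"
    by (rule sigma_power_combination[of s]) blast
  have "(\<sigma> ^^ s) ?w = C *s (\<Sum>i<t div s. (\<theta> ^^ (Suc i * s)) z *s E (Suc i * s))"
    unfolding C(2) by (simp add: funpow_add)
  \<comment> \<open>The terms are only shifted cyclically: the one of index \<open>t div s\<close>
    equals that of index 0, as \<open>E\<close> and the powers of \<open>\<theta>\<close> have
    period \<open>t\<close>.\<close>
  also have "(\<Sum>i<t div s. (\<theta> ^^ (Suc i * s)) z *s E (Suc i * s)) = ?w"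
  proof -
    let ?g = "\<lambda>i. (\<theta> ^^ (i * s)) z *s E (i * s)"
    have "?g (t div s) = ?g 0" using s power_t E_periodic[of 0] by simp
    thus ?thesis using sum.lessThan_Suc_shift[of ?g "t div s"] by simp
  qed
  finally have sw: "(\<sigma> ^^ s) ?w = C *s ?w" .
  have in_ext: "frame_point s z \<subseteq> extension \<iota> p"
  proof -
    have "E (i * s) \<in> vec.span (E ` {..<t})" for i
      using E_mod[of "i * s"] t_pos by (metis imageI lessThan_iff mod_less_divisor vec.span_base)
    hence "?w \<in> vec.span (E ` {..<t})" by (intro vec.span_sum vec.span_scale)
    thus ?thesis unfolding frame_point_def extension_p
      by (intro vec.span_minimal) auto
  qed
  moreover have "?w \<noteq> 0"
  proof
    assume "?w = 0"
    have "ext_vec z \<noteq> 0"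
      using E_eqD[of "\<lambda>i. (\<theta> ^^ i) z" "\<lambda>_. 0" 0] z t_pos by (auto simp: ext_vec_def)
    moreover have "frame s z 0 \<noteq> 0"
      using lin_indepD[OF frame_indep[OF s z], of "\<lambda>j. if j = 0 then 1 else 0" 0] s t_pos
      by (auto simp: if_distrib[of "\<lambda>c. c *s _"] intro: Nat.gr0I cong: if_cong)
    ultimately show False using \<open>?w = 0\<close> by (simp add: frame_def)
  qed
  moreover have "(\<sigma> ^^ s) ` frame_point s z = frame_point s z"
    unfolding frame_point_def sigma_power_span sw using C(1) by (simp add: span_singleton_scale)
  ultimately show "frame_point s z \<in> fixed_points \<iota> \<sigma> p s"
    unfolding fixed_points_def pg_points_vec frame_point_def by blast
  have "?w \<in> sigma_space_of s" unfolding sigma_space_eq[OF s]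
    by (intro CollectI exI[of _ "\<lambda>i. (\<theta> ^^ (i * s)) z"]) simp
  moreover have "vec.subspace (sigma_space_of s)"
    unfolding sigma_space_def conjugate_span_def by (rule vec.subspace_span)
  ultimately show "frame_point s z \<subseteq> sigma_space_of s"
    unfolding frame_point_def by (intro vec.span_minimal) auto
qed

text \<open>The class of index 0 in the expansion of \<open>ext_vec z\<close> is a multiple of the
  generating vector, so any element containing \<open>vec_of z\<close> is generated by
  \<open>frame_point s z\<close>. This gives uniqueness; existence is
  \<open>frame_point_fixed\<close>.\<close>

lemma subspread_iff:
  assumes s: "s dvd t" and z: "z \<noteq> 0"
  shows "D \<in> subspread_of s \<and> vec_of z \<in> D \<longleftrightarrow> D = subline s z"
proof
  assume D: "D \<in> subspread_of s \<and> vec_of z \<in> D"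
  then obtain X where X: "X \<in> fixed_points \<iota> \<sigma> p s" "X \<subseteq> sigma_space_of s"
    and DX: "D = subgeometry_part \<iota> p (conjugate_span \<sigma> s X)"
    by (auto simp: subspread_def)
  obtain w where w: "w \<noteq> 0" "X = vec.span {w}" using X(1) by (auto simp: fixed_points_def pg_points_vec)
  have "w \<in> sigma_space_of s" using w X(2) vec.span_base[of w "{w}"] by auto
  then obtain a where a: "w = (\<Sum>i<t div s. a i *s E (i * s))" unfolding sigma_space_eq[OF s] by auto
  have s0: "s > 0" using s t_pos by (auto intro: Nat.gr0I)
  have "ext_vec z \<in> conjugate_span \<sigma> s X"
    using D unfolding DX by (auto simp: subgeometry_part_def iota_vec_of)
  then obtain d where "ext_vec z = (\<Sum>j<s. d j *s (\<Sum>i<t div s. (\<theta> ^^ j) (a i) *s E (i * s + j)))"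
    unfolding w(2) a conjugate_span_eq by auto
  hence "(\<Sum>j<s. \<Sum>i<t div s. (\<theta> ^^ (i * s + j)) z *s E (i * s + j))
       = (\<Sum>j<s. \<Sum>i<t div s. (d j * (\<theta> ^^ j) (a i)) *s E (i * s + j))"
    by (simp add: ext_vec_frame[OF s] frame_def vec.scale_sum_right)
  from split_eqD[OF s this s0] have eq: "(\<theta> ^^ (i * s)) z = d 0 * a i" if "i < t div s" for i
    using that by simp
  have "d 0 \<noteq> 0" using eq[OF div_pos[OF s]] z by auto
  moreover have "(\<Sum>i<t div s. (\<theta> ^^ (i * s)) z *s E (i * s)) = d 0 *s w"
    unfolding a vec.scale_sum_right by (intro sum.cong refl) (simp add: eq)
  ultimately have "frame_point s z = X"
    by (simp add: frame_point_def w(2) span_singleton_scale)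
  thus "D = subline s z" using DX subgeometry_part_frame_point[OF s z] by simp
next
  assume D: "D = subline s z"
  have "subline s z \<in> subspread_of s"
    unfolding subspread_def subgeometry_part_frame_point[OF s z, symmetric]
    using frame_point_fixed[OF s z] by blast
  moreover have "vec_of z \<in> subline s z"
    unfolding subline_def by (intro CollectI exI[of _ 1]) (simp add: th_1)
  ultimately show "D \<in> subspread_of s \<and> vec_of z \<in> D" using D by simp
qed

lemma base_linear_subline:
  assumes "vec_of y \<in> subline s z"
  shows "pt y \<subseteq> subline s z"
proof -
  obtain w where w: "y = w * z" "(\<theta> ^^ s) w = w" using assms by (auto simp: subline_def)
  have "vec_of (emb a * y) \<in> subline s z" for a
    unfolding subline_def w by (intro CollectI exI[of _ "emb a * w"]) (simp add: th_mult th_emb w mult.assoc)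
  thus ?thesis by (auto simp: pt_def base_point_def vec_of_emb)
qed

lemma vec_of_in_pt [simp]: "vec_of y \<in> pt y"
  by (simp add: pt_def)

lemma points_in_subspread:
  assumes s: "s dvd t" and y1: "y1 \<noteq> 0"
  shows "D \<in> subspread_of s \<and> pt y1 \<subseteq> D \<and> pt y2 \<subseteq> D \<longleftrightarrow>
    D = subline s y1 \<and> (\<theta> ^^ s) (y2 / y1) = y2 / y1"
proof -
  have "vec_of y2 \<in> subline s y1 \<longleftrightarrow> (\<theta> ^^ s) (y2 / y1) = y2 / y1"
  proof
    assume "(\<theta> ^^ s) (y2 / y1) = y2 / y1"
    thus "vec_of y2 \<in> subline s y1"
      unfolding subline_def using y1 by (intro CollectI exI[of _ "y2 / y1"]) simp
  qed (auto simp: subline_def y1)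
  moreover have "pt y2 \<subseteq> subline s y1 \<longleftrightarrow> vec_of y2 \<in> subline s y1"
    using base_linear_subline vec_of_in_pt by blast
  moreover have "pt y1 \<subseteq> subline s y1"
    using subspread_iff[OF s y1, of "subline s y1"] base_linear_subline by blast
  ultimately show ?thesis
    using subspread_iff[OF s y1, of D] vec_of_in_pt[of y1] by blast
qed

text \<open>Two points share an element of \<open>subspread_of s\<close> when their ratio is fixed
  by \<open>\<theta> ^^ s\<close>; the level is thus the degree over the base field of the subfield
  generated by the ratio.\<close>

lemma level_eq:
  assumes "y1 \<noteq> 0"
  shows "level_of (pt y1) (pt y2) = (LEAST s. s dvd t \<and> (\<theta> ^^ s) (y2 / y1) = y2 / y1)"
proof -
  have "s dvd t \<and> (\<exists>D\<in>subspread_of s. pt y1 \<subseteq> D \<and> pt y2 \<subseteq> D) \<longleftrightarrow>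
      s dvd t \<and> (\<theta> ^^ s) (y2 / y1) = y2 / y1" for s
  proof (cases "s dvd t")
    case True
    thus ?thesis by (simp add: Bex_def points_in_subspread[OF True assms])
  qed simp
  thus ?thesis by (simp add: level_def)
qed

lemma extension_pt: "extension \<iota> (pt y) = vec.span {ext_vec y}"
proof -
  have "\<iota> ` pt y = range (\<lambda>a. emb a *s ext_vec y)"
  proof -
    have "\<iota> (emb a *s vec_of y) = emb a *s ext_vec y" for a
      unfolding vec_of_emb[symmetric] iota_vec_of
      by (simp add: ext_vec_def th_mult th_emb vec.scale_sum_right)
    thus ?thesis by (simp add: pt_def base_point_def image_image)
  qed
  moreover have "ext_vec y \<in> range (\<lambda>a. emb a *s ext_vec y)" by (intro range_eqI[of _ _ 1]) simp
  ultimately show ?thesis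
    unfolding extension_def
    by (intro equalityI vec.span_minimal vec.subspace_span)
      (auto intro!: vec.span_base simp: vec.span_singleton)
qed

lemma sum_single:
  fixes i n :: nat
  assumes "i < n"
  shows "(\<Sum>j<n. (if j = i then a else 0) *s f j) = a *s (f i :: 'K^'n)"
proof -
  have "(\<Sum>j<n. (if j = i then a else 0) *s f j) = (\<Sum>j\<in>{i}. (if j = i then a else 0) *s f j)"
    using assms by (intro sum.mono_neutral_right) auto
  thus ?thesis by simp
qed

lemma ext_vec_mult_frame:
  "s dvd t \<Longrightarrow> (\<theta> ^^ s) w = w \<Longrightarrow> ext_vec (w * z) = (\<Sum>j<s. (\<theta> ^^ j) w *s frame s z j)"
  by (simp only: ext_vec_frame frame_mult)

end

section \<open>The curve and the block through two points\<close>

locale design_block = design +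
  fixes y1 y2 and s :: nat
  assumes y1_nz: "y1 \<noteq> 0" and y2_nz: "y2 \<noteq> 0" and pts_distinct: "pt y1 \<noteq> pt y2"
    and s_eq: "s = level_of (pt y1) (pt y2)"
begin

definition u where "u = y2 / y1"

lemma s_least: "s = (LEAST s. s dvd t \<and> (\<theta> ^^ s) u = u)"
  using level_eq[OF y1_nz, of y2] by (simp add: s_eq u_def)

lemma s_dvd: "s dvd t" and s_fixes: "(\<theta> ^^ s) u = u"
  using LeastI[of "\<lambda>s. s dvd t \<and> (\<theta> ^^ s) u = u" t] by (simp_all add: s_least[symmetric] power_t)

lemma s_min: "r dvd t \<Longrightarrow> (\<theta> ^^ r) u = u \<Longrightarrow> s \<le> r"
  unfolding s_least by (rule Least_le) simp

lemma s_pos: "s > 0"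
  using s_dvd t_pos by (auto intro: Nat.gr0I)

lemma u_nz: "u \<noteq> 0"
  by (simp add: u_def y1_nz y2_nz)

text \<open>Level 1 would put the ratio into the base field, so the two points would coincide. The
  degree \<open>s - 1\<close> of the curve is therefore positive.\<close>

lemma s_gt_1: "s > 1"
proof (rule ccontr)
  assume "\<not> s > 1"
  hence "s = 1" using s_pos by simp
  hence "u \<in> range emb" using s_fixes by (intro fixed_in_base) simp
  then obtain a where a: "u = emb a" by auto
  hence "y2 = emb a * y1" using y1_nz by (auto simp: u_def field_simps)
  moreover have "a \<noteq> 0" using a u_nz by auto
  ultimately have "pt y2 = pt y1" using pt_eq_iff[OF y2_nz] by auto
  thus False using pts_distinct by simp
qed

text \<open>A coincidence gives \<open>m < s\<close> such that \<open>\<theta> ^^ m\<close> fixes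
  \<open>u\<close>. By Bezout the power \<open>gcd m t\<close> fixes \<open>u\<close> too, and as a
  divisor of \<open>t\<close> it contradicts the minimality of \<open>s\<close>.\<close>

lemma conjugates_distinct:
  assumes "i < j" and "j < s"
  shows "(\<theta> ^^ i) u \<noteq> (\<theta> ^^ j) u"
proof
  assume eq: "(\<theta> ^^ i) u = (\<theta> ^^ j) u"
  define m where "m = j - i"
  have m: "m > 0" "m < s" using assms by (auto simp: m_def)
  have "(\<theta> ^^ i) ((\<theta> ^^ m) u) = (\<theta> ^^ i) u"
    using eq assms funpow_add[of i m \<theta>] by (simp add: m_def)
  hence fx: "(\<theta> ^^ m) u = u" using aut_inj[OF aut_power[of i]] by (simp add: inj_def)
  obtain x y where xy: "m * x = t * y + gcd m t" using bezout_nat[of m t] m by auto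
  have "(\<theta> ^^ gcd m t) u = (\<theta> ^^ (y * t + gcd m t)) u"
    using fixed_power_mult[of t "(\<theta> ^^ gcd m t) u" 0 0]
    by (simp add: funpow_mod_eq power_mod_t[of "y * t + gcd m t"] power_mod_t[of "gcd m t"])
  also have "\<dots> = (\<theta> ^^ (x * m + 0)) u" using xy by (simp add: mult.commute)
  also have "\<dots> = u" using fixed_power_mult[OF fx, of x 0] by simp
  finally have "s \<le> gcd m t" by (intro s_min) auto
  also have "gcd m t \<le> m" using m by (intro dvd_imp_le) auto
  finally show False using m by simp
qed

lemma inj_conjugates: "inj_on (\<lambda>j. (\<theta> ^^ j) u) {..<s}"
  using conjugates_distinct by (intro linorder_inj_onI) auto

abbreviation "f \<equiv> frame s y1"

lemma common_element_eq: "common_element t \<iota> \<sigma> \<nu> p (pt y1) (pt y2) = subline s y1"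
  unfolding common_element_def s_eq[symmetric]
    points_in_subspread[OF s_dvd y1_nz] using s_fixes[unfolded u_def] by simp

text \<open>
  Dedekind's lemma on the field fixed by \<open>\<theta> ^^ s\<close>, where \<open>u\<close> separates the powers of \<open>\<theta>\<close>.
\<close>

lemma extension_subline: "extension \<iota> (subline s y1) = vec.span (f ` {..<s})"
proof -
  let ?W = "vec.span (\<iota> ` subline s y1)"
  have in_W: "(\<Sum>j<s. (\<theta> ^^ j) w *s f j) \<in> ?W" if w: "(\<theta> ^^ s) w = w" for w
  proof -
    have "vec_of (w * y1) \<in> subline s y1"
      unfolding subline_def by (intro CollectI exI[of _ w]) (simp add: w)
    hence "ext_vec (w * y1) \<in> ?W" unfolding iota_vec_of[symmetric] by (intro vec.span_base imageI)
    thus ?thesis by (simp only: ext_vec_mult_frame[OF s_dvd w])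
  qed
  have sep: "\<exists>y\<in>{w. (\<theta> ^^ s) w = w}. (\<theta> ^^ i) y \<noteq> (\<theta> ^^ j) y"
    if "i \<in> {..<s}" "j \<in> {..<s}" "i \<noteq> j" for i j
    using s_fixes inj_onD[OF inj_conjugates _ that(1,2)] that(3) by blast
  have "f j \<in> ?W" if "j < s" for j
    using vec.dedekind_independence[of "{..<s}" ?W "{w. (\<theta> ^^ s) w = w}" "\<lambda>i. \<theta> ^^ i" f j]
      in_W sep that by (simp add: th_mult th_1)
  moreover have "\<iota> ` subline s y1 \<subseteq> vec.span (f ` {..<s})"
  proof clarify
    fix v assume "v \<in> subline s y1"
    then obtain w where w: "v = vec_of (w * y1)" "(\<theta> ^^ s) w = w" by (auto simp: subline_def)
    show "\<iota> v \<in> vec.span (f ` {..<s})"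
      unfolding w(1) iota_vec_of ext_vec_mult_frame[OF s_dvd w(2)]
      by (intro vec.span_sum vec.span_scale vec.span_base) auto
  qed
  ultimately show ?thesis
    unfolding extension_def by (intro equalityI vec.span_minimal) auto
qed

text \<open>The conjugates of \<open>sigma_space_of s\<close> live on different residue classes of
  indices, so comparing classes removes every \<open>f j\<close> with
  \<open>j \<noteq> i\<close>.\<close>

lemma extension_inter_sigma_space:
  assumes i: "i < s"
  shows "extension \<iota> (subline s y1) \<inter> (\<sigma> ^^ i) ` sigma_space_of s = vec.span {f i}"
proof (intro equalityI subsetI)
  fix x assume "x \<in> extension \<iota> (subline s y1) \<inter> (\<sigma> ^^ i) ` sigma_space_of s"
  hence x: "x \<in> extension \<iota> (subline s y1)" "x \<in> (\<sigma> ^^ i) ` sigma_space_of s" by auto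
  obtain d where d: "x = (\<Sum>j<s. d j *s f j)"
    using x(1) unfolding extension_subline span_family by auto
  obtain a where a: "x = (\<Sum>m<t div s. a m *s E (m * s + i))"
    using x(2) unfolding sigma_power_sigma_space[OF s_dvd] by auto
  \<comment> \<open>Padding with zeros in the other residue classes makes both expansions run over
    the same index pairs.\<close>
  have "x = (\<Sum>j<s. (if j = i then 1 else 0) *s (\<Sum>m<t div s. a m *s E (m * s + j)))"
    using sum_single[OF i, of 1 "\<lambda>j. \<Sum>m<t div s. a m *s E (m * s + j)"] a by simp
  also have "\<dots> = (\<Sum>j<s. \<Sum>m<t div s. ((if j = i then 1 else 0) * a m) *s E (m * s + j))"
    by (simp add: vec.scale_sum_right)
  finally have "(\<Sum>j<s. \<Sum>m<t div s. (d j * (\<theta> ^^ (m * s + j)) y1) *s E (m * s + j)) =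
      (\<Sum>j<s. \<Sum>m<t div s. ((if j = i then 1 else 0) * a m) *s E (m * s + j))"
    unfolding d frame_def by (simp add: vec.scale_sum_right)
  from split_eqD[OF s_dvd this _ div_pos[OF s_dvd]]
  have coeff: "d j * (\<theta> ^^ j) y1 = (if j = i then 1 else 0) * a 0" if "j < s" for j using that by simp
  have "d j = 0" if "j < s" "j \<noteq> i" for j using coeff[of j] that y1_nz by (simp add: th_eq_0_iff)
  hence "x = (\<Sum>j\<in>{i}. d j *s f j)" unfolding d using i by (intro sum.mono_neutral_right) auto
  thus "x \<in> vec.span {f i}" by (auto simp: vec.span_singleton)
next
  fix x assume "x \<in> vec.span {f i}"
  then obtain k where x: "x = k *s f i" by (auto simp: vec.span_singleton)
  have "f i \<in> vec.span (f ` {..<s})" using i by (intro vec.span_base) auto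
  hence "x \<in> extension \<iota> (subline s y1)" unfolding extension_subline x by (rule vec.span_scale)
  moreover have "x = (\<Sum>m<t div s. (k * (\<theta> ^^ (m * s + i)) y1) *s E (m * s + i))"
    unfolding x frame_def by (simp add: vec.scale_sum_right)
  hence "x \<in> (\<sigma> ^^ i) ` sigma_space_of s"
    unfolding sigma_power_sigma_space[OF s_dvd]
    by (intro CollectI exI[of _ "\<lambda>m. k * (\<theta> ^^ (m * s + i)) y1"]) simp
  ultimately show "x \<in> extension \<iota> (subline s y1) \<inter> (\<sigma> ^^ i) ` sigma_space_of s" by simp
qed

sublocale curve_frame "s - 1" f "\<lambda>j. (\<theta> ^^ j) u"
proof
  show "s - 1 > 0" using s_gt_1 by simp
  show "lin_indep (Suc (s - 1)) f" using frame_indep[OF s_dvd y1_nz] s_pos by simp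
  show "inj_on (\<lambda>j. (\<theta> ^^ j) u) {..s - 1}"
    by (rule inj_on_subset[OF inj_conjugates]) (use s_pos in auto)
  show "(\<theta> ^^ j) u \<noteq> 0" for j using u_nz by (simp add: th_eq_0_iff)
qed

lemma atMost_s: "{..s - 1} = {..<s}"
  using s_pos by auto

abbreviation "curve \<equiv> standard_curve (s - 1) f (\<lambda>j. (\<theta> ^^ j) u)"

text \<open>In the frame \<open>f\<close> the first point has all coordinates 1 and the second the
  conjugates of \<open>u\<close>, so the description is resolved by
  \<open>nrc_unique\<close>.\<close>

lemma block_curve_eq:
  "block_curve t \<iota> \<sigma> \<nu> p (pt y1) (pt y2) = curve"
proof -
  have P: "extension \<iota> (pt y1) = vec.span {\<Sum>j\<le>s - 1. f j}"
    unfolding atMost_s by (simp add: extension_pt ext_vec_frame[OF s_dvd])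
  have "ext_vec y2 = ext_vec (u * y1)" using y1_nz by (simp add: u_def)
  hence Q: "extension \<iota> (pt y2) = vec.span {\<Sum>j\<le>s - 1. (\<theta> ^^ j) u *s f j}"
    unfolding atMost_s by (simp add: extension_pt ext_vec_mult_frame[OF s_dvd s_fixes])
  show ?thesis
    unfolding block_curve_def s_eq[symmetric] common_element_eq P Q
  proof (rule the_equality)
    show "normal_rational_curve (s - 1) (curve) \<and>
      vec.span {\<Sum>j\<le>s - 1. f j} \<in> curve \<and>
      vec.span {\<Sum>j\<le>s - 1. (\<theta> ^^ j) u *s f j} \<in> curve \<and>
      (\<forall>i<s. extension \<iota> (subline s y1) \<inter> (\<sigma> ^^ i) ` sigma_space_of s
        \<in> curve)"
      using standard_curve_nrc standard_curve_points extension_inter_sigma_space by auto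
  next
    fix C assume C: "normal_rational_curve (s - 1) C \<and>
      vec.span {\<Sum>j\<le>s - 1. f j} \<in> C \<and> vec.span {\<Sum>j\<le>s - 1. (\<theta> ^^ j) u *s f j} \<in> C \<and>
      (\<forall>i<s. extension \<iota> (subline s y1) \<inter> (\<sigma> ^^ i) ` sigma_space_of s \<in> C)"
    show "C = curve"
    proof (rule nrc_unique)
      show "vec.span {f j} \<in> C" if "j \<le> s - 1" for j
      proof -
        have "j < s" using that s_pos by simp
        thus ?thesis using C extension_inter_sigma_space[of j] by metis
      qed
    qed (use C in auto)
  qed
qed

text \<open>
  In the coordinate \<open>y1 / y\<close> the curve is the line of the points \<open>A + B / u\<close>, and those of \<open>\<pi>\<^sub>\<infinity>\<close> have
  \<open>A\<close>, \<open>B\<close> fixed by \<open>\<theta>\<close>.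
\<close>

lemma pt_in_curve_iff:
  assumes y: "y \<noteq> 0"
  shows "vec.span {ext_vec y} \<in> curve \<longleftrightarrow>
    (\<exists>a b. 1 / y = emb a / y1 + emb b / y2)"
proof
  assume "vec.span {ext_vec y} \<in> curve"
  then obtain A B where AB: "(A, B) \<noteq> (0, 0)"
    "vec.span {ext_vec y} = vec.span {curve_vector (s - 1) f (\<lambda>j. (\<theta> ^^ j) u) A B}"
    by (auto simp: standard_curve_def)
  have "ext_vec y \<noteq> 0"
    using E_eqD[of "\<lambda>i. (\<theta> ^^ i) y" "\<lambda>_. 0" 0] y t_pos by (auto simp: ext_vec_def)
  then obtain l where l: "l \<noteq> 0" "ext_vec y = l *s curve_vector (s - 1) f (\<lambda>j. (\<theta> ^^ j) u) A B"
    using AB(2) span_singleton_eq_iff by blast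
  define m where "m i = A + B / (\<theta> ^^ i) u" for i
  define K where "K j = (\<Prod>i\<in>{..s - 1}-{j}. m i)" for j
  have "ext_vec y = (\<Sum>j<s. (l * K j) *s f j)"
    unfolding atMost_s[symmetric] l(2) curve_vector_def K_def m_def by (simp add: vec.scale_sum_right)
  hence "(\<Sum>j<s. \<Sum>i<t div s. (\<theta> ^^ (i * s + j)) y *s E (i * s + j))
       = (\<Sum>j<s. \<Sum>i<t div s. (l * K j * (\<theta> ^^ (i * s + j)) y1) *s E (i * s + j))"
    by (simp add: ext_vec_frame[OF s_dvd] frame_def vec.scale_sum_right)
  from split_eqD[OF s_dvd this]
  have eq: "(\<theta> ^^ (i * s + j)) (y / y1) = l * K j" if "i < t div s" "j < s" for i j
    using that y1_nz by (simp add: th_divide th_eq_0_iff field_simps)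
  define w where "w = y / y1"
  have w_nz: "w \<noteq> 0" using y y1_nz by (simp add: w_def)
  have wK: "(\<theta> ^^ j) w = l * K j" if "j < s" for j
    using eq[OF div_pos[OF s_dvd] that] by (simp add: w_def)
  \<comment> \<open>The value \<open>l * K j\<close> does not depend on \<open>i\<close>, so indices
    0 and 1 of the class of \<open>j = 0\<close> can be compared.\<close>
  have w_fixed: "(\<theta> ^^ s) w = w"
  proof (cases "s = t")
    case False
    thus ?thesis using one_less_div[OF s_dvd] eq[of 1 0] eq[of 0 0] s_pos by (simp add: w_def)
  qed (simp add: power_t)
  have K_nz: "K j \<noteq> 0" if "j < s" for j using wK[OF that] w_nz by (auto simp: th_eq_0_iff)
  have m_nz: "m i \<noteq> 0" if i: "i < s" for i
  proof
    assume "m i = 0"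
    obtain j where j: "j < s" "j \<noteq> i" using s_gt_1 i by (metis less_trans neq0_conv zero_less_one nat_neq_iff)
    have "K j = 0" unfolding K_def using i j \<open>m i = 0\<close> by (intro prod_zero bexI[of _ i]) auto
    thus False using K_nz j by simp
  qed
  define M where "M = (\<Prod>i\<le>s - 1. m i)"
  have M: "M \<noteq> 0" using m_nz s_pos by (auto simp: M_def)
  have K: "K j = M / m j" if "j < s" for j
    unfolding K_def M_def using that m_nz by (intro prod_remove_inverse) auto
  define A' B' where "A' = A / (l * M)" and "B' = B / (l * M)"
  define U where "U j = (\<theta> ^^ j) (1 / u)" for j
  have inv_w: "(\<theta> ^^ j) (1 / w) = A' + B' * U j" if "j < s" for j
  proof -
    have "(\<theta> ^^ j) (1 / w) = m j / (l * M)"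
      using wK[OF that] K[OF that] by (simp add: th_divide th_1)
    thus ?thesis
      by (simp add: m_def A'_def B'_def U_def th_divide th_1 add_divide_distrib)
  qed
  \<comment> \<open>Applying \<open>\<theta>\<close> to the formula at \<open>j\<close> must give
    the formula at the next index, taken modulo \<open>s\<close> because \<open>w\<close> and
    \<open>u\<close> are fixed by \<open>\<theta> ^^ s\<close>.\<close>
  have next_eq: "A' + B' * U (Suc j mod s) = \<theta> A' + \<theta> B' * U (Suc j mod s)" if j: "j < s" for j
  proof -
    have step: "\<theta> ((\<theta> ^^ j) x) = (\<theta> ^^ (Suc j mod s)) x" if "(\<theta> ^^ s) x = x" for x
    proof (cases "Suc j = s")
      case True
      have "\<theta> ((\<theta> ^^ j) x) = (\<theta> ^^ Suc j) x" by simp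
      thus ?thesis using that True by simp
    qed (use j in simp)
    have "(\<theta> ^^ s) (1 / w) = 1 / w" "(\<theta> ^^ s) (1 / u) = 1 / u"
      using w_fixed s_fixes by (simp_all add: th_divide th_1)
    hence "(\<theta> ^^ (Suc j mod s)) (1 / w) = \<theta> (A' + B' * U j)" and "\<theta> (U j) = U (Suc j mod s)"
      using inv_w[OF j] step unfolding U_def by metis+
    thus ?thesis
      using inv_w[of "Suc j mod s"] s_pos by (simp add: aut_add[OF aut_theta] aut_mult[OF aut_theta])
  qed
  \<comment> \<open>An affine function is determined by its values at two different arguments; so
    \<open>A'\<close> and \<open>B'\<close> agree with their images under
    \<open>\<theta>\<close>.\<close>
  have "U 0 \<noteq> U 1"
    using conjugates_distinct[of 0 1] s_gt_1 by (simp add: U_def th_divide th_1 aut_divide[OF aut_theta] aut_1[OF aut_theta])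
  have e1: "A' + B' * U 1 = \<theta> A' + \<theta> B' * U 1" using next_eq[of 0] s_gt_1 by simp
  have e0: "A' + B' * U 0 = \<theta> A' + \<theta> B' * U 0" using next_eq[of "s - 1"] s_pos by simp
  have "(B' - \<theta> B') * (U 0 - U 1)
      = (A' + B' * U 0 - (\<theta> A' + \<theta> B' * U 0)) - (A' + B' * U 1 - (\<theta> A' + \<theta> B' * U 1))"
    by (simp add: algebra_simps)
  hence "(B' - \<theta> B') * (U 0 - U 1) = 0" unfolding e0 e1 by simp
  hence B': "\<theta> B' = B'" using \<open>U 0 \<noteq> U 1\<close> by simp
  hence A': "\<theta> A' = A'" using e0 by simp
  obtain a b where ab: "A' = emb a" "B' = emb b" using fixed_in_base[OF A'] fixed_in_base[OF B'] by auto
  have "1 / w = emb a + emb b / u" using inv_w[of 0] s_pos ab by (simp add: U_def)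
  hence "1 / y = emb a / y1 + emb b / y2"
  proof -
    assume "1 / w = emb a + emb b / u"
    moreover have "1 / y = 1 / w * (1 / y1)" using y1_nz by (simp add: w_def)
    ultimately have "1 / y = (emb a + emb b / u) * (1 / y1)" by simp
    thus ?thesis using y1_nz by (simp add: u_def add_divide_distrib)
  qed
  thus "\<exists>a b. 1 / y = emb a / y1 + emb b / y2" by blast
next
  assume "\<exists>a b. 1 / y = emb a / y1 + emb b / y2"
  then obtain a b where ab: "1 / y = emb a / y1 + emb b / y2" by auto
  define w where "w = y / y1"
  have w_nz: "w \<noteq> 0" using y y1_nz by (simp add: w_def)
  have w: "1 / w = emb a + emb b / u" 
  proof -
    have "1 / w = 1 / y * y1" by (simp add: w_def)
    thus ?thesis unfolding ab using y1_nz by (simp add: u_def distrib_right)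
  qed
  have "(\<theta> ^^ s) (1 / w) = 1 / w"
    unfolding w using s_fixes by (simp add: th_add th_divide th_emb)
  hence "(\<theta> ^^ s) w = w" by (simp add: th_divide th_1)
  hence ext: "ext_vec y = (\<Sum>j<s. (\<theta> ^^ j) w *s f j)"
    using ext_vec_mult_frame[OF s_dvd, of w y1] y1_nz by (simp add: w_def)
  define m where "m i = emb a + emb b / (\<theta> ^^ i) u" for i
  have m: "m j = 1 / (\<theta> ^^ j) w" for j
    using arg_cong[OF w, of "\<theta> ^^ j"] by (simp add: m_def th_add th_divide th_emb th_1)
  have m_nz: "m j \<noteq> 0" for j using w_nz by (simp add: m th_eq_0_iff)
  define M where "M = (\<Prod>i\<le>s - 1. m i)"
  have M: "M \<noteq> 0" using m_nz by (auto simp: M_def)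
  \<comment> \<open>Since \<open>m j\<close> is the inverse of the \<open>j\<close>-th conjugate of
    \<open>w\<close>, omitting it multiplies the full product by that conjugate; the curve vector
    becomes a multiple of \<open>ext_vec y\<close>.\<close>
  have "(\<Prod>i\<in>{..s - 1}-{j}. m i) = M * (\<theta> ^^ j) w" if "j \<le> s - 1" for j
    using prod_remove_inverse[of j "s - 1" m] that m_nz[of j] by (simp add: M_def m)
  hence "curve_vector (s - 1) f (\<lambda>j. (\<theta> ^^ j) u) (emb a) (emb b) = M *s ext_vec y"
    unfolding curve_vector_def ext vec.scale_sum_right m_def[symmetric] atMost_s[symmetric] by simp
  hence "vec.span {ext_vec y} = vec.span {curve_vector (s - 1) f (\<lambda>j. (\<theta> ^^ j) u) (emb a) (emb b)}"
    using M by (simp add: span_singleton_scale)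
  moreover have "(emb a, emb b) \<noteq> (0, 0)" using ab y by auto
  ultimately show "vec.span {ext_vec y} \<in> curve"
    unfolding standard_curve_def by blast
qed

end

section \<open>Subspaces of the design and their dimension\<close>

context design
begin

lemma block_eq:
  assumes "y1 \<noteq> 0" and "y2 \<noteq> 0" and "pt y1 \<noteq> pt y2"
  shows "block emb t \<iota> \<sigma> \<nu> p (pt y1) (pt y2) =
    {pt y | y. y \<noteq> 0 \<and> (\<exists>a b. 1 / y = emb a / y1 + emb b / y2)}"
proof -
  interpret design_block emb q t \<theta> \<iota> \<sigma> \<nu> p \<tau> v\<^sub>0 E c y1 y2 "level_of (pt y1) (pt y2)"
    using assms by unfold_locales auto
  have "extension \<iota> (pt y) \<in> block_curve t \<iota> \<sigma> \<nu> p (pt y1) (pt y2) \<longleftrightarrow>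
      (\<exists>a b. 1 / y = emb a / y1 + emb b / y2)" if "y \<noteq> 0" for y
    unfolding block_curve_eq extension_pt by (rule pt_in_curve_iff[OF that])
  thus ?thesis unfolding block_def points_p by blast
qed

abbreviation "is_H_subspace \<equiv> H_subspace emb t \<iota> \<sigma> \<nu> p"

definition inverse_points :: "'K set \<Rightarrow> ('K^'r) set set" where
  "inverse_points W = {pt (1 / w) | w. w \<in> W \<and> w \<noteq> 0}"

lemma pt_inverse_in_iff:
  assumes W: "over_base.subspace W" and w: "w \<noteq> 0"
  shows "pt (1 / w) \<in> inverse_points W \<longleftrightarrow> w \<in> W"
proof
  assume "pt (1 / w) \<in> inverse_points W"
  then obtain w' where w': "w' \<in> W" "w' \<noteq> 0" "pt (1 / w) = pt (1 / w')"
    by (auto simp: inverse_points_def)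
  have "1 / w \<noteq> 0" using w by simp
  then obtain a where a: "a \<noteq> 0" "1 / w = emb a * (1 / w')"
    using w'(3) pt_eq_iff[of "1 / w" "1 / w'"] by blast
  have "w' = emb a * w" using a w w'(2) by (simp add: field_simps)
  hence "w = emb (inverse a) * w'" using a(1) by (simp add: emb_inverse)
  thus "w \<in> W" using over_base.subspace_scale[OF W w'(1)] by simp
qed (use w in \<open>unfold inverse_points_def, blast\<close>)

lemma inverse_points_subset_iff:
  assumes "over_base.subspace W" and "over_base.subspace W'"
  shows "inverse_points W \<subseteq> inverse_points W' \<longleftrightarrow> W \<subseteq> W'"
proof
  assume sub: "inverse_points W \<subseteq> inverse_points W'"
  show "W \<subseteq> W'"
  proof
    fix w assume w: "w \<in> W"
    show "w \<in> W'"
    proof (cases "w = 0")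
      case True
      thus ?thesis using over_base.subspace_0[OF assms(2)] by simp
    next
      case False
      thus ?thesis using sub w pt_inverse_in_iff[OF assms(1) False] pt_inverse_in_iff[OF assms(2) False] by blast
    qed
  qed
qed (unfold inverse_points_def, blast)

lemma H_subspace_inverse_points:
  assumes W: "over_base.subspace W"
  shows "is_H_subspace (inverse_points W)"
  unfolding H_subspace_def points_p
proof (intro conjI ballI impI subsetI)
  fix X assume "X \<in> inverse_points W"
  then obtain w where "X = pt (1 / w)" "1 / w \<noteq> 0" by (auto simp: inverse_points_def)
  thus "X \<in> {pt y | y. y \<noteq> 0}" by blast
next
  fix P Q X assume PQ: "P \<in> inverse_points W" "Q \<in> inverse_points W" "P \<noteq> Q"
    and X: "X \<in> block emb t \<iota> \<sigma> \<nu> p P Q"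
  obtain w1 w2 where w: "P = pt (1 / w1)" "w1 \<in> W" "w1 \<noteq> 0" "Q = pt (1 / w2)" "w2 \<in> W" "w2 \<noteq> 0"
    using PQ by (auto simp: inverse_points_def)
  obtain y a b where y: "X = pt y" "y \<noteq> 0" "1 / y = emb a / (1 / w1) + emb b / (1 / w2)"
    using X PQ(3) w block_eq[of "1 / w1" "1 / w2"] by auto
  have "1 / y \<in> W"
    unfolding y(3) using w over_base.subspace_add[OF W] over_base.subspace_scale[OF W] by simp
  thus "X \<in> inverse_points W"
    using pt_inverse_in_iff[OF W, of "1 / y"] y(1,2) by simp
qed

text \<open>Take the reciprocals of the coordinates of the points of \<open>T\<close>, together with
  0. The block through the points of \<open>1 / w1\<close> and \<open>1 / w2\<close> contains the
  point of \<open>1 / (w1 + w2)\<close>, which gives closure under addition.\<close>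

lemma H_subspace_obtain:
  assumes T: "is_H_subspace T"
  obtains W where "over_base.subspace W" "T = inverse_points W"
proof -
  define W where "W = {w. w = 0 \<or> pt (1 / w) \<in> T}"
  have scale: "emb a * w \<in> W" if "w \<in> W" for a w
  proof (cases "a = 0 \<or> w = 0")
    case False
    hence "pt (1 / (emb a * w)) = pt (1 / w)"
      by (subst pt_eq_iff) (auto intro!: exI[of _ "inverse a"] simp: emb_inverse divide_inverse)
    thus ?thesis using that False by (simp add: W_def)
  qed (auto simp: W_def)
  have add: "w1 + w2 \<in> W" if w: "w1 \<in> W" "w2 \<in> W" for w1 w2
  proof (cases "w1 = 0 \<or> w2 = 0 \<or> w1 + w2 = 0")
    case False
    show ?thesis
    proof (cases "pt (1 / w1) = pt (1 / w2)")
      \<comment> \<open>Coinciding points span no block, but then \<open>w2\<close> is a base field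
        multiple of \<open>w1\<close>.\<close>
      case True
      moreover have "1 / w1 \<noteq> 0" using False by simp
      ultimately obtain a where a: "1 / w1 = emb a * (1 / w2)"
        using pt_eq_iff[of "1 / w1" "1 / w2"] by blast
      hence "w2 = emb a * w1" using False by (simp add: field_simps)
      hence "w1 + w2 = emb (1 + a) * w1" by (simp add: emb_add algebra_simps)
      thus ?thesis using scale[OF w(1)] by simp
    next
      case ne: False
      let ?y = "1 / (w1 + w2)"
      have y: "1 / ?y = emb 1 / (1 / w1) + emb 1 / (1 / w2)" "?y \<noteq> 0" using False by auto
      have "block emb t \<iota> \<sigma> \<nu> p (pt (1 / w1)) (pt (1 / w2)) =
          {pt y | y. y \<noteq> 0 \<and> (\<exists>a b. 1 / y = emb a / (1 / w1) + emb b / (1 / w2))}"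
        by (rule block_eq) (use False ne in auto)
      also have "pt ?y \<in> \<dots>"
        by (rule CollectI, rule exI[of _ ?y], intro conjI refl y(2))
          (rule exI[of _ 1], rule exI[of _ 1], rule y(1))
      finally have "pt ?y \<in> block emb t \<iota> \<sigma> \<nu> p (pt (1 / w1)) (pt (1 / w2))" .
      moreover have "pt (1 / w1) \<in> T" "pt (1 / w2) \<in> T" using w False by (auto simp: W_def)
      ultimately have "pt ?y \<in> T" using T ne unfolding H_subspace_def by blast
      thus ?thesis by (simp add: W_def)
    qed
  qed (use w in \<open>auto simp: W_def\<close>)
  have "over_base.subspace W"
    by (rule over_base.subspaceI) (auto simp: scale add, simp add: W_def)
  moreover have "T = inverse_points W"
  proof (intro equalityI subsetI)
    fix X assume X: "X \<in> T"
    then obtain y where y: "X = pt y" "y \<noteq> 0" using T unfolding H_subspace_def points_p by auto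
    have "pt (1 / (1 / y)) = X" using y by simp
    moreover have "1 / y \<in> W" "1 / y \<noteq> 0" using X y by (auto simp: W_def)
    ultimately show "X \<in> inverse_points W" unfolding inverse_points_def by blast
  qed (auto simp: inverse_points_def W_def)
  ultimately show thesis by (rule that)
qed

text \<open>By the preceding lemmas \<open>inverse_points\<close> is an inclusion-preserving
  bijection from the subspaces of \<open>'K\<close> over \<open>'k\<close> onto the subspaces of the
  design. Generating sets of points thus correspond to spanning sets of vectors, and the least sizes
  agree.\<close>

lemma H_dim_inverse_points:
  assumes W: "over_base.subspace W"
  shows "H_dim emb t \<iota> \<sigma> \<nu> p (inverse_points W) = int (over_base.dim W) - 1"
proof -
  let ?P = "\<lambda>m. \<exists>A\<subseteq>inverse_points W. finite A \<and> card A = m \<and> is_H_subspace hull A = inverse_points W"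
  obtain B where B: "B \<subseteq> W" "over_base.independent B" "W \<subseteq> over_base.span B" "card B = over_base.dim W"
    by (rule over_base.basis_exists)
  have B_nz: "b \<noteq> 0" if "b \<in> B" for b using that B(2) over_base.dependent_zero by blast
  define A where "A = (\<lambda>b. pt (1 / b)) ` B"
  have A: "A \<subseteq> inverse_points W" using B(1) B_nz by (auto simp: A_def inverse_points_def)
  have "is_H_subspace hull A = inverse_points W"
  proof (intro equalityI hull_minimal A H_subspace_inverse_points W)
    show "inverse_points W \<subseteq> is_H_subspace hull A"
    proof (unfold hull_def, intro Inter_greatest, clarify)
      fix T X assume T: "is_H_subspace T" "A \<subseteq> T" "X \<in> inverse_points W"
      obtain W' where W': "over_base.subspace W'" "T = inverse_points W'"
        using H_subspace_obtain[OF T(1)] .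
      have "b \<in> W'" if "b \<in> B" for b
        using T(2) that pt_inverse_in_iff[OF W'(1) B_nz[OF that]] by (auto simp: A_def W'(2))
      hence "over_base.span B \<subseteq> W'" using W'(1) by (intro over_base.span_minimal) auto
      hence "W \<subseteq> W'" using B(3) by auto
      thus "X \<in> T" using T(3) inverse_points_subset_iff[OF W W'(1)] W'(2) by auto
    qed
  qed
  hence ex: "?P (card A)" using A by auto
  have "(LEAST m. ?P m) = over_base.dim W"
  proof (rule antisym)
    have "(LEAST m. ?P m) \<le> card A" using ex by (rule Least_le)
    also have "card A \<le> over_base.dim W" unfolding A_def B(4)[symmetric] by (intro card_image_le) simp
    finally show "(LEAST m. ?P m) \<le> over_base.dim W" .
    obtain A' where A': "A' \<subseteq> inverse_points W" "finite A'" "card A' = (LEAST m. ?P m)"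
      "is_H_subspace hull A' = inverse_points W"
      using LeastI[of ?P, OF ex] by blast
    have "\<forall>X\<in>A'. \<exists>w. w \<noteq> 0 \<and> X = pt (1 / w)" using A'(1) by (auto simp: inverse_points_def)
    then obtain g where g: "\<And>X. X \<in> A' \<Longrightarrow> g X \<noteq> 0 \<and> X = pt (1 / g X)" by metis
    have sp: "over_base.subspace (over_base.span (g ` A'))" by (rule over_base.subspace_span)
    have "A' \<subseteq> inverse_points (over_base.span (g ` A'))"
    proof
      fix X assume X: "X \<in> A'"
      hence "g X \<in> over_base.span (g ` A')" by (intro over_base.span_base) auto
      thus "X \<in> inverse_points (over_base.span (g ` A'))"
        using g[OF X] unfolding inverse_points_def by blast
    qed
    hence "inverse_points W \<subseteq> inverse_points (over_base.span (g ` A'))"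
      unfolding A'(4)[symmetric] by (intro hull_minimal H_subspace_inverse_points sp)
    hence "W \<subseteq> over_base.span (g ` A')" using inverse_points_subset_iff[OF W sp] by simp
    hence "over_base.dim W \<le> card (g ` A')" using A'(2) by (intro over_base.dim_le_card) auto
    also have "\<dots> \<le> card A'" using A'(2) by (rule card_image_le)
    finally show "over_base.dim W \<le> (LEAST m. ?P m)" using A'(3) by simp
  qed
  thus ?thesis by (simp add: H_dim_def)
qed

end

section \<open>The indicator line\<close>

lemma pg_line_eq:
  fixes x y :: "('a::field)^'n"
  assumes L: "pg_subspace (*s) 1 L" and "x \<in> L" "y \<in> L" and x: "x \<noteq> 0" and y: "y \<notin> vec.span {x}"
  shows "L = {a *s x + b *s y | a b. True}"
    and "a *s x + b *s y = 0 \<Longrightarrow> a = 0 \<and> b = 0"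
proof -
  have sub: "vec.subspace L" and dim: "vec.dim L = 2" using L by (auto simp: pg_subspace_def)
  have ind: "vec.independent {y, x}" using x y by (intro vec.independent_insertI) (auto simp: vec.independent_empty)
  have "y \<noteq> x" using y vec.span_base[of x "{x}"] by auto
  hence "L \<subseteq> vec.span {y, x}"
    using assms(2,3) ind dim by (intro vec.card_ge_dim_independent) auto
  moreover have "vec.span {y, x} \<subseteq> L" using assms(2,3) sub by (intro vec.span_minimal) auto
  moreover have "vec.span {y, x} = {a *s x + b *s y | a b. True}"
  proof (intro equalityI subsetI)
    fix z assume "z \<in> vec.span {y, x}"
    then obtain a b where "z - b *s y = a *s x"
      by (auto simp: vec.span_insert[of y] vec.span_singleton)
    hence "z = a *s x + b *s y" by (simp add: diff_eq_eq)
    thus "z \<in> {a *s x + b *s y | a b. True}" by blast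
  qed (auto intro!: vec.span_add vec.span_scale intro: vec.span_base)
  ultimately show "L = {a *s x + b *s y | a b. True}" by simp
  show "a = 0 \<and> b = 0" if 0: "a *s x + b *s y = 0"
  proof -
    have "b = 0"
    proof (rule ccontr)
      assume b: "b \<noteq> 0"
      have "b *s y = (- a) *s x" using 0 by (simp add: eq_neg_iff_add_eq_0 add.commute)
      hence "inverse b *s (b *s y) = inverse b *s ((- a) *s x)" by simp
      hence "y = (inverse b * (- a)) *s x" using b by simp
      thus False using y unfolding vec.span_singleton by blast
    qed
    thus ?thesis using 0 x by simp
  qed
qed

lemma pg_line_obtain:
  fixes x :: "('a::field)^'n"
  assumes L: "pg_subspace (*s) 1 L" and "x \<noteq> 0"
  obtains y where "y \<in> L" "y \<notin> vec.span {x}"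
proof -
  have "\<not> L \<subseteq> vec.span {x}"
    using L vec.dim_le_card[of L "{x}"] by (auto simp: pg_subspace_def)
  thus thesis using that by blast
qed

context field_extension
begin

lemma independent_pair:
  assumes "x \<noteq> 0" and "y \<noteq> 0" and "base_point x \<noteq> base_point y"
  shows "x \<noteq> y" "\<not> module.dependent (sub_scale emb) {x, y :: 'K^'r}"
proof -
  interpret sub: vector_space "sub_scale emb :: 'k \<Rightarrow> 'K^'r \<Rightarrow> 'K^'r" by (rule vector_space_sub_scale)
  have "x \<notin> sub.span {y}"
  proof
    assume "x \<in> sub.span {y}"
    then obtain a where a: "x = emb a *s y" by (auto simp: sub.span_singleton sub_scale_def)
    hence "a \<noteq> 0" using assms(1) by auto
    thus False using a assms(3) base_point_scale by blast
  qed
  thus "\<not> sub.dependent {x, y}" using assms(2) by (intro sub.independent_insertI) (auto simp: sub.independent_empty)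
  show "x \<noteq> y" using assms(3) by auto
qed

text \<open>Each \<open>\<iota> x\<close> is an eigenvector, as \<open>\<sigma>\<close> fixes the
  points of the subgeometry, and additivity makes the factor \<open>c\<close> the same for all of
  them; semilinearity then shows that \<open>\<theta>\<close> fixes the base field. The
  coordinatewise Frobenius map \<open>f\<close> fixes the same points, so it agrees on points with a
  power of \<open>\<sigma>\<close>.\<close>

lemma generator_companion:
  fixes L :: "('K^'r) set" and \<iota> :: "'K^'r \<Rightarrow> 'K^'n"
  assumes L: "pg_subspace (*s) 1 L"
    and emb\<iota>: "subgeometry_embedding emb L \<iota>" and gen: "subgeometry_generator emb L \<iota> \<sigma>"
  obtains \<theta> c where "aut \<theta>" "\<exists>i. \<forall>x. x ^ q = (\<theta> ^^ i) x" "c \<noteq> 0"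
    "\<And>x. x \<in> L \<Longrightarrow> \<sigma> (\<iota> x) = c *s \<iota> x" "\<And>x y. \<sigma> (x + y) = \<sigma> x + \<sigma> y"
    "\<And>a x. \<sigma> (a *s x) = \<theta> a *s \<sigma> x"
proof -
  interpret sub: vector_space "sub_scale emb :: 'k \<Rightarrow> 'K^'r \<Rightarrow> 'K^'r" by (rule vector_space_sub_scale)
  have Lsub: "vec.subspace L" using L by (simp add: pg_subspace_def)
  have Lbase: "sub.subspace L"
    using Lsub by (auto simp: base_subspace_iff vec.subspace_def)
  have \<iota>_add: "\<iota> (x + y) = \<iota> x + \<iota> y" if "x \<in> L" "y \<in> L" for x y
    using emb\<iota> that by (simp add: subgeometry_embedding_def)
  have \<iota>_scale: "\<iota> (emb a *s x) = emb a *s \<iota> x" if "x \<in> L" for x a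
    using emb\<iota> that by (simp add: subgeometry_embedding_def sub_scale_def)
  have \<iota>_ind: "inj_on \<iota> B \<and> vec.independent (\<iota> ` B)" if "B \<subseteq> L" "sub.independent B" for B
    using emb\<iota> that by (simp add: subgeometry_embedding_def)
  have \<iota>_span: "vec.span (\<iota> ` L) = UNIV"
    using emb\<iota> by (simp add: subgeometry_embedding_def)
  have \<iota>_pair: "a = 0 \<and> b = 0"
    if "x \<in> L" "y \<in> L" "x \<noteq> 0" "y \<noteq> 0" "base_point x \<noteq> base_point y" "a *s \<iota> x + b *s \<iota> y = 0" for a b x y
  proof -
    have ne: "x \<noteq> y" and "inj_on \<iota> {x, y} \<and> vec.independent (\<iota> ` {x, y})"
      using independent_pair[OF that(3-5)] \<iota>_ind[of "{x, y}"] that(1,2) by auto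
    hence ind: "vec.independent {\<iota> x, \<iota> y}" and \<iota>ne: "\<iota> x \<noteq> \<iota> y" by (auto simp: inj_on_def)
    have "(\<Sum>v\<in>{\<iota> x, \<iota> y}. (if v = \<iota> x then a else b) *s v) = 0" using that(6) \<iota>ne by simp
    from vec.independentD[OF ind _ _ this, of "\<iota> x"] vec.independentD[OF ind _ _ this, of "\<iota> y"]
    show ?thesis using \<iota>ne by (auto split: if_splits)
  qed
  have ext_point: "extension \<iota> (base_point x) = vec.span {\<iota> x}" if "x \<in> L" for x
  proof -
    have "\<iota> ` base_point x = range (\<lambda>a. emb a *s \<iota> x)"
      using \<iota>_scale[OF that] by (simp add: base_point_def image_image)
    moreover have "\<iota> x \<in> range (\<lambda>a. emb a *s \<iota> x)" by (intro range_eqI[of _ _ 1]) simp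
    ultimately show ?thesis unfolding extension_def
      by (intro equalityI vec.span_minimal vec.subspace_span) (auto intro: vec.span_base simp: vec.span_singleton)
  qed
  have point_L: "base_point x \<in> base_points L" if "x \<in> L" "x \<noteq> 0" for x
    using that base_point_subset[OF Lbase, of x] by (auto simp: pg_points_base)
  obtain \<theta> where bij: "bij \<sigma>" and add: "\<And>x y. \<sigma> (x + y) = \<sigma> x + \<sigma> y" and \<theta>: "field_embedding \<theta>"
    and scale: "\<And>a x. \<sigma> (a *s x) = \<theta> a *s \<sigma> x"
    using gen by (auto simp: subgeometry_generator_def collineation_def)
  have \<sigma>0: "\<sigma> 0 = 0" using add[of 0 0] by (metis add.right_neutral add_cancel_left_right)
  obtain v0 where v0: "v0 \<in> L" "v0 \<noteq> 0"
  proof -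
    have "\<not> L \<subseteq> {0}" using L vec.dim_le_card[of L "{}"] by (auto simp: pg_subspace_def)
    thus thesis using that by auto
  qed
  obtain v1 where v1: "v1 \<in> L" "v1 \<notin> vec.span {v0}" using pg_line_obtain[OF L v0(2)] .
  have v1_nz: "v1 \<noteq> 0" using v1(2) vec.span_zero by auto
  have v01: "base_point v0 \<noteq> base_point v1"
  proof
    assume "base_point v0 = base_point v1"
    hence "v1 \<in> base_point v0" by simp
    thus False using v1(2) by (auto simp: base_point_def vec.span_singleton)
  qed
  have \<iota>_nz: "\<iota> x \<noteq> 0" if "x \<in> L" "x \<noteq> 0" for x
  proof (cases "base_point x = base_point v0")
    case False
    thus ?thesis using \<iota>_pair[OF that(1) v0(1) that(2) v0(2) False, of 1 0] by auto
  next
    case True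
    thus ?thesis using \<iota>_pair[OF that(1) v1(1) that(2) v1_nz, of 1 0] v01 by auto
  qed
  have "\<exists>k. \<sigma> (\<iota> x) = k *s \<iota> x" if "x \<in> L" for x
  proof (cases "x = 0")
    case True
    hence "\<iota> x = 0" using \<iota>_scale[OF that, of 0] by simp
    thus ?thesis by (simp add: \<sigma>0)
  next
    case False
    have "\<sigma> ` vec.span {\<iota> x} = vec.span {\<iota> x}"
      using gen point_L[OF that False]
      unfolding subgeometry_generator_def fixes_subgeometry_def ext_point[OF that, symmetric] by blast
    hence "\<sigma> (\<iota> x) \<in> vec.span {\<iota> x}" using vec.span_base[of "\<iota> x" "{\<iota> x}"] by blast
    thus ?thesis by (auto simp: vec.span_singleton)
  qed
  then obtain k where k: "\<And>x. x \<in> L \<Longrightarrow> \<sigma> (\<iota> x) = k x *s \<iota> x" by metis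
  \<comment> \<open>The eigenvalue of \<open>\<iota> (x + y)\<close> has to equal those of both
    independent summands.\<close>
  have k_eq: "k x = k y" if "x \<in> L" "y \<in> L" "x \<noteq> 0" "y \<noteq> 0" "base_point x \<noteq> base_point y" for x y
  proof -
    have xy: "x + y \<in> L" using Lsub that by (simp add: vec.subspace_add)
    have "k (x + y) *s \<iota> (x + y) = k x *s \<iota> x + k y *s \<iota> y"
      using k[OF xy] k that by (simp add: \<iota>_add add)
    hence "(k (x + y) - k x) *s \<iota> x + (k (x + y) - k y) *s \<iota> y = 0"
      using that by (simp add: \<iota>_add vec.scale_right_distrib vec.scale_left_diff_distrib)
        (metis add_diff_add diff_self)
    from \<iota>_pair[OF that this] have "k (x + y) = k x" "k (x + y) = k y" by auto
    thus ?thesis by metis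
  qed
  define c where "c = k v0"
  have c: "\<sigma> (\<iota> x) = c *s \<iota> x" if x: "x \<in> L" for x
  proof (cases "x = 0")
    case True
    hence "\<iota> x = 0" using \<iota>_scale[OF that, of 0] by simp
    thus ?thesis by (simp add: \<sigma>0)
  next
    case False
    have "k x = k v0"
    proof (cases "base_point x = base_point v0")
      \<comment> \<open>A multiple of \<open>v0\<close> is compared with \<open>v1\<close> first,
        since \<open>k_eq\<close> needs two different points.\<close>
      case True
      hence "k x = k v1" using k_eq[OF x v1(1) False v1_nz] v01 by simp
      thus ?thesis using k_eq[OF v0(1) v1(1) v0(2) v1_nz v01] by simp
    qed (use k_eq[OF x v0(1) False v0(2)] in simp)
    thus ?thesis using k[OF x] by (simp add: c_def)
  qed
  have c_nz: "c \<noteq> 0"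
  proof
    assume "c = 0"
    hence "\<sigma> (\<iota> v0) = \<sigma> 0" using c[OF v0(1)] \<sigma>0 by simp
    hence "\<iota> v0 = 0" using bij by (simp add: bij_def inj_eq)
    thus False using \<iota>_nz v0 by simp
  qed
  have "\<theta> (emb a) = emb a" for a
  proof -
    have "emb a *s v0 \<in> L" using Lsub v0(1) by (simp add: vec.subspace_scale)
    hence "\<sigma> (emb a *s \<iota> v0) = c *s (emb a *s \<iota> v0)" using c[of "emb a *s v0"] \<iota>_scale[OF v0(1)] by simp
    hence "(\<theta> (emb a) * c) *s \<iota> v0 = (emb a * c) *s \<iota> v0"
      using c[OF v0(1)] by (simp add: scale mult.commute)
    thus ?thesis using \<iota>_nz[OF v0] c_nz by (simp only: vec.scale_cancel_right) simp
  qed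
  hence aut: "aut \<theta>" using \<theta> by (simp add: aut_def)
  obtain B where B: "B \<subseteq> L" "sub.independent B" "L \<subseteq> sub.span B"
    using sub.basis_exists[of L] by metis
  have Bi: "vec.independent (\<iota> ` B)" using \<iota>_ind B by auto
  have in_spanB: "\<iota> x \<in> vec.span (\<iota> ` B) \<and> x \<in> L" if "x \<in> sub.span B" for x
    using that
  proof (induction rule: sub.span_induct_alt)
    case base
    have "\<iota> (emb 0 *s v0) = emb 0 *s \<iota> v0" using v0(1) by (rule \<iota>_scale)
    thus ?case using Lsub by (simp add: vec.span_zero vec.subspace_0)
  next
    case (step a x y)
    have x: "x \<in> L" "emb a *s x \<in> L" using step B(1) Lsub by (auto intro: vec.subspace_scale)
    hence "\<iota> (sub_scale emb a x + y) = emb a *s \<iota> x + \<iota> y"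
      using step by (simp add: sub_scale_def \<iota>_add \<iota>_scale)
    moreover have "emb a *s x + y \<in> L" using x step Lsub by (auto intro: vec.subspace_add)
    moreover have "emb a *s \<iota> x + \<iota> y \<in> vec.span (\<iota> ` B)"
      using step by (intro vec.span_add vec.span_scale) (auto intro: vec.span_base)
    ultimately show ?case by (simp add: sub_scale_def)
  qed
  have spB: "vec.span (\<iota> ` B) = UNIV"
  proof -
    have "vec.span (\<iota> ` L) \<subseteq> vec.span (\<iota> ` B)"
      using in_spanB B(3) by (intro vec.span_minimal vec.subspace_span) auto
    thus ?thesis using \<iota>_span by auto
  qed
  define f where "f w = (\<Sum>b\<in>\<iota> ` B. (vec.representation (\<iota> ` B) w b) ^ q *s b)" for w
  note fr = aut_frobenius
  have f_add: "f (x + y) = f x + f y" for x y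
    unfolding f_def using Bi spB aut_add[OF fr]
    by (simp add: vec.representation_add vec.scale_left_distrib sum.distrib)
  have f_scale: "f (a *s x) = a ^ q *s f x" for a x
    unfolding f_def using Bi spB by (simp add: vec.representation_scale vec.scale_sum_right power_mult_distrib)
  have rep: "(\<Sum>b\<in>\<iota> ` B. vec.representation (\<iota> ` B) w b *s b) = w" for w
    using vec.sum_representation_eq[OF Bi, of w "\<iota> ` B"] spB by simp
  have "inj f"
  proof (rule injI)
    fix x y assume "f x = f y"
    hence "(\<Sum>b\<in>\<iota> ` B. (vec.representation (\<iota> ` B) x b ^ q - vec.representation (\<iota> ` B) y b ^ q) *s b) = 0"
      by (simp add: f_def vec.scale_left_diff_distrib sum_subtractf)
    from vec.independentD[OF Bi _ _ this]
    have "vec.representation (\<iota> ` B) x b ^ q = vec.representation (\<iota> ` B) y b ^ q" if "b \<in> \<iota> ` B" for b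
      using that by simp
    hence "vec.representation (\<iota> ` B) x b = vec.representation (\<iota> ` B) y b" if "b \<in> \<iota> ` B" for b
      using that aut_inj[OF fr] by (auto simp: inj_def)
    hence "(\<Sum>b\<in>\<iota> ` B. vec.representation (\<iota> ` B) x b *s b) = (\<Sum>b\<in>\<iota> ` B. vec.representation (\<iota> ` B) y b *s b)"
      by (intro sum.cong) auto
    thus "x = y" by (simp only: rep)
  qed
  hence "bij f" by (simp add: bij_def finite_UNIV_inj_surj)
  hence coll: "collineation f"
    unfolding collineation_def using f_add f_scale fr aut_bij[OF fr] by (auto simp: aut_def)
  have f_emb: "f (emb a *s x) = emb a *s f x" for a x
    using f_scale[of "emb a" x] aut_emb[OF fr] by simp
  have f_\<iota>B: "f (\<iota> x) = \<iota> x" if "x \<in> B" for x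
  proof -
    have "vec.representation (\<iota> ` B) (\<iota> x) = (\<lambda>v. if v = \<iota> x then 1 else 0)"
      using vec.representation_basis[OF Bi, of "\<iota> x"] that by auto
    hence "f (\<iota> x) = (\<Sum>b\<in>\<iota> ` B. (if b = \<iota> x then b else 0))"
      using q_gt_1 unfolding f_def by (intro sum.cong refl) (simp add: power_0_left)
    thus ?thesis using that by simp
  qed
  have f_\<iota>: "f (\<iota> x) = \<iota> x" if "x \<in> L" for x
  proof -
    have "x \<in> sub.span B" using B(3) that by auto
    hence "f (\<iota> x) = \<iota> x \<and> x \<in> L"
    proof (induction rule: sub.span_induct_alt)
      case base
      have "\<iota> (emb 0 *s v0) = emb 0 *s \<iota> v0" using v0(1) by (rule \<iota>_scale)
      moreover have "f 0 = 0" using f_emb[of 0 0] by simp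
      ultimately show ?case using Lsub by (simp add: vec.subspace_0)
    next
      case (step a x y)
      have x: "x \<in> L" "emb a *s x \<in> L" using step B(1) Lsub by (auto intro: vec.subspace_scale)
      moreover have "emb a *s x + y \<in> L" using x step Lsub by (auto intro: vec.subspace_add)
      ultimately show ?case
        using step by (simp add: sub_scale_def \<iota>_add \<iota>_scale f_add f_emb f_\<iota>B)
    qed
    thus ?thesis by simp
  qed
  have "fixes_subgeometry emb L \<iota> f"
    unfolding fixes_subgeometry_def
  proof
    fix X assume "X \<in> base_points L"
    then obtain x where x: "X = base_point x" "base_point x \<subseteq> L" by (auto simp: pg_points_base)
    hence xL: "x \<in> L" using base_point_self by blast
    have "f ` vec.span {\<iota> x} = (\<lambda>a. a *s \<iota> x) ` range (\<lambda>a. a ^ q)"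
      by (simp add: vec.span_singleton image_image f_scale f_\<iota>[OF xL])
    also have "range (\<lambda>a :: 'K. a ^ q) = UNIV" using bij_is_surj[OF aut_bij[OF fr]] .
    finally show "f ` extension \<iota> X = extension \<iota> X"
      by (simp add: x(1) ext_point[OF xL] vec.span_singleton)
  qed
  then obtain i where i: "\<And>X. X \<in> pg_points (*s) UNIV \<Longrightarrow> f ` X = (\<sigma> ^^ i) ` X"
    using gen coll by (auto simp: subgeometry_generator_def)
  have "x ^ q = (\<theta> ^^ i) x" for x
  proof -
    have \<sigma>i_add: "(\<sigma> ^^ i) (x + y) = (\<sigma> ^^ i) x + (\<sigma> ^^ i) y" for x y and i
      by (induction i) (auto simp: add)
    have \<sigma>i_scale: "(\<sigma> ^^ i) (a *s x) = (\<theta> ^^ i) a *s (\<sigma> ^^ i) x" for a x and i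
      by (induction i) (auto simp: scale)
    have "\<exists>C. \<forall>x\<in>L. (\<sigma> ^^ i) (\<iota> x) = C *s \<iota> x" for i
    proof (induction i)
      case 0
      thus ?case by (intro exI[of _ 1]) simp
    next
      case (Suc i)
      then obtain C where "\<And>x. x \<in> L \<Longrightarrow> (\<sigma> ^^ i) (\<iota> x) = C *s \<iota> x" by auto
      thus ?case by (intro exI[of _ "\<theta> C * c"]) (auto simp: scale c)
    qed
    then obtain C where C: "\<And>x. x \<in> L \<Longrightarrow> (\<sigma> ^^ i) (\<iota> x) = C *s \<iota> x" by metis
    \<comment> \<open>The two collineations agree only up to a scalar on each point. A vector with
      two independent components gets rid of the scalar: the ratio of the image components is
      \<open>x ^ q\<close> on one side and the conjugate of \<open>x\<close> on the other.\<close>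
    let ?w = "\<iota> v0 + x *s \<iota> v1"
    have "?w \<noteq> 0" using \<iota>_pair[OF v0(1) v1(1) v0(2) v1_nz v01, of 1 x] by auto
    hence "vec.span {?w} \<in> pg_points (*s) UNIV" by (auto simp: pg_points_vec)
    hence "f ?w \<in> (\<sigma> ^^ i) ` vec.span {?w}"
      using i[of "vec.span {?w}"] vec.span_base[of ?w "{?w}"] by blast
    then obtain k where "f ?w = (\<sigma> ^^ i) (k *s ?w)" by (auto simp: vec.span_singleton)
    hence "\<iota> v0 + x ^ q *s \<iota> v1
        = ((\<theta> ^^ i) k * C) *s \<iota> v0 + ((\<theta> ^^ i) k * C * (\<theta> ^^ i) x) *s \<iota> v1"
      using v0(1) v1(1)
      by (simp add: f_add f_scale f_\<iota> \<sigma>i_add \<sigma>i_scale C aut_mult[OF aut_funpow[OF aut]] vec.scale_right_distrib mult_ac)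
    hence "(1 - (\<theta> ^^ i) k * C) *s \<iota> v0 + (x ^ q - (\<theta> ^^ i) k * C * (\<theta> ^^ i) x) *s \<iota> v1 = 0"
      by (simp add: vec.scale_left_diff_distrib) (metis add_diff_add diff_self)
    from \<iota>_pair[OF v0(1) v1(1) v0(2) v1_nz v01 this] show ?thesis by auto
  qed
  thus thesis using that[OF aut _ c_nz c add scale] by blast
qed

end

lemma lin_indep_of_spanning:
  fixes h :: "nat \<Rightarrow> ('a::field)^'n"
  assumes "vec.span (h ` {..<CARD('n)}) = UNIV"
  shows "lin_indep CARD('n) h"
proof -
  have "CARD('n) \<le> card (h ` {..<CARD('n)})"
    using vec.dim_le_card[of UNIV "h ` {..<CARD('n)}"] assms vec_dim_card[where 'a='a and 'n='n] by simp
  moreover have "card (h ` {..<CARD('n)}) \<le> CARD('n)"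
    using card_image_le[of "{..<CARD('n)}" h] by simp
  ultimately have card: "card (h ` {..<CARD('n)}) = CARD('n)" by simp
  hence "inj_on h {..<CARD('n)}" by (intro eq_card_imp_inj_on) auto
  moreover have "vec.independent (h ` {..<CARD('n)})"
    using assms card vec_dim_card[where 'a='a and 'n='n]
    by (intro vec.card_le_dim_spanning[of _ UNIV]) auto
  ultimately show ?thesis by (simp add: lin_indep_iff)
qed

lemma periodic_sum_shift:
  fixes F :: "nat \<Rightarrow> 'b::ab_group_add"
  assumes "\<And>i. F (i + t) = F i"
  shows "(\<Sum>i<t. F (i + m)) = (\<Sum>i<t. F i)"
proof (induction m)
  case (Suc m)
  have "F m + (\<Sum>i<t. F (i + Suc m)) = (\<Sum>i<Suc t. F (i + m))"
    by (subst sum.lessThan_Suc_shift) simp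
  also have "\<dots> = (\<Sum>i<t. F (i + m)) + F m" using assms[of m] by (simp add: add.commute)
  finally show ?case using Suc by simp
qed simp

section \<open>Eigenvectors of the spread and the point R on the indicator line\<close>

locale indicator_line = cyclic_extension emb q t \<theta>
  for emb :: "'k::{field,finite} \<Rightarrow> 'K::{field,finite}" and q t :: nat and \<theta> :: "'K \<Rightarrow> 'K" +
  fixes L :: "('K^'r) set" and \<iota> :: "'K^'r \<Rightarrow> 'K^'n" and \<sigma> :: "'K^'n \<Rightarrow> 'K^'n" and \<nu> :: "('K^'n) set"
    and v0 v1 :: "'K^'r" and c :: 'K
  assumes line: "pg_subspace (*s) 1 L" and v0: "v0 \<in> L" "v0 \<noteq> 0" and v1: "v1 \<in> L" "v1 \<notin> vec.span {v0}"
    and card_n: "CARD('n) = 2 * t"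
    and iota_add: "\<And>x y. x \<in> L \<Longrightarrow> y \<in> L \<Longrightarrow> \<iota> (x + y) = \<iota> x + \<iota> y"
    and iota_scale: "\<And>a x. x \<in> L \<Longrightarrow> \<iota> (emb a *s x) = emb a *s \<iota> x"
    and iota_span: "vec.span (\<iota> ` L) = UNIV"
    and c_nz: "c \<noteq> 0" and sigma_iota: "\<And>x. x \<in> L \<Longrightarrow> \<sigma> (\<iota> x) = c *s \<iota> x"
    and sigma_add: "\<And>x y. \<sigma> (x + y) = \<sigma> x + \<sigma> y" and sigma_scale: "\<And>a x. \<sigma> (a *s x) = \<theta> a *s \<sigma> x"
    and indicator: "indicator_set emb t L \<iota> \<sigma> \<nu>"
begin

lemma scale_in_L: "x \<in> L \<Longrightarrow> a *s x \<in> L"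
  using line by (auto simp: pg_subspace_def intro: vec.subspace_scale)

lemma L_eq: "L = {a *s v0 + b *s v1 | a b. True}"
  using pg_line_eq(1)[OF line v0(1) v1(1) v0(2) v1(2)] .

lemma expansion:
  assumes "v \<in> L"
  obtains e where "\<And>x. \<iota> (x *s v) = (\<Sum>i<t. (\<theta> ^^ i) x *s e i)"
proof (rule base_linear_vec_expansion[of "\<lambda>x. \<iota> (x *s v)"])
  show "\<iota> ((x + y) *s v) = \<iota> (x *s v) + \<iota> (y *s v)" for x y
    using iota_add[OF scale_in_L scale_in_L, OF assms assms] by (simp add: vec.scale_left_distrib)
  show "\<iota> ((emb a * x) *s v) = emb a *s \<iota> (x *s v)" for a x
    using iota_scale[OF scale_in_L, OF assms, of a x] by simp
qed (rule that)

text \<open>Such vectors exist by \<open>expansion\<close>. The \<open>e i\<close> with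
  \<open>i < t\<close> span the conjugate points in the extension of \<open>vec.span {v0}\<close>,
  and the \<open>g i\<close> those for \<open>v1\<close>.\<close>

definition e where "e = (SOME e. \<forall>x. \<iota> (x *s v0) = (\<Sum>i<t. (\<theta> ^^ i) x *s e i))"
definition g where "g = (SOME e. \<forall>x. \<iota> (x *s v1) = (\<Sum>i<t. (\<theta> ^^ i) x *s e i))"

lemma iota_v0: "\<iota> (x *s v0) = (\<Sum>i<t. (\<theta> ^^ i) x *s e i)"
proof -
  have "\<exists>e. \<forall>x. \<iota> (x *s v0) = (\<Sum>i<t. (\<theta> ^^ i) x *s e i)" using expansion[OF v0(1)] by metis
  from someI_ex[OF this] show ?thesis unfolding e_def[symmetric] by (rule spec)
qed

lemma iota_v1: "\<iota> (x *s v1) = (\<Sum>i<t. (\<theta> ^^ i) x *s g i)"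
proof -
  have "\<exists>e. \<forall>x. \<iota> (x *s v1) = (\<Sum>i<t. (\<theta> ^^ i) x *s e i)" using expansion[OF v1(1)] by metis
  from someI_ex[OF this] show ?thesis unfolding g_def[symmetric] by (rule spec)
qed

lemma iota_line:
  "\<iota> (x *s (a *s v0 + b *s v1)) = (\<Sum>i<t. (\<theta> ^^ i) x *s ((\<theta> ^^ i) a *s e i + (\<theta> ^^ i) b *s g i))"
proof -
  have "\<iota> (x *s (a *s v0 + b *s v1)) = \<iota> ((x * a) *s v0) + \<iota> ((x * b) *s v1)"
    using iota_add[OF scale_in_L[OF v0(1)] scale_in_L[OF v1(1)], of "x * a" "x * b"]
    by (simp add: vec.scale_right_distrib)
  thus ?thesis
    by (simp add: iota_v0 iota_v1 th_mult vec.scale_right_distrib sum.distrib)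
qed

text \<open>Both families in one list: independence of the \<open>2 * t\<close> vectors follows from
  spanning a space of dimension \<open>CARD('n)\<close>.\<close>

definition h where "h i = (if i < t then e i else g (i - t))"

lemma sum_h: "(\<Sum>i<2 * t. a i *s h i) = (\<Sum>i<t. a i *s e i) + (\<Sum>i<t. a (i + t) *s g i)"
proof -
  have "(\<Sum>i<2 * t. a i *s h i) = (\<Sum>i<t. a i *s h i) + (\<Sum>i\<in>{t..<2 * t}. a i *s h i)"
    by (subst sum.union_disjoint[symmetric]) (auto intro: sum.cong)
  also have "(\<Sum>i\<in>{t..<2 * t}. a i *s h i) = (\<Sum>i<t. a (i + t) *s h (i + t))"
    by (rule sum.reindex_bij_witness[of _ "\<lambda>i. i + t" "\<lambda>i. i - t"]) auto
  finally show ?thesis by (simp add: h_def)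
qed

lemma h_indep: "lin_indep (2 * t) h"
proof -
  have "\<iota> x \<in> vec.span (h ` {..<2 * t})" if x: "x \<in> L" for x
  proof -
    obtain a b where ab: "x = a *s v0 + b *s v1" using x L_eq by auto
    have "\<iota> x = (\<Sum>i<2 * t. (if i < t then (\<theta> ^^ i) a else (\<theta> ^^ (i - t)) b) *s h i)"
      using iota_line[of 1 a b] by (simp add: ab sum_h th_1 sum.distrib)
    also have "\<dots> \<in> vec.span (h ` {..<2 * t})"
      by (intro vec.span_sum vec.span_scale vec.span_base) auto
    finally show ?thesis .
  qed
  hence "vec.span (\<iota> ` L) \<subseteq> vec.span (h ` {..<2 * t})"
    by (intro vec.span_minimal vec.subspace_span) auto
  thus ?thesis using lin_indep_of_spanning[of h] iota_span card_n by auto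
qed

lemma eg_eqD:
  assumes "(\<Sum>i<t. a i *s e i) + (\<Sum>i<t. b i *s g i) = (\<Sum>i<t. a' i *s e i) + (\<Sum>i<t. b' i *s g i)" and "i < t"
  shows "a i = a' i \<and> b i = b' i"
proof -
  let ?c = "\<lambda>a b i. if i < t then a i else b (i - t)"
  have "(\<Sum>i<2 * t. ?c a b i *s h i) = (\<Sum>i<2 * t. ?c a' b' i *s h i)"
    using assms(1) by (simp add: sum_h)
  from lin_indep_eqD[OF h_indep this, of i] lin_indep_eqD[OF h_indep this, of "i + t"]
  show ?thesis using assms(2) by simp
qed

lemma sigma_sum: "\<sigma> (\<Sum>j\<in>J. f j) = (\<Sum>j\<in>J. \<sigma> (f j))"
proof -
  have "\<sigma> 0 = 0" using sigma_add[of 0 0] by (metis add.right_neutral add_cancel_left_right)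
  thus ?thesis by (induction J rule: infinite_finite_induct) (auto simp: sigma_add)
qed

text \<open>The vector \<open>\<sigma> (\<iota> (y *s v0))\<close> is expanded twice, termwise by
  semilinearity and as \<open>c *s \<iota> (y *s v0)\<close>. After an index shift the expansions
  are compared by Dedekind's lemma.\<close>

lemma sigma_e:
  assumes "j < t"
  shows "\<sigma> (e j) = c *s e (Suc j mod t)"
proof -
  have 0: "(\<Sum>j<t. (\<theta> ^^ j) x *s (\<sigma> (e j) - c *s e (Suc j mod t))) = 0" for x
  proof -
    \<comment> \<open>Writing \<open>x\<close> as an image under \<open>\<theta>\<close> absorbs the
      twist that \<open>\<sigma>\<close> causes in the coefficients.\<close>
    obtain y where y: "x = \<theta> y" using bij_is_surj[OF aut_bij[OF aut_theta]] by blast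
    have "(\<Sum>j<t. (\<theta> ^^ j) x *s \<sigma> (e j)) = \<sigma> (\<iota> (y *s v0))"
      unfolding iota_v0 sigma_sum by (intro sum.cong refl) (simp add: sigma_scale y funpow_swap1)
    also have "\<dots> = c *s \<iota> (y *s v0)" by (rule sigma_iota[OF scale_in_L[OF v0(1)]])
    also have "\<dots> = c *s (\<Sum>j<t. (\<theta> ^^ j) y *s e (j mod t))" by (simp add: iota_v0)
    also have "(\<Sum>j<t. (\<theta> ^^ j) y *s e (j mod t)) = (\<Sum>j<t. (\<theta> ^^ (j + 1)) y *s e ((j + 1) mod t))"
      by (rule periodic_sum_shift[symmetric, where m = 1]) (simp add: funpow_add power_t)
    also have "c *s \<dots> = (\<Sum>j<t. (\<theta> ^^ j) x *s (c *s e (Suc j mod t)))"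
      unfolding vec.scale_sum_right y by (intro sum.cong refl) (simp add: funpow_swap1 mult.commute)
    finally show ?thesis by (simp add: vec.scale_right_diff_distrib sum_subtractf)
  qed
  have "\<sigma> (e j) - c *s e (Suc j mod t) \<in> {0}"
    by (rule sum_powers_in_subspace[OF vec.subspace_single_0 _ assms, of "\<lambda>j. \<sigma> (e j) - c *s e (Suc j mod t)"])
      (simp only: 0 singleton_iff)
  thus ?thesis by simp
qed

text \<open>The conjugate span of the point of \<open>\<nu>\<close> that yields the spread element
  has dimension at most \<open>t\<close>. Dedekind's lemma puts \<open>t\<close> independent vectors
  into it, so these span it, and the generator \<open>w\<close> is a combination of them.\<close>

lemma indicator_meets:
  assumes ab: "(a, b) \<noteq> (0, 0)"
  obtains w z where "w \<in> \<nu>" "w \<noteq> 0" "w = (\<Sum>i<t. (z i * (\<theta> ^^ i) a) *s e i) + (\<Sum>i<t. (z i * (\<theta> ^^ i) b) *s g i)"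
proof -
  let ?d = "a *s v0 + b *s v1"
  let ?h = "\<lambda>i. (\<theta> ^^ i) a *s e i + (\<theta> ^^ i) b *s g i"
  have d_nz: "?d \<noteq> 0" using pg_line_eq(2)[OF line v0(1) v1(1) v0(2) v1(2), of a b] ab by auto
  have dL: "?d \<in> L" using L_eq by blast
  hence "vec.span {?d} \<subseteq> L" using line by (intro vec.span_minimal) (auto simp: pg_subspace_def)
  hence "vec.span {?d} \<in> desarguesian_spread L"
    using d_nz by (auto simp: desarguesian_spread_def pg_points_vec)
  then obtain X where X: "X \<in> pg_points (*s) \<nu>"
    "vec.span {?d} = subgeometry_part \<iota> L (conjugate_span \<sigma> t X)"
    using indicator by (auto simp: indicator_set_def)
  obtain w where w: "X = vec.span {w}" "w \<noteq> 0" "X \<subseteq> \<nu>" using X(1) by (auto simp: pg_points_vec)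
  have wX: "w \<in> X" using w(1) by (simp add: vec.span_base)
  let ?W = "conjugate_span \<sigma> t X"
  have sc: "(\<sigma> ^^ i) (k *s x) = (\<theta> ^^ i) k *s (\<sigma> ^^ i) x" for i k x
    by (induction i) (auto simp: sigma_scale)
  have "(\<sigma> ^^ i) ` X \<subseteq> vec.span ((\<lambda>i. (\<sigma> ^^ i) w) ` {..<t})" if "i < t" for i
  proof -
    have "(\<sigma> ^^ i) w \<in> vec.span ((\<lambda>i. (\<sigma> ^^ i) w) ` {..<t})"
      using that by (intro vec.span_base imageI) simp
    thus ?thesis unfolding w(1) vec.span_singleton by (auto simp: sc intro: vec.span_scale)
  qed
  hence W_sub: "?W \<subseteq> vec.span ((\<lambda>i. (\<sigma> ^^ i) w) ` {..<t})"
    unfolding conjugate_span_def by (intro vec.span_minimal vec.subspace_span) auto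
  have dimW: "vec.dim ?W \<le> t"
    using vec.dim_le_card[OF W_sub] card_image_le[of "{..<t}" "\<lambda>i. (\<sigma> ^^ i) w"] by simp
  have h_W: "?h i \<in> ?W" if "i < t" for i
  proof (rule sum_powers_in_subspace[OF _ _ that])
    show "vec.subspace ?W" unfolding conjugate_span_def by (rule vec.subspace_span)
    fix x
    have "x *s ?d \<in> vec.span {?d}" by (auto simp: vec.span_singleton)
    hence "\<iota> (x *s ?d) \<in> ?W" unfolding X(2) by (simp add: subgeometry_part_def)
    thus "(\<Sum>i<t. (\<theta> ^^ i) x *s ?h i) \<in> ?W" unfolding iota_line .
  qed
  have h_sum: "(\<Sum>i<t. z i *s ?h i) = (\<Sum>i<t. (z i * (\<theta> ^^ i) a) *s e i) + (\<Sum>i<t. (z i * (\<theta> ^^ i) b) *s g i)" for z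
    by (simp add: vec.scale_right_distrib sum.distrib)
  have "lin_indep t ?h"
    unfolding lin_indep_def
  proof (intro allI impI)
    fix z j assume "(\<Sum>i<t. z i *s ?h i) = 0" and j: "j < t"
    hence "(\<Sum>i<t. (z i * (\<theta> ^^ i) a) *s e i) + (\<Sum>i<t. (z i * (\<theta> ^^ i) b) *s g i)
        = (\<Sum>i<t. 0 *s e i) + (\<Sum>i<t. 0 *s g i)" unfolding h_sum by simp
    from eg_eqD[OF this j] show "z j = 0" using ab by (auto simp: th_eq_0_iff)
  qed
  hence "inj_on ?h {..<t}" "vec.independent (?h ` {..<t})" by (auto simp: lin_indep_iff)
  hence "?W \<subseteq> vec.span (?h ` {..<t})"
    using h_W dimW by (intro vec.card_ge_dim_independent) (auto simp: card_image)
  moreover have "w \<in> ?W"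
    unfolding conjugate_span_def using wX t_pos by (intro vec.span_base UN_I[of 0]) auto
  ultimately have "w \<in> {\<Sum>i<t. z i *s ?h i | z. True}" unfolding span_family[symmetric] by (rule subsetD)
  then obtain z where z: "w = (\<Sum>i<t. z i *s ?h i)" by blast
  show thesis
  proof (rule that)
    show "w \<in> \<nu>" using w(3) wX by blast
    show "w \<noteq> 0" by (rule w(2))
    show "w = (\<Sum>i<t. (z i * (\<theta> ^^ i) a) *s e i) + (\<Sum>i<t. (z i * (\<theta> ^^ i) b) *s g i)"
      unfolding z by (rule h_sum)
  qed
qed

text \<open>The line \<open>\<nu>\<close> is spanned by vectors \<open>w0\<close>, \<open>w1\<close>
  in the extensions belonging to \<open>v0\<close> and \<open>v1\<close>. It has to meet the
  extensions of all other spread elements as well, which leaves a single nonzero coefficient in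
  \<open>w0\<close>.\<close>

lemma indicator_point_obtain:
  obtains j where "j < t" "\<nu> \<inter> vec.span (e ` {..<t}) = vec.span {e j}"
proof -
  have nu: "pg_subspace (*s) 1 \<nu>" using indicator by (simp add: indicator_set_def)
  obtain w0 z0 where w0: "w0 \<in> \<nu>" "w0 \<noteq> 0" "w0 = (\<Sum>i<t. z0 i *s e i)"
    using indicator_meets[of 1 0] by (auto simp: th_1 th_0)
  obtain w1 z1 where w1: "w1 \<in> \<nu>" "w1 \<noteq> 0" "w1 = (\<Sum>i<t. z1 i *s g i)"
    using indicator_meets[of 0 1] by (auto simp: th_1 th_0)
  have comb: "a *s w0 + b *s w1 = (\<Sum>i<t. (a * z0 i) *s e i) + (\<Sum>i<t. (b * z1 i) *s g i)" for a b
    by (simp add: w0(3) w1(3) vec.scale_sum_right)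
  have "w1 \<notin> vec.span {w0}"
  proof
    assume "w1 \<in> vec.span {w0}"
    then obtain k where "w1 = k *s w0" by (auto simp: vec.span_singleton)
    hence eq: "(\<Sum>i<t. (k * z0 i) *s e i) + (\<Sum>i<t. (0 * z1 i) *s g i)
       = (\<Sum>i<t. (0 * z0 i) *s e i) + (\<Sum>i<t. (1 * z1 i) *s g i)"
      using comb[of k 0] comb[of 0 1] by simp
    have "z1 i = 0" if "i < t" for i using eg_eqD[OF eq that] by simp
    hence "w1 = 0" by (simp add: w1(3))
    thus False using w1(2) by simp
  qed
  note nu_eq = pg_line_eq(1)[OF nu w0(1) w1(1) w0(2) this]
  \<comment> \<open>The condition that \<open>\<nu>\<close> meets the extension belonging to
    \<open>v0 + y *s v1\<close>, read off coefficientwise.\<close>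
  have meets: "\<exists>a b. (a, b) \<noteq> (0, 0) \<and> (\<forall>i<t. b * z1 i = a * z0 i * (\<theta> ^^ i) y)" for y
  proof -
    obtain w z where w: "w \<in> \<nu>" "w \<noteq> 0"
      "w = (\<Sum>i<t. (z i * (\<theta> ^^ i) 1) *s e i) + (\<Sum>i<t. (z i * (\<theta> ^^ i) y) *s g i)"
      using indicator_meets[of 1 y] by auto
    obtain a b where ab: "w = a *s w0 + b *s w1" using w(1) nu_eq by auto
    have "(a, b) \<noteq> (0, 0)" using w(2) ab by auto
    moreover have "b * z1 i = a * z0 i * (\<theta> ^^ i) y" if "i < t" for i
      using eg_eqD[OF trans[OF comb[of a b, symmetric] trans[OF ab[symmetric] w(3)]] that] by (simp add: th_1)
    ultimately show ?thesis by blast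
  qed
  obtain j where j: "j < t" "z0 j \<noteq> 0"
  proof -
    have "w0 = 0" if "\<forall>j<t. z0 j = 0" using that by (simp add: w0(3))
    hence "\<not> (\<forall>j<t. z0 j = 0)" using w0(2) by blast
    thus thesis using that by auto
  qed
  obtain l where l: "l < t" "z1 l \<noteq> 0"
  proof -
    have "w1 = 0" if "\<forall>j<t. z1 j = 0" using that by (simp add: w1(3))
    hence "\<not> (\<forall>j<t. z1 j = 0)" using w1(2) by blast
    thus thesis using that by auto
  qed
  \<comment> \<open>The case \<open>y = 1\<close> makes the coefficients of \<open>w0\<close> and
    \<open>w1\<close> proportional.\<close>
  obtain a1 b1 where ab1: "(a1, b1) \<noteq> (0, 0)" "\<And>i. i < t \<Longrightarrow> b1 * z1 i = a1 * z0 i"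
    using meets[of 1] by (auto simp: th_1)
  have b1: "b1 \<noteq> 0" using ab1 j by (cases "b1 = 0") auto
  have a1: "a1 \<noteq> 0" using ab1(2)[OF l(1)] l b1 by auto
  define k where "k = a1 / b1"
  have k: "k \<noteq> 0" "\<And>i. i < t \<Longrightarrow> z1 i = k * z0 i"
    using a1 b1 ab1(2) by (auto simp: k_def field_simps)
  \<comment> \<open>Two nonzero coefficients would force the powers \<open>i\<close> and
    \<open>j\<close> of \<open>\<theta>\<close> to agree at every \<open>y\<close>.\<close>
  have only: "z0 i = 0" if i: "i < t" "i \<noteq> j" for i
  proof (rule ccontr)
    assume zi: "z0 i \<noteq> 0"
    have "(\<theta> ^^ i) y = (\<theta> ^^ j) y" for y
    proof -
      obtain a b where ab: "(a, b) \<noteq> (0, 0)" "\<And>i. i < t \<Longrightarrow> b * z1 i = a * z0 i * (\<theta> ^^ i) y"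
        using meets[of y] by auto
      have "b * k = a * (\<theta> ^^ i) y" "b * k = a * (\<theta> ^^ j) y"
        using ab(2)[OF i(1)] ab(2)[OF j(1)] k(2)[OF i(1)] k(2)[OF j(1)] zi j(2)
        by (simp_all add: mult_ac)
      moreover from this have "a \<noteq> 0" using ab(1) k(1) by auto
      ultimately show ?thesis by (metis mult_left_cancel)
    qed
    hence "\<theta> ^^ i = \<theta> ^^ j" by auto
    thus False using inj_onD[OF inj_on_powers, of i j] i j(1) by simp
  qed
  have "w0 = (\<Sum>i\<in>{j}. z0 i *s e i)"
    unfolding w0(3) using only j(1) by (intro sum.mono_neutral_right) auto
  hence w0j: "w0 = z0 j *s e j" by simp
  have "\<nu> \<inter> vec.span (e ` {..<t}) = vec.span {e j}"
  proof (intro equalityI subsetI)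
    fix x assume x: "x \<in> \<nu> \<inter> vec.span (e ` {..<t})"
    obtain a b where ab: "x = a *s w0 + b *s w1" using x nu_eq by auto
    obtain d where d: "x = (\<Sum>i<t. d i *s e i)" using x unfolding span_family by auto
    have "(\<Sum>i<t. (a * z0 i) *s e i) + (\<Sum>i<t. (b * z1 i) *s g i) = (\<Sum>i<t. d i *s e i) + (\<Sum>i<t. 0 *s g i)"
      using ab d comb by simp
    from eg_eqD[OF this l(1)] have "b = 0" using l(2) by simp
    hence "x = (a * z0 j) *s e j" using ab w0j by simp
    thus "x \<in> vec.span {e j}" by (auto simp: vec.span_singleton)
  next
    fix x assume "x \<in> vec.span {e j}"
    then obtain d where d: "x = d *s e j" by (auto simp: vec.span_singleton)
    have "x = (d / z0 j) *s w0 + 0 *s w1" using d w0j j(2) by simp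
    hence "x \<in> \<nu>" unfolding nu_eq by blast
    moreover have "x \<in> vec.span (e ` {..<t})" unfolding d using j(1) by (intro vec.span_scale vec.span_base) auto
    ultimately show "x \<in> \<nu> \<inter> vec.span (e ` {..<t})" by simp
  qed
  thus thesis using that j(1) by blast
qed

lemma e_indep: "lin_indep t e"
  unfolding lin_indep_def
proof (intro allI impI)
  fix d i assume "(\<Sum>j<t. d j *s e j) = 0" and i: "i < t"
  hence "(\<Sum>j<t. d j *s e j) + (\<Sum>j<t. 0 *s g j) = (\<Sum>j<t. 0 *s e j) + (\<Sum>j<t. 0 *s g j)" by simp
  from eg_eqD[OF this i] show "d i = 0" by simp
qed

text \<open>The point \<open>R\<close> is spanned by \<open>e j\<close> for some unknown
  \<open>j\<close>. Starting the cycle there gives \<open>E\<close>, and substituting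
  \<open>(\<theta> ^^ (t - j)) y\<close> for the coordinate restores the shape of the
  expansion.\<close>

lemma design_exists:
  obtains \<tau> E where "design emb q t \<theta> \<iota> \<sigma> \<nu> (vec.span {v0}) \<tau> v0 E c"
proof -
  obtain j where j: "j < t" "\<nu> \<inter> vec.span (e ` {..<t}) = vec.span {e j}"
    using indicator_point_obtain .
  define E where "E i = e ((i + j) mod t)" for i
  have ext: "extension \<iota> (vec.span {v0}) = vec.span (e ` {..<t})"
  proof -
    have "\<iota> (x *s v0) \<in> vec.span (e ` {..<t})" for x
      unfolding iota_v0 by (rule vec.span_sum, rule vec.span_scale, rule vec.span_base) simp
    hence "\<iota> ` vec.span {v0} \<subseteq> vec.span (e ` {..<t})"
      unfolding vec.span_singleton by auto
    moreover have "e i \<in> vec.span (\<iota> ` vec.span {v0})" if "i < t" for i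
    proof (rule sum_powers_in_subspace[OF vec.subspace_span _ that])
      fix x
      have "\<iota> (x *s v0) \<in> \<iota> ` vec.span {v0}" by (auto simp: vec.span_singleton)
      thus "(\<Sum>i<t. (\<theta> ^^ i) x *s e i) \<in> vec.span (\<iota> ` vec.span {v0})"
        unfolding iota_v0 by (rule vec.span_base)
    qed
    ultimately show ?thesis unfolding extension_def
      by (intro equalityI vec.span_minimal) auto
  qed
  have "design emb q t \<theta> \<iota> \<sigma> \<nu> (vec.span {v0}) (\<theta> ^^ (t - j)) v0 E c"
  proof
    show "aut (\<theta> ^^ (t - j))" by (rule aut_power)
    show "v0 \<noteq> 0" by (rule v0(2))
    show "vec.span {v0} = range (\<lambda>y. y *s v0)" by (rule vec.span_singleton)
    show "\<iota> ((\<theta> ^^ (t - j)) y *s v0) = (\<Sum>i<t. (\<theta> ^^ i) y *s E i)" for y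
    proof -
      let ?F = "\<lambda>i. (\<theta> ^^ i) ((\<theta> ^^ (t - j)) y) *s e (i mod t)"
      have "\<iota> ((\<theta> ^^ (t - j)) y *s v0) = (\<Sum>i<t. ?F i)" by (simp add: iota_v0)
      also have "\<dots> = (\<Sum>i<t. ?F (i + j))"
        by (rule periodic_sum_shift[symmetric]) (simp add: funpow_add power_t)
      also have "\<dots> = (\<Sum>i<t. (\<theta> ^^ i) y *s E i)"
      proof (intro sum.cong refl)
        fix i
        have "(\<theta> ^^ (i + j)) ((\<theta> ^^ (t - j)) y) = (\<theta> ^^ (i + j + (t - j))) y"
          by (simp only: funpow_add comp_apply)
        also have "i + j + (t - j) = i + t" using j(1) by simp
        finally show "?F (i + j) = (\<theta> ^^ i) y *s E i" by (simp add: E_def funpow_add power_t)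
      qed
      finally show ?thesis .
    qed
    show "lin_indep t E"
    proof (rule lin_indepI_spanning[OF e_indep])
      fix i assume i: "i < t"
      have "e i = E ((i + (t - j)) mod t)"
      proof -
        have "((i + (t - j)) mod t + j) mod t = (i + (t - j) + j) mod t" by (rule mod_add_left_eq)
        also have "\<dots> = i" using i j(1) by simp
        finally show ?thesis by (simp add: E_def)
      qed
      thus "e i \<in> vec.span (E ` {..<t})" using t_pos by (auto intro!: vec.span_base)
    qed
    show "E (i + t) = E i" for i
      by (simp add: E_def) (metis add.assoc add.commute mod_add_self2)
    show "\<sigma> (E i) = c *s E (Suc i)" for i
      using sigma_e[of "(i + j) mod t"] t_pos by (simp add: E_def mod_Suc_eq)
    show "c \<noteq> 0" by (rule c_nz)
    show "\<sigma> (x + y) = \<sigma> x + \<sigma> y" for x y by (rule sigma_add)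
    show "\<sigma> (a *s x) = \<theta> a *s \<sigma> x" for a x by (rule sigma_scale)
    show "\<nu> \<inter> extension \<iota> (vec.span {v0}) = vec.span {E 0}"
      using j by (simp add: ext E_def)
  qed
  thus thesis by (rule that)
qed

end

section \<open>Clubs\<close>

text \<open>The points of the line other than \<open>P\<^sub>\<infinity> = <v\<^sub>0>\<close> are the points \<open>aff y = <h + y v\<^sub>0>\<close>; the head is \<open>aff 0\<close>.\<close>

locale affine_line = field_extension emb q t
  for emb :: "'k::{field,finite} \<Rightarrow> 'K::{field,finite}" and q t :: nat +
  fixes l :: "('K^'r) set" and h v\<^sub>0 :: "'K^'r"
  assumes l_eq: "l = {a *s h + b *s v\<^sub>0 | a b. True}"
    and indep: "\<And>a b. a *s h + b *s v\<^sub>0 = 0 \<Longrightarrow> a = 0 \<and> b = 0"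
begin

lemma coord_eqD: "a *s h + b *s v\<^sub>0 = a' *s h + b' *s v\<^sub>0 \<Longrightarrow> a = a' \<and> b = b'"
  using indep[of "a - a'" "b - b'"]
  by (simp add: vec.scale_left_diff_distrib algebra_simps)

lemma h_nz: "h \<noteq> 0" and v0_nz: "v\<^sub>0 \<noteq> 0"
  using indep[of 1 0] indep[of 0 1] by auto

definition aff :: "'K \<Rightarrow> ('K^'r) set" where
  "aff y = vec.span {h + y *s v\<^sub>0}"

lemma aff_0: "aff 0 = vec.span {h}"
  by (simp add: aff_def)

lemma aff_nz: "h + y *s v\<^sub>0 \<noteq> 0"
  using indep[of 1 y] by auto

lemma in_aff_iff: "x \<in> aff y \<longleftrightarrow> (\<exists>a. x = a *s h + (a * y) *s v\<^sub>0)"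
  by (auto simp: aff_def vec.span_singleton vec.scale_right_distrib)

lemma aff_ne: "aff y \<noteq> vec.span {v\<^sub>0}"
proof
  assume "aff y = vec.span {v\<^sub>0}"
  hence "v\<^sub>0 \<in> aff y" by (simp add: vec.span_base)
  then obtain a where "0 *s h + 1 *s v\<^sub>0 = a *s h + (a * y) *s v\<^sub>0" by (auto simp: in_aff_iff)
  from coord_eqD[OF this] show False by auto
qed

lemma subspace_l: "vec.subspace l"
proof -
  have "l = vec.span {h, v\<^sub>0}"
  proof (intro equalityI)
    show "l \<subseteq> vec.span {h, v\<^sub>0}"
      unfolding l_eq by (auto intro!: vec.span_add vec.span_scale intro: vec.span_base)
    show "vec.span {h, v\<^sub>0} \<subseteq> l"
    proof
      fix z assume "z \<in> vec.span {h, v\<^sub>0}"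
      then obtain a b where "z - a *s h = b *s v\<^sub>0" by (auto simp: vec.span_insert[of h] vec.span_singleton)
      hence "z = a *s h + b *s v\<^sub>0" by (simp add: diff_eq_eq add.commute)
      thus "z \<in> l" unfolding l_eq by blast
    qed
  qed
  thus ?thesis by simp
qed

lemma points_l: "pg_points (*s) l = insert (vec.span {v\<^sub>0}) (range aff)"
proof (intro equalityI subsetI)
  fix X assume "X \<in> pg_points (*s) l"
  then obtain x where x: "X = vec.span {x}" "x \<noteq> 0" "vec.span {x} \<subseteq> l" by (auto simp: pg_points_vec)
  hence "x \<in> l" using vec.span_base[of x "{x}"] by auto
  then obtain a b where ab: "x = a *s h + b *s v\<^sub>0" unfolding l_eq by auto
  show "X \<in> insert (vec.span {v\<^sub>0}) (range aff)"
  proof (cases "a = 0")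
    case True
    hence "X = vec.span {v\<^sub>0}" using x ab by (cases "b = 0") (auto simp: span_singleton_scale)
    thus ?thesis by simp
  next
    case False
    hence xe: "x = a *s (h + (b / a) *s v\<^sub>0)" by (simp add: ab vec.scale_right_distrib)
    have "X = aff (b / a)" unfolding x(1) aff_def xe by (rule span_singleton_scale[OF False])
    thus ?thesis by simp
  qed
next
  fix X assume "X \<in> insert (vec.span {v\<^sub>0}) (range aff)"
  moreover have "vec.span {x} \<in> pg_points (*s) l" if "x \<in> l" "x \<noteq> 0" for x
    using that subspace_l vec.span_minimal[of "{x}" l] unfolding pg_points_vec by blast
  moreover have "v\<^sub>0 \<in> l" unfolding l_eq by (intro CollectI exI[of _ 0] exI[of _ 1]) simp
  moreover have "h + y *s v\<^sub>0 \<in> l" for y unfolding l_eq by (intro CollectI exI[of _ 1] exI[of _ y]) simp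
  ultimately show "X \<in> pg_points (*s) l" using v0_nz aff_nz by (auto simp: aff_def)
qed

text \<open>A point over the base field lies in only one point over \<open>'K\<close>. Field
  reduction is therefore injective on sets of points, and equality can be tested before
  reducing.\<close>

lemma linear_set_iff:
  assumes S: "S \<subseteq> pg_points (*s) l" and \<pi>: "module.subspace (sub_scale emb) \<pi>"
  shows "field_reduction emb S = (\<Union>D\<in>spread_meeting emb l \<pi>. base_points D)
    \<longleftrightarrow> S = {D \<in> pg_points (*s) l. \<exists>x\<in>D \<inter> \<pi>. x \<noteq> 0}"
proof -
  have base_sub: "module.subspace (sub_scale emb) (vec.span {x})" for x :: "'K^'r"
    by (auto simp: base_subspace_iff intro: vec.span_add vec.span_scale vec.span_zero)
  have pm: "base_points (D \<inter> \<pi>) \<noteq> {} \<longleftrightarrow> (\<exists>x\<in>D \<inter> \<pi>. x \<noteq> 0)" if "D \<in> pg_points (*s) l" for D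
  proof -
    have "module.subspace (sub_scale emb) (D \<inter> \<pi>)"
      using that base_sub \<pi> by (auto simp: pg_points_vec base_subspace_iff)
    note bs = base_point_subset[OF this]
    show ?thesis unfolding pg_points_base using bs by auto
  qed
  have meeting: "spread_meeting emb l \<pi> = {D \<in> pg_points (*s) l. \<exists>x\<in>D \<inter> \<pi>. x \<noteq> 0}"
    unfolding spread_meeting_def desarguesian_spread_def by (rule Collect_cong, rule conj_cong[OF refl pm])
  have sub: "A \<subseteq> B" if A: "A \<subseteq> pg_points (*s) l" and B: "B \<subseteq> pg_points (*s) l"
    and eq: "field_reduction emb A = field_reduction emb B" for A B
  proof
    fix P assume P: "P \<in> A"
    then obtain x where x: "P = vec.span {x}" "x \<noteq> 0" using A by (auto simp: pg_points_vec)
    have "base_point x \<in> base_points P"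
      using x base_point_subset[OF base_sub[of x], of x] by (auto simp: pg_points_base vec.span_base)
    hence "base_point x \<in> field_reduction emb B" using P eq by (auto simp: field_reduction_def)
    then obtain P' where P': "P' \<in> B" "base_point x \<subseteq> P'"
      by (auto simp: field_reduction_def pg_points_base)
    then obtain x' where x': "P' = vec.span {x'}" using B by (auto simp: pg_points_vec)
    have "x \<in> vec.span {x'}" using P'(2) x' base_point_self by blast
    then obtain a where "x = a *s x'" by (auto simp: vec.span_singleton)
    moreover from this have "a \<noteq> 0" using x(2) by auto
    ultimately have "P = P'" using x(1) x' by (simp add: span_singleton_scale)
    thus "P \<in> B" using P' by simp
  qed
  have fr: "(\<Union>D\<in>spread_meeting emb l \<pi>. base_points D) = field_reduction emb (spread_meeting emb l \<pi>)"
    by (simp add: field_reduction_def)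
  have sp: "spread_meeting emb l \<pi> \<subseteq> pg_points (*s) l" unfolding meeting by auto
  have "field_reduction emb S = (\<Union>D\<in>spread_meeting emb l \<pi>. base_points D)
    \<longleftrightarrow> S = spread_meeting emb l \<pi>"
    unfolding fr using sub[OF S sp] sub[OF sp S] by auto
  thus ?thesis by (simp only: meeting)
qed

lemma weight_iff:
  assumes "module.subspace (sub_scale emb) \<pi>"
  shows "weight emb \<pi> (vec.span {x}) = d \<longleftrightarrow> card (vec.span {x} \<inter> \<pi>) = q ^ d"
  unfolding weight_def using assms
  by (intro base_dim_iff) (auto simp: base_subspace_iff intro: vec.span_add vec.span_scale vec.span_zero)

text \<open>A vector of \<open>\<pi>\<close> with first coordinate \<open>u\<close> lies on
  \<open>aff y\<close> when \<open>u * y = emb a * w\<close>, and a nonzero \<open>a\<close> can be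
  absorbed into \<open>u\<close>. Since \<open>w / 0 = 0\<close>, the element 0 of \<open>U\<close>
  stands for the head \<open>aff 0\<close>.\<close>

lemma club_plane_meets_aff:
  assumes U: "over_base.subspace U" and U1: "card U > 1" and w: "w \<noteq> 0"
    and \<pi>: "\<pi> = {u *s h + (emb a * w) *s v\<^sub>0 | u a. u \<in> U}"
  shows "(\<exists>x\<in>aff y \<inter> \<pi>. x \<noteq> 0) \<longleftrightarrow> y \<in> (\<lambda>u. w / u) ` U"
proof
  assume "\<exists>x\<in>aff y \<inter> \<pi>. x \<noteq> 0"
  then obtain x k u a where x: "x \<noteq> 0" "x = k *s h + (k * y) *s v\<^sub>0" "x = u *s h + (emb a * w) *s v\<^sub>0" "u \<in> U"
    unfolding \<pi> by (auto simp: in_aff_iff)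
  from coord_eqD[OF trans[OF x(2)[symmetric] x(3)]] have k: "k = u" "u * y = emb a * w" by auto
  hence u_nz: "u \<noteq> 0" using x by auto
  show "y \<in> (\<lambda>u. w / u) ` U"
  proof (cases "a = 0")
    case True
    hence "y = w / 0" using k u_nz by simp
    thus ?thesis using over_base.subspace_0[OF U] by blast
  next
    case False
    have "y = emb a * w / u" using k u_nz by (simp add: field_simps)
    hence "y = w / (emb (inverse a) * u)" by (simp add: emb_inverse divide_inverse mult_ac)
    thus ?thesis using over_base.subspace_scale[OF U x(4), of "inverse a"] by blast
  qed
next
  assume "y \<in> (\<lambda>u. w / u) ` U"
  then obtain u where u: "u \<in> U" "y = w / u" by auto
  obtain x a where x: "x \<in> U" "x \<noteq> 0" "x * y = emb a * w"
  proof (cases "u = 0")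
    case True
    have "\<not> U \<subseteq> {0}" using U1 card_mono[of "{0}" U] by auto
    then obtain x where "x \<in> U" "x \<noteq> 0" by auto
    thus thesis using that[of x 0] u True by simp
  next
    case False
    thus thesis using that[of u 1] u by simp
  qed
  have "x *s h + (x * y) *s v\<^sub>0 \<in> aff y" unfolding in_aff_iff by blast
  moreover have "x *s h + (x * y) *s v\<^sub>0 \<in> \<pi>" unfolding \<pi> x(3) using x(1) by blast
  moreover have "x *s h + (x * y) *s v\<^sub>0 \<noteq> 0" using indep x(2) by blast
  ultimately show "\<exists>x\<in>aff y \<inter> \<pi>. x \<noteq> 0" by blast
qed

lemma card_club_plane:
  assumes "w \<noteq> 0"
  shows "card {u *s h + (emb a * w) *s v\<^sub>0 | u a. u \<in> U} = card U * q"
proof -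
  have "{u *s h + (emb a * w) *s v\<^sub>0 | u a. u \<in> U} = (\<lambda>(u, a). u *s h + (emb a * w) *s v\<^sub>0) ` (U \<times> UNIV)"
    by auto
  moreover have "inj_on (\<lambda>(u, a). u *s h + (emb a * w) *s v\<^sub>0) (U \<times> UNIV)"
    using assms by (auto simp: inj_on_def dest!: coord_eqD)
  ultimately show ?thesis by (simp add: card_image card_cartesian_product card_base)
qed

lemma card_multiples:
  assumes "x \<noteq> (0 :: 'K^'r)"
  shows "card {u *s x | u. u \<in> U} = card U"
proof -
  have "{u *s x | u. u \<in> U} = (\<lambda>u. u *s x) ` U" by auto
  thus ?thesis using assms by (simp add: card_image inj_on_def)
qed

definition affine_coords :: "('K^'r) set set \<Rightarrow> 'K set" where
  "affine_coords S = {y. aff y \<in> S}"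

text \<open>Let \<open>U\<close> describe the part of \<open>\<pi>\<close> on the head and let
  \<open>w *s v\<^sub>0\<close> be a nonzero vector of \<open>\<pi>\<close> on the point at
  infinity. These generate a space as large as \<open>\<pi>\<close>, and \<open>V\<close> is
  \<open>U\<close> divided by \<open>w\<close>. As \<open>inverse 0 = 0\<close>, the vector 0 of
  \<open>V\<close> accounts for the head.\<close>

lemma club_iff:
  assumes S: "S \<subseteq> pg_points (*s) l" and k: "k \<ge> 2" and P: "vec.span {v\<^sub>0} \<in> S"
  shows "club_with_head emb l k S (vec.span {h}) \<longleftrightarrow>
    (\<exists>V. over_base.subspace V \<and> card V = q ^ (k - 1) \<and> affine_coords S = inverse ` V)"
proof
  assume "club_with_head emb l k S (vec.span {h})"
  then obtain \<pi> where lin: "is_linear_set emb l k \<pi> S" and H: "weight emb \<pi> (vec.span {h}) = k - 1"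
    and others: "\<And>P. P \<in> S \<Longrightarrow> P \<noteq> vec.span {h} \<Longrightarrow> weight emb \<pi> P = 1"
    by (auto simp: club_with_head_def)
  have sub: "module.subspace (sub_scale emb) \<pi>" and card: "card \<pi> = q ^ k" and \<pi>l: "\<pi> \<subseteq> l"
    using lin k by (auto simp: is_linear_set_def pg_subspace_base_iff)
  have S_eq: "S = {D \<in> pg_points (*s) l. \<exists>x\<in>D \<inter> \<pi>. x \<noteq> 0}"
    using lin linear_set_iff[OF S sub] by (simp add: is_linear_set_def)
  obtain x where "x \<in> vec.span {v\<^sub>0} \<inter> \<pi>" "x \<noteq> 0" using P S_eq by auto
  then obtain w where w: "w *s v\<^sub>0 \<in> \<pi>" "w \<noteq> 0" by (auto simp: vec.span_singleton)
  define U where "U = {u. u *s h \<in> \<pi>}"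
  have U: "over_base.subspace U"
  proof (rule over_base.subspaceI)
    show "0 \<in> U" using sub by (simp add: U_def base_subspace_iff)
    show "x + y \<in> U" if "x \<in> U" "y \<in> U" for x y
      using sub that by (simp add: U_def base_subspace_iff vec.scale_left_distrib)
    show "emb a * x \<in> U" if "x \<in> U" for a x
    proof -
      have "emb a *s (x *s h) \<in> \<pi>" using sub that by (simp only: U_def base_subspace_iff mem_Collect_eq)
      thus ?thesis by (simp add: U_def)
    qed
  qed
  have "vec.span {h} \<inter> \<pi> = {u *s h | u. u \<in> U}" by (auto simp: U_def vec.span_singleton)
  hence cU: "card U = q ^ (k - 1)"
    using H card_multiples[OF h_nz, of U] by (simp add: weight_iff[OF sub])
  hence U1: "card U > 1" using one_less_power[OF q_gt_1, of "k - 1"] k by simp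
  define \<pi>' where "\<pi>' = {u *s h + (emb a * w) *s v\<^sub>0 | u a. u \<in> U}"
  have "\<pi>' \<subseteq> \<pi>"
  proof
    fix x assume "x \<in> \<pi>'"
    then obtain u a where x: "x = u *s h + emb a *s (w *s v\<^sub>0)" "u *s h \<in> \<pi>" by (auto simp: \<pi>'_def U_def)
    thus "x \<in> \<pi>" using sub w(1) unfolding base_subspace_iff by blast
  qed
  moreover have "card \<pi>' = q ^ k"
    unfolding \<pi>'_def card_club_plane[OF w(2)] cU using k by (cases k) auto
  \<comment> \<open>Head part and base field multiples of \<open>w\<close> give
    \<open>q ^ (k - 1) * q\<close> vectors, which is all of \<open>\<pi>\<close>.\<close>
  ultimately have \<pi>': "\<pi> = \<pi>'" using card by (intro card_seteq[symmetric]) auto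
  have "aff y \<in> S \<longleftrightarrow> y \<in> (\<lambda>u. w / u) ` U" for y
  proof -
    have "aff y \<in> pg_points (*s) l" unfolding points_l by simp
    hence "aff y \<in> S \<longleftrightarrow> (\<exists>x\<in>aff y \<inter> \<pi>. x \<noteq> 0)" by (subst S_eq) simp
    thus ?thesis using club_plane_meets_aff[OF U U1 w(2) \<pi>'[unfolded \<pi>'_def], of y] by simp
  qed
  hence "affine_coords S = (\<lambda>u. w / u) ` U" unfolding affine_coords_def by auto
  moreover have "(\<lambda>u. w / u) ` U = inverse ` ((\<lambda>u. u / w) ` U)"
    by (simp add: image_image)
  moreover have "over_base.subspace ((\<lambda>u. u / w) ` U)"
  proof (rule over_base.subspaceI)
    show "0 \<in> (\<lambda>u. u / w) ` U" using over_base.subspace_0[OF U] by force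
    show "x + y \<in> (\<lambda>u. u / w) ` U" if "x \<in> (\<lambda>u. u / w) ` U" "y \<in> (\<lambda>u. u / w) ` U" for x y
      using that over_base.subspace_add[OF U] by (auto simp flip: add_divide_distrib)
    show "emb a * x \<in> (\<lambda>u. u / w) ` U" if "x \<in> (\<lambda>u. u / w) ` U" for a x
      using that over_base.subspace_scale[OF U] by auto
  qed
  moreover have "card ((\<lambda>u. u / w) ` U) = q ^ (k - 1)"
    using w(2) cU by (subst card_image) (auto simp: inj_on_def)
  ultimately show "\<exists>V. over_base.subspace V \<and> card V = q ^ (k - 1) \<and> affine_coords S = inverse ` V"
    by metis
next
  assume "\<exists>V. over_base.subspace V \<and> card V = q ^ (k - 1) \<and> affine_coords S = inverse ` V"
  then obtain V where V: "over_base.subspace V" and cV: "card V = q ^ (k - 1)"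
    and SV: "affine_coords S = inverse ` V" by auto
  have V1: "card V > 1" using cV one_less_power[OF q_gt_1, of "k - 1"] k by simp
  \<comment> \<open>The normal form with \<open>w = 1\<close>, any scaling being contained in
    \<open>V\<close>.\<close>
  define \<pi> where "\<pi> = {u *s h + (emb a * 1) *s v\<^sub>0 | u a. u \<in> V}"
  have \<pi>_iff: "a *s h + b *s v\<^sub>0 \<in> \<pi> \<longleftrightarrow> a \<in> V \<and> b \<in> range emb" for a b
    by (auto simp: \<pi>_def dest: coord_eqD)
  have sub: "module.subspace (sub_scale emb) \<pi>"
    unfolding base_subspace_iff
  proof (intro conjI ballI allI)
    show "0 \<in> \<pi>" using \<pi>_iff[of 0 0] over_base.subspace_0[OF V] by (auto intro: range_eqI[of _ _ 0])
    fix x assume "x \<in> \<pi>"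
    then obtain u a where x: "x = u *s h + emb a *s v\<^sub>0" "u \<in> V" by (auto simp: \<pi>_def)
    have "emb b *s x = (emb b * u) *s h + emb (b * a) *s v\<^sub>0" for b
      by (simp add: x vec.scale_right_distrib emb_mult)
    thus "emb b *s x \<in> \<pi>" for b using over_base.subspace_scale[OF V x(2)] by (simp add: \<pi>_iff)
    fix y assume "y \<in> \<pi>"
    then obtain u' a' where y: "y = u' *s h + emb a' *s v\<^sub>0" "u' \<in> V" by (auto simp: \<pi>_def)
    have "x + y = (u + u') *s h + emb (a + a') *s v\<^sub>0"
      by (simp add: x y vec.scale_left_distrib emb_add)
    thus "x + y \<in> \<pi>" using over_base.subspace_add[OF V x(2) y(2)]
      by (simp only: \<pi>_iff rangeI simp_thms)
  qed
  have card: "card \<pi> = q ^ k"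
    unfolding \<pi>_def card_club_plane[OF one_neq_zero] cV using k by (cases k) auto
  have \<pi>l: "\<pi> \<subseteq> l" unfolding \<pi>_def l_eq by auto
  have S_iff: "aff y \<in> S \<longleftrightarrow> (\<exists>x\<in>aff y \<inter> \<pi>. x \<noteq> 0)" for y
  proof -
    have "aff y \<in> S \<longleftrightarrow> y \<in> (\<lambda>u. 1 / u) ` V"
      using SV by (auto simp: affine_coords_def set_eq_iff inverse_eq_divide)
    thus ?thesis using club_plane_meets_aff[OF V V1 one_neq_zero \<pi>_def] by simp
  qed
  have P\<pi>: "v\<^sub>0 \<in> \<pi>" using \<pi>_iff[of 0 1] over_base.subspace_0[OF V] by (auto intro: range_eqI[of _ _ 1])
  have "S = {D \<in> pg_points (*s) l. \<exists>x\<in>D \<inter> \<pi>. x \<noteq> 0}"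
  proof (intro equalityI subsetI)
    fix D assume D: "D \<in> S"
    hence "D \<in> insert (vec.span {v\<^sub>0}) (range aff)" using S points_l by auto
    hence "\<exists>x\<in>D \<inter> \<pi>. x \<noteq> 0"
    proof
      assume "D = vec.span {v\<^sub>0}"
      thus ?thesis using P\<pi> v0_nz by (auto intro!: bexI[of _ v\<^sub>0] simp: vec.span_base)
    qed (use D S_iff in auto)
    thus "D \<in> {D \<in> pg_points (*s) l. \<exists>x\<in>D \<inter> \<pi>. x \<noteq> 0}" using D S by auto
  next
    fix D assume "D \<in> {D \<in> pg_points (*s) l. \<exists>x\<in>D \<inter> \<pi>. x \<noteq> 0}"
    hence "D \<in> insert (vec.span {v\<^sub>0}) (range aff)" and D: "\<exists>x\<in>D \<inter> \<pi>. x \<noteq> 0" using points_l by auto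
    from this(1) show "D \<in> S"
    proof
      assume "D \<in> range aff"
      then obtain y where "D = aff y" by auto
      thus ?thesis using D S_iff[of y] by simp
    qed (use P in simp)
  qed
  hence lin: "is_linear_set emb l k \<pi> S"
    using linear_set_iff[OF S sub] sub card \<pi>l S k
    by (simp add: is_linear_set_def pg_subspace_base_iff)
  have "0 \<in> affine_coords S" unfolding SV using over_base.subspace_0[OF V] by force
  hence HS: "vec.span {h} \<in> S" by (simp add: affine_coords_def aff_0)
  have "vec.span {h} \<inter> \<pi> = {u *s h | u. u \<in> V}"
  proof -
    have "u *s h \<in> \<pi> \<longleftrightarrow> u \<in> V" for u using \<pi>_iff[of u 0] by (auto intro: range_eqI[of _ _ 0])
    thus ?thesis by (auto simp: vec.span_singleton)
  qed
  hence weight_H: "weight emb \<pi> (vec.span {h}) = k - 1"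
    using card_multiples[OF h_nz, of V] cV by (simp add: weight_iff[OF sub])
  have weight_P: "weight emb \<pi> (vec.span {v\<^sub>0}) = 1"
  proof -
    have "a *s v\<^sub>0 \<in> \<pi> \<longleftrightarrow> a \<in> range emb" for a
      using \<pi>_iff[of 0 a] over_base.subspace_0[OF V] by auto
    hence "vec.span {v\<^sub>0} \<inter> \<pi> = base_point v\<^sub>0" by (auto simp: vec.span_singleton base_point_def)
    thus ?thesis using card_base_point[OF v0_nz] by (simp add: weight_iff[OF sub])
  qed
  have weight_aff: "weight emb \<pi> (aff y) = 1" if y: "aff y \<in> S" "y \<noteq> 0" for y
  proof -
    have "y \<in> inverse ` V" using y(1) SV by (auto simp: affine_coords_def)
    then obtain u where u: "u \<in> V" "y = inverse u" by auto
    hence u_nz: "u \<noteq> 0" using y(2) by auto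
    \<comment> \<open>With \<open>y = inverse u\<close> the spanning vector is
      \<open>u *s h + v\<^sub>0\<close>: a vector of \<open>\<pi>\<close> on \<open>aff y\<close> is
      determined by its second coordinate, which lies in the base field.\<close>
    have "aff y \<inter> \<pi> = base_point (u *s (h + y *s v\<^sub>0))"
    proof (intro equalityI subsetI)
      fix x assume "x \<in> aff y \<inter> \<pi>"
      then obtain a where a: "x = a *s h + (a * y) *s v\<^sub>0" "x \<in> \<pi>" by (auto simp: in_aff_iff)
      then obtain b where "a * y = emb b" using \<pi>_iff by auto
      hence "a = emb b * u" using u u_nz by (simp add: field_simps)
      hence "x = emb b *s (u *s (h + y *s v\<^sub>0))" unfolding a(1) by (simp add: vec.scale_right_distrib mult_ac)
      thus "x \<in> base_point (u *s (h + y *s v\<^sub>0))" by (simp add: base_point_def)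
    next
      fix x assume "x \<in> base_point (u *s (h + y *s v\<^sub>0))"
      then obtain b where x: "x = (emb b * u) *s h + (emb b * u * y) *s v\<^sub>0"
        by (auto simp: base_point_def vec.scale_right_distrib mult_ac)
      have "x \<in> aff y" unfolding x in_aff_iff by blast
      moreover have "emb b * u * y = emb b" using u u_nz by simp
      hence "x \<in> \<pi>"
        unfolding x \<pi>_iff using over_base.subspace_scale[OF V u(1), of b] by (metis rangeI)
      ultimately show "x \<in> aff y \<inter> \<pi>" by simp
    qed
    moreover have "u *s (h + y *s v\<^sub>0) \<noteq> 0"
      using vec.scale_eq_0_iff[of u "h + y *s v\<^sub>0"] u_nz aff_nz by metis
    ultimately have "card (aff y \<inter> \<pi>) = q" by (simp only: card_base_point not_False_eq_True)
    thus ?thesis using weight_iff[OF sub, of "h + y *s v\<^sub>0" 1] by (simp only: aff_def power_one_right)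
  qed
  have "weight emb \<pi> D = 1" if D: "D \<in> S - {vec.span {h}}" for D
  proof -
    have "D \<in> insert (vec.span {v\<^sub>0}) (range aff)" using S D points_l by auto
    thus ?thesis
    proof
      assume "D \<in> range aff"
      then obtain y where y: "D = aff y" by auto
      hence "y \<noteq> 0" using D aff_0 by auto
      thus ?thesis using weight_aff D y by simp
    qed (simp add: weight_P)
  qed
  thus "club_with_head emb l k S (vec.span {h})"
    unfolding club_with_head_def using lin HS weight_H by blast
qed

end

section \<open>Cones over subspaces of the design\<close>

locale club_cone = design emb q t \<theta> \<iota> \<sigma> \<nu> p \<tau> v\<^sub>0 E c + affine_line emb q t l h v\<^sub>0
  for emb :: "'k::{field,finite} \<Rightarrow> 'K::{field,finite}" and q t :: nat and \<theta> :: "'K \<Rightarrow> 'K"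
    and \<iota> :: "'K^'r \<Rightarrow> 'K^'n" and \<sigma> \<nu> and p :: "('K^'r) set" and \<tau> and v\<^sub>0 :: "'K^'r" and E c
    and l :: "('K^'r) set" and h :: "'K^'r" +
  fixes \<mu> :: "('K^'r) set"
  assumes mu_iff: "\<And>a b. a *s h + b *s v\<^sub>0 \<in> \<mu> \<longleftrightarrow> a \<in> range emb"
begin

lemma p_span: "p = vec.span {v\<^sub>0}"
  by (simp add: p_eq vec.span_singleton)

text \<open>By \<open>mu_iff\<close> a multiple of \<open>h + y *s v\<^sub>0\<close> lies in
  \<open>\<mu>\<close> exactly when the factor comes from the base field.\<close>

lemma abb_aff: "abb_map \<mu> (aff y) = base_point (h + y *s v\<^sub>0)"
proof (intro equalityI subsetI)
  fix x assume "x \<in> abb_map \<mu> (aff y)"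
  then obtain a where a: "x = a *s h + (a * y) *s v\<^sub>0" "x \<in> \<mu>" by (auto simp: abb_map_def in_aff_iff)
  then obtain b where "a = emb b" using mu_iff by auto
  thus "x \<in> base_point (h + y *s v\<^sub>0)" using a(1) by (auto simp: base_point_def vec.scale_right_distrib)
next
  fix x assume "x \<in> base_point (h + y *s v\<^sub>0)"
  then obtain b where x: "x = emb b *s h + (emb b * y) *s v\<^sub>0" by (auto simp: base_point_def vec.scale_right_distrib)
  hence "x \<in> aff y" unfolding in_aff_iff by blast
  moreover have "x \<in> \<mu>" unfolding x mu_iff by simp
  ultimately show "x \<in> abb_map \<mu> (aff y)" by (simp add: abb_map_def)
qed

lemma base_point_aff_eqD:
  assumes "base_point (h + y *s v\<^sub>0) = base_point (h + y' *s v\<^sub>0)"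
  shows "y = y'"
proof -
  have "h + y *s v\<^sub>0 \<in> base_point (h + y' *s v\<^sub>0)" using base_point_self[of "h + y *s v\<^sub>0"] assms by simp
  then obtain a where "1 *s h + y *s v\<^sub>0 = emb a *s h + (emb a * y') *s v\<^sub>0"
    by (auto simp: base_point_def vec.scale_right_distrib)
  from coord_eqD[OF this] show ?thesis by auto
qed

lemma abb_image:
  assumes S: "S \<subseteq> pg_points (*s) l"
  shows "abb_map \<mu> ` (S - {vec.span {v\<^sub>0}}) = (\<lambda>y. base_point (h + y *s v\<^sub>0)) ` affine_coords S"
proof -
  have "S - {vec.span {v\<^sub>0}} = aff ` affine_coords S"
    using S aff_ne unfolding points_l affine_coords_def by auto
  thus ?thesis by (simp add: image_image abb_aff)
qed

abbreviation "cone_over W \<equiv> proj_cone (sub_scale emb) (base_point h) (inverse_points W)"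

lemma cone_point_vector:
  assumes W: "over_base.subspace W"
  shows "cone_over W =
    {base_point x | x w a b. w \<in> W \<and> w \<noteq> 0 \<and> x \<noteq> 0 \<and> x = emb a *s h + (emb b * \<tau> (1 / w)) *s v\<^sub>0}"
proof -
  interpret sub: vector_space "sub_scale emb :: 'k \<Rightarrow> 'K^'r \<Rightarrow> 'K^'r" by (rule vector_space_sub_scale)
  have span: "sub.span (base_point h \<union> pt (1 / w)) = {emb a *s h + (emb b * \<tau> (1 / w)) *s v\<^sub>0 | a b. True}" for w
    unfolding pt_def span_base_points by (simp add: vec_of_def)
  have pts: "X \<in> base_points (sub.span (base_point h \<union> pt (1 / w))) \<longleftrightarrow>
      (\<exists>x a b. X = base_point x \<and> x \<noteq> 0 \<and> x = emb a *s h + (emb b * \<tau> (1 / w)) *s v\<^sub>0)" for X w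
    unfolding pg_points_base mem_Collect_eq base_point_subset[OF sub.subspace_span] unfolding span mem_Collect_eq
    by blast
  have "X \<in> cone_over W \<longleftrightarrow>
      (\<exists>w. w \<in> W \<and> w \<noteq> 0 \<and> X \<in> base_points (sub.span (base_point h \<union> pt (1 / w))))" for X
    unfolding proj_cone_def inverse_points_def by auto
  thus ?thesis unfolding pts by (simp only: set_eq_iff mem_Collect_eq) blast
qed

text \<open>A point off \<open>p\<close> on the line from the vertex to \<open>pt (1 / w)\<close>
  can be normalised to coefficient 1 at \<open>h\<close>, and the remaining base field scalar is
  absorbed into \<open>w\<close>. The element 0 of \<open>W\<close> gives the vertex, which lies on
  the cone because a nontrivial \<open>W\<close> provides at least one line.\<close>

lemma cone_affine_part:
  assumes W: "over_base.subspace W" and nontrivial: "W \<noteq> {0}"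
  shows "cone_over W - base_points p
    = (\<lambda>w. base_point (h + \<tau> (inverse w) *s v\<^sub>0)) ` W"
proof (intro equalityI subsetI)
  fix X assume X: "X \<in> cone_over W - base_points p"
  then obtain x w a b where x: "X = base_point x" "w \<in> W" "w \<noteq> 0" "x \<noteq> 0"
    "x = emb a *s h + (emb b * \<tau> (1 / w)) *s v\<^sub>0" unfolding cone_point_vector[OF W] by auto
  have a: "a \<noteq> 0"
  proof
    assume "a = 0"
    hence "x = (emb b * \<tau> (1 / w)) *s v\<^sub>0" using x(5) by simp
    hence "base_point x \<subseteq> p" by (auto simp: base_point_def p_eq)
    thus False using X x(1,4) by (auto simp: pg_points_base)
  qed
  have xe: "x = emb a *s (h + \<tau> (emb (b / a) / w) *s v\<^sub>0)"
  proof -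
    have "emb a * \<tau> (emb (b / a) / w) = \<tau> (emb a * (emb (b / a) / w))"
      by (simp only: aut_mult[OF aut_tau] aut_emb[OF aut_tau])
    also have "emb a * (emb (b / a) / w) = emb b * (1 / w)" using a by (simp flip: emb_mult)
    also have "\<tau> (emb b * (1 / w)) = emb b * \<tau> (1 / w)"
      by (simp only: aut_mult[OF aut_tau] aut_emb[OF aut_tau])
    finally show ?thesis unfolding x(5) by (simp add: vec.scale_right_distrib)
  qed
  have Xe: "X = base_point (h + \<tau> (emb (b / a) / w) *s v\<^sub>0)" unfolding x(1) xe by (rule base_point_scale[OF a])
  \<comment> \<open>For \<open>b = 0\<close> both sides are 0, since \<open>a / 0 = 0\<close> and
    \<open>inverse 0 = 0\<close>.\<close>
  have "emb (b / a) / w = inverse (emb (a / b) * w)"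
    using emb_inverse[of "b / a"] by (simp add: divide_inverse)
      (metis emb_inverse emb_mult inverse_inverse_eq inverse_mult_distrib mult.commute)
  moreover have "emb (a / b) * w \<in> W" using over_base.subspace_scale[OF W x(2)] .
  ultimately show "X \<in> (\<lambda>w. base_point (h + \<tau> (inverse w) *s v\<^sub>0)) ` W" using Xe by (intro image_eqI) auto
next
  fix X assume "X \<in> (\<lambda>w. base_point (h + \<tau> (inverse w) *s v\<^sub>0)) ` W"
  then obtain w where w: "w \<in> W" "X = base_point (h + \<tau> (inverse w) *s v\<^sub>0)" by auto
  have "\<exists>w' b. w' \<in> W \<and> w' \<noteq> 0 \<and> \<tau> (inverse w) = emb b * \<tau> (1 / w')"
  proof (cases "w = 0")
    case True
    obtain w' where "w' \<in> W" "w' \<noteq> 0" using nontrivial over_base.subspace_0[OF W] by auto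
    thus ?thesis using True by (intro exI[of _ w'] exI[of _ 0]) (simp add: aut_0[OF aut_tau])
  next
    case False
    thus ?thesis using w(1) by (intro exI[of _ w] exI[of _ 1]) (simp add: inverse_eq_divide)
  qed
  then obtain w' b where w': "w' \<in> W" "w' \<noteq> 0" "\<tau> (inverse w) = emb b * \<tau> (1 / w')" by auto
  have "h + \<tau> (inverse w) *s v\<^sub>0 = emb 1 *s h + (emb b * \<tau> (1 / w')) *s v\<^sub>0" by (simp add: w'(3))
  hence "X \<in> cone_over W"
    unfolding cone_point_vector[OF W] w(2) using w'(1,2) aff_nz by blast
  moreover have "X \<notin> base_points p"
  proof
    assume "X \<in> base_points p"
    hence "base_point (h + \<tau> (inverse w) *s v\<^sub>0) \<subseteq> p" using w(2) by (auto simp: pg_points_base)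
    hence "h + \<tau> (inverse w) *s v\<^sub>0 \<in> p" using base_point_self by blast
    then obtain k where "1 *s h + \<tau> (inverse w) *s v\<^sub>0 = 0 *s h + k *s v\<^sub>0" by (auto simp: p_eq)
    from coord_eqD[OF this] show False by simp
  qed
  ultimately show "X \<in> cone_over W - base_points p" by simp
qed

lemma cone_in_space:
  assumes W: "over_base.subspace W"
  shows "cone_over W \<subseteq> base_points (l \<inter> \<mu>)"
proof
  fix X assume "X \<in> cone_over W"
  then obtain x w a b where x: "X = base_point x" "x \<noteq> 0" "x = emb a *s h + (emb b * \<tau> (1 / w)) *s v\<^sub>0"
    unfolding cone_point_vector[OF W] by auto
  have "emb d *s x \<in> l \<inter> \<mu>" for d
  proof -
    have d: "emb d *s x = emb (d * a) *s h + (emb d * (emb b * \<tau> (1 / w))) *s v\<^sub>0"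
      by (simp add: x(3) vec.scale_right_distrib emb_mult)
    show ?thesis unfolding d Int_iff mu_iff l_eq by blast
  qed
  hence "base_point x \<subseteq> l \<inter> \<mu>" by (auto simp: base_point_def)
  thus "X \<in> base_points (l \<inter> \<mu>)" using x(1,2) by (auto simp: pg_points_base)
qed

lemma over_base_dim_iff:
  assumes "over_base.subspace W"
  shows "over_base.dim W = d \<longleftrightarrow> card W = q ^ d"
  using over_base.card_subspace[OF _ _ assms] card_base q_gt_1 by simp

lemma image_aut_subspace:
  assumes "over_base.subspace W" and \<alpha>: "aut \<alpha>"
  shows "over_base.subspace (\<alpha> ` W)"
proof (rule over_base.subspaceI)
  show "0 \<in> \<alpha> ` W" using over_base.subspace_0[OF assms(1)] aut_0[OF \<alpha>] by (metis image_eqI)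
  show "x + y \<in> \<alpha> ` W" if "x \<in> \<alpha> ` W" "y \<in> \<alpha> ` W" for x y
    using that over_base.subspace_add[OF assms(1)] by (auto simp flip: aut_add[OF \<alpha>])
  show "emb a * x \<in> \<alpha> ` W" if "x \<in> \<alpha> ` W" for a x
  proof -
    from that obtain w where w: "w \<in> W" "x = \<alpha> w" by auto
    have "emb a * x = \<alpha> (emb a * w)" by (simp add: w(2) aut_mult[OF \<alpha>] aut_emb[OF \<alpha>])
    thus ?thesis using over_base.subspace_scale[OF assms(1) w(1)] by blast
  qed
qed

text \<open>The affine part of the cone over \<open>inverse_points W\<close> has as coordinates the
  inverses of the elements of the image of \<open>W\<close> under \<open>\<tau>\<close>. This image
  plays the role of \<open>V\<close>: \<open>\<tau>\<close> permutes the subspaces of a given size,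
  and dimension \<open>k - 2\<close> in the design means \<open>q ^ (k - 1)\<close> vectors.\<close>

lemma cone_iff:
  assumes S: "S \<subseteq> pg_points (*s) l" and k: "k \<ge> 2"
  shows "(\<exists>K. is_H_subspace K \<and> H_dim emb t \<iota> \<sigma> \<nu> p K = int k - 2 \<and>
        proj_cone (sub_scale emb) (base_point h) K \<subseteq> base_points (l \<inter> \<mu>) \<and>
        abb_map \<mu> ` (S - {p}) = proj_cone (sub_scale emb) (base_point h) K - base_points p)
    \<longleftrightarrow> (\<exists>V. over_base.subspace V \<and> card V = q ^ (k - 1) \<and> affine_coords S = inverse ` V)"
    (is "?L \<longleftrightarrow> ?R")
proof -
  have cone_eq: "abb_map \<mu> ` (S - {p}) = cone_over W - base_points p
      \<longleftrightarrow> affine_coords S = inverse ` (\<tau> ` W)"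
    if W: "over_base.subspace W" "card W = q ^ (k - 1)" for W
  proof -
    have "card W > 1" using W(2) one_less_power[OF q_gt_1, of "k - 1"] k by simp
    hence "W \<noteq> {0}" by auto
    moreover have "inj (\<lambda>y. base_point (h + y *s v\<^sub>0))" using base_point_aff_eqD by (auto simp: inj_def)
    moreover have "(\<lambda>w. base_point (h + \<tau> (inverse w) *s v\<^sub>0)) ` W = (\<lambda>y. base_point (h + y *s v\<^sub>0)) ` (inverse ` (\<tau> ` W))"
      by (simp add: image_image aut_inverse[OF aut_tau])
    ultimately show ?thesis
      unfolding cone_affine_part[OF W(1) \<open>W \<noteq> {0}\<close>] using abb_image[OF S]
      by (simp add: p_span inj_image_eq_iff)
  qed
  show ?thesis
  proof
    assume ?L
    then obtain K where K: "is_H_subspace K" "H_dim emb t \<iota> \<sigma> \<nu> p K = int k - 2"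
      "abb_map \<mu> ` (S - {p}) = proj_cone (sub_scale emb) (base_point h) K - base_points p" by blast
    obtain W where W: "over_base.subspace W" "K = inverse_points W" using H_subspace_obtain[OF K(1)] .
    have "over_base.dim W = k - 1" using K(2) k unfolding W(2) H_dim_inverse_points[OF W(1)] by simp
    hence cW: "card W = q ^ (k - 1)" by (simp add: over_base_dim_iff[OF W(1)])
    have "affine_coords S = inverse ` (\<tau> ` W)" using K(3) cone_eq[OF W(1) cW] W(2) by simp
    moreover have "card (\<tau> ` W) = q ^ (k - 1)"
      using cW inj_on_subset[OF aut_inj[OF aut_tau]] by (simp add: card_image)
    ultimately show ?R using image_aut_subspace[OF W(1) aut_tau] by blast
  next
    assume ?R
    then obtain V where V: "over_base.subspace V" "card V = q ^ (k - 1)" "affine_coords S = inverse ` V" by blast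
    define W where "W = \<tau> -` V"
    have surj: "surj \<tau>" using bij_is_surj[OF aut_bij[OF aut_tau]] .
    have VW: "V = \<tau> ` W" unfolding W_def using surj by (rule surj_image_vimage_eq[symmetric])
    have W: "over_base.subspace W"
      by (rule over_base.subspaceI)
        (use V(1) in \<open>auto simp: W_def aut_0[OF aut_tau] aut_add[OF aut_tau] aut_mult[OF aut_tau] aut_emb[OF aut_tau]
          intro: over_base.subspace_0 over_base.subspace_add over_base.subspace_scale\<close>)
    have cW: "card W = q ^ (k - 1)"
      using V(2) VW inj_on_subset[OF aut_inj[OF aut_tau]] by (simp add: card_image)
    have "H_dim emb t \<iota> \<sigma> \<nu> p (inverse_points W) = int k - 2"
      using over_base_dim_iff[OF W, of "k - 1"] cW k H_dim_inverse_points[OF W] by simp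
    thus ?L
      using H_subspace_inverse_points[OF W] cone_in_space[OF W] cone_eq[OF W cW] V(3) VW
      by (intro exI[of _ "inverse_points W"]) simp
  qed
qed

end

section \<open>The projective plane\<close>

lemma card_vec_subspace:
  assumes "vec.subspace (U :: ('a::{field,finite}^'n) set)"
  shows "card U = CARD('a) ^ vec.dim U"
  using assms by (intro vec.card_subspace) auto

text \<open>There are more pairs in \<open>l \<times> l'\<close> than vectors in the whole space, so
  two pairs have the same difference, and this yields a common nonzero vector. A second independent
  common vector would make the lines equal.\<close>

lemma pg_lines_meet:
  fixes l l' :: "(('a::{field,finite})^3) set"
  assumes l: "pg_subspace (*s) 1 l" and l': "pg_subspace (*s) 1 l'" and ne: "l \<noteq> l'"
  obtains v where "v \<noteq> 0" "l \<inter> l' = vec.span {v}"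
proof -
  have sub: "vec.subspace l" "vec.subspace l'" using l l' by (auto simp: pg_subspace_def)
  have "\<not> inj_on (\<lambda>(x, y). x - y) (l \<times> l')"
  proof
    assume "inj_on (\<lambda>(x, y). x - y) (l \<times> l')"
    hence "card (l \<times> l') \<le> card (UNIV :: ('a^3) set)" by (intro card_inj_on_le) auto
    moreover have "card l = CARD('a) ^ 2" "card l' = CARD('a) ^ 2"
      using card_vec_subspace[OF sub(1)] card_vec_subspace[OF sub(2)] l l' by (auto simp: pg_subspace_def numeral_2_eq_2)
    moreover have "card (UNIV :: ('a^3) set) = CARD('a) ^ 3"
      using card_vec_subspace[of "UNIV :: ('a^3) set"] vec_dim_card[where 'a='a and 'n=3] by simp
    ultimately have "CARD('a) ^ 4 \<le> CARD('a) ^ 3" by (simp add: card_cartesian_product flip: power_add)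
    moreover have "card {0, 1 :: 'a} \<le> CARD('a)" by (intro card_mono) auto
    ultimately show False by (simp add: power_increasing_iff)
  qed
  then obtain x y x' y' where xy: "x \<in> l" "y \<in> l'" "x' \<in> l" "y' \<in> l'" "x - y = x' - y'" "(x, y) \<noteq> (x', y')"
    by (auto simp: inj_on_def)
  define v where "v = x - x'"
  have vy: "v = y - y'" using xy(5) by (simp add: v_def algebra_simps)
  have "v \<in> l" unfolding v_def by (rule vec.subspace_diff[OF sub(1) xy(1,3)])
  moreover have "v \<in> l'" unfolding vy by (rule vec.subspace_diff[OF sub(2) xy(2,4)])
  ultimately have v: "v \<in> l \<inter> l'" by simp
  have v_nz: "v \<noteq> 0" using xy(6) vy by (auto simp: v_def)
  have "l \<inter> l' \<subseteq> vec.span {v}"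
  proof (rule ccontr)
    assume "\<not> l \<inter> l' \<subseteq> vec.span {v}"
    then obtain w where w: "w \<in> l" "w \<in> l'" "w \<notin> vec.span {v}" by auto
    have "l = l'" using pg_line_eq(1)[OF l _ w(1) v_nz w(3)] pg_line_eq(1)[OF l' _ w(2) v_nz w(3)] v by auto
    thus False using ne by simp
  qed
  moreover have "vec.span {v} \<subseteq> l \<inter> l'" using v sub by (intro Int_greatest vec.span_minimal) auto
  ultimately show thesis using that v_nz by blast
qed

context field_extension
begin

text \<open>A vector of \<open>\<mu>\<close> outside \<open>L\<close> has a nonzero component
  \<open>h\<close> along \<open>h\<^sub>0\<close>, and \<open>h\<close> lies in \<open>\<mu>\<close>
  because \<open>L\<close> does. By cardinality \<open>\<mu>\<close> consists of the sums of vectors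
  of \<open>L\<close> and base field multiples of \<open>h\<close>.\<close>

lemma head_representative:
  fixes L \<mu> :: "('K^3) set"
  assumes L: "pg_subspace (*s) 1 L" and \<mu>: "pg_subspace (sub_scale emb) (2 * t) \<mu>" and sub: "L \<subseteq> \<mu>"
    and h0: "h\<^sub>0 \<notin> L"
  obtains h k where "k \<noteq> 0" "h = k *s h\<^sub>0" "\<And>z a. z \<in> L \<Longrightarrow> a *s h + z \<in> \<mu> \<longleftrightarrow> a \<in> range emb"
proof -
  have Lsub: "vec.subspace L" and cL: "card L = (q ^ t) ^ 2"
    using L card_vec_subspace[of L] by (auto simp: pg_subspace_def card_ext numeral_2_eq_2)
  have \<mu>sub: "module.subspace (sub_scale emb) \<mu>" and c\<mu>: "card \<mu> = q ^ (2 * t + 1)"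
    using \<mu> by (auto simp: pg_subspace_base_iff)
  have no_multiple: "a = 0" if "a *s h\<^sub>0 \<in> L" for a
  proof (rule ccontr)
    assume "a \<noteq> 0"
    moreover have "inverse a *s (a *s h\<^sub>0) \<in> L" by (rule vec.subspace_scale[OF Lsub that])
    ultimately show False using h0 by simp
  qed
  have inj: "inj_on (\<lambda>(z, a). z + a *s h\<^sub>0) (L \<times> UNIV)"
  proof (rule inj_onI, clarify)
    fix z a z' a' assume z: "z \<in> L" "z' \<in> L" and eq: "z + a *s h\<^sub>0 = z' + a' *s h\<^sub>0"
    have "(a - a') *s h\<^sub>0 = z' - z" using eq by (simp add: vec.scale_left_diff_distrib algebra_simps)
    hence "(a - a') *s h\<^sub>0 \<in> L" using z Lsub by (simp add: vec.subspace_diff)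
    hence "a = a'" using no_multiple by fastforce
    thus "z = z' \<and> a = a'" using eq by simp
  qed
  have "card (L \<times> (UNIV :: 'K set)) = (q ^ t) ^ 2 * q ^ t" by (simp only: card_cartesian_product cL card_ext)
  also have "\<dots> = (q ^ t) ^ 3" by (simp only: power2_eq_square power3_eq_cube)
  also have "\<dots> = card (UNIV :: ('K^3) set)"
    using card_vec_subspace[of "UNIV :: ('K^3) set"] vec_dim_card[where 'a='K and 'n=3] card_ext by simp
  finally have "card ((\<lambda>(z, a). z + a *s h\<^sub>0) ` (L \<times> UNIV)) = card (UNIV :: ('K^3) set)"
    by (simp only: card_image[OF inj])
  hence surj: "(\<lambda>(z, a). z + a *s h\<^sub>0) ` (L \<times> UNIV) = UNIV" by (intro card_seteq) auto
  have "\<not> \<mu> \<subseteq> L"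
  proof
    assume "\<mu> \<subseteq> L"
    hence "q ^ (2 * t + 1) \<le> q ^ (t * 2)" using card_mono[of L \<mu>] cL c\<mu> by (simp flip: power_mult)
    from power_le_imp_le_exp[OF q_gt_1 this] show False by simp
  qed
  then obtain m where m: "m \<in> \<mu>" "m \<notin> L" by auto
  have "m \<in> (\<lambda>(z, a). z + a *s h\<^sub>0) ` (L \<times> UNIV)" unfolding surj by simp
  then obtain z0 k where zk: "z0 \<in> L" "m = z0 + k *s h\<^sub>0" by auto
  have k: "k \<noteq> 0" using m(2) zk by auto
  define h where "h = k *s h\<^sub>0"
  have add\<mu>: "x + y \<in> \<mu>" if "x \<in> \<mu>" "y \<in> \<mu>" for x y using \<mu>sub that by (simp add: base_subspace_iff)
  have scale\<mu>: "emb a *s x \<in> \<mu>" if "x \<in> \<mu>" for a x using \<mu>sub that by (simp add: base_subspace_iff)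
  have "h = m + emb (- 1) *s z0" by (simp add: h_def zk(2) emb_uminus)
  hence h\<mu>: "h \<in> \<mu>" using add\<mu>[OF m(1) scale\<mu>] zk(1) sub by auto
  define M where "M = (\<lambda>(z, a). z + (emb a * k) *s h\<^sub>0) ` (L \<times> UNIV)"
  have "inj_on (\<lambda>(z, a). z + (emb a * k) *s h\<^sub>0) (L \<times> UNIV)"
  proof (rule inj_onI, clarify)
    fix z a z' a' assume "z \<in> L" "z' \<in> L" "z + (emb a * k) *s h\<^sub>0 = z' + (emb a' * k) *s h\<^sub>0"
    thus "z = z' \<and> a = a'"
      using inj_onD[OF inj, of "(z, emb a * k)" "(z', emb a' * k)"] k by simp
  qed
  hence "card M = card \<mu>"
    using cL c\<mu> card_base by (simp add: M_def card_image card_cartesian_product power_mult[symmetric] mult.commute)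
  moreover have "M \<subseteq> \<mu>"
  proof
    fix x assume "x \<in> M"
    then obtain z a where x: "x = z + emb a *s h" "z \<in> L" by (auto simp: M_def h_def)
    thus "x \<in> \<mu>" using add\<mu>[OF _ scale\<mu>[OF h\<mu>]] sub by auto
  qed
  ultimately have M: "\<mu> = M" by (intro card_seteq[symmetric]) auto
  show thesis
  proof (rule that[OF k h_def])
    fix z a assume z: "z \<in> L"
    show "a *s h + z \<in> \<mu> \<longleftrightarrow> a \<in> range emb"
    proof
      assume "a *s h + z \<in> \<mu>"
      then obtain z' b where z': "z' \<in> L" "a *s h + z = z' + (emb b * k) *s h\<^sub>0" unfolding M M_def by auto
      hence "(\<lambda>(z, a). z + a *s h\<^sub>0) (z, a * k) = (\<lambda>(z, a). z + a *s h\<^sub>0) (z', emb b * k)"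
        by (simp add: h_def add.commute)
      from inj_onD[OF inj this] have "a * k = emb b * k" using z z'(1) by auto
      thus "a \<in> range emb" using k by auto
    next
      assume "a \<in> range emb"
      thus "a *s h + z \<in> \<mu>" using add\<mu>[OF scale\<mu>[OF h\<mu>]] z sub by auto
    qed
  qed
qed

end

theorem theorem3p8:
  fixes q t k :: nat
    and emb :: "'k::{field,finite} \<Rightarrow> 'K::{field,finite}"
    and l_inf l P_inf \<mu> Pi_l H :: "('K^3) set"
    and \<iota> :: "'K^3 \<Rightarrow> 'K^'n"
    and \<sigma> :: "'K^'n \<Rightarrow> 'K^'n"
    and \<nu> :: "('K^'n) set"
    and S :: "('K^3) set set"
  assumes "CARD('k) = q" and "CARD('K) = q ^ t" and "field_embedding emb"
    and "t \<ge> 2" and "k \<ge> 2"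
    and "pg_subspace (*s) 1 l_inf"
    and "pg_subspace (sub_scale emb) (2 * t) \<mu>" and "l_inf \<subseteq> \<mu>"
    and "pg_subspace (*s) 1 l" and "l \<noteq> l_inf"
    and "P_inf = l \<inter> l_inf" and "Pi_l = l \<inter> \<mu>"
    and "CARD('n) = 2 * t"
    and "subgeometry_embedding emb l_inf \<iota>"
    and "subgeometry_generator emb l_inf \<iota> \<sigma>"
    and "indicator_set emb t l_inf \<iota> \<sigma> \<nu>"
    and "S \<subseteq> pg_points (*s) l"
    and "H \<in> pg_points (*s) l" and "H \<noteq> P_inf"
  shows "(club_with_head emb l k S H \<and> P_inf \<in> S) \<longleftrightarrow>
    (P_inf \<in> S \<and>
     (\<exists>K. H_subspace emb t \<iota> \<sigma> \<nu> P_inf K \<and> H_dim emb t \<iota> \<sigma> \<nu> P_inf K = int k - 2 \<and>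
        proj_cone (sub_scale emb) (abb_map \<mu> H) K \<subseteq> pg_points (sub_scale emb) Pi_l \<and>
        abb_map \<mu> ` (S - {P_inf}) =
          proj_cone (sub_scale emb) (abb_map \<mu> H) K - pg_points (sub_scale emb) P_inf))"
proof -
  interpret field_extension emb q t using assms(1-4) by unfold_locales auto
  note L = assms(6) and l = assms(9)
  have Lsub: "vec.subspace l_inf" using L by (simp add: pg_subspace_def)
  obtain v0 where v0: "v0 \<noteq> 0" "P_inf = vec.span {v0}"
    using pg_lines_meet[OF l L assms(10)] assms(11) by metis
  have v0_in: "v0 \<in> l" "v0 \<in> l_inf" using v0(2) assms(11) vec.span_base[of v0 "{v0}"] by auto
  obtain v1 where v1: "v1 \<in> l_inf" "v1 \<notin> vec.span {v0}" using pg_line_obtain[OF L v0(1)] .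
  obtain h0 where h0: "h0 \<noteq> 0" "H = vec.span {h0}" "vec.span {h0} \<subseteq> l"
    using assms(18) by (auto simp: pg_points_vec)
  have h0_l: "h0 \<in> l" using h0(3) vec.span_base[of h0 "{h0}"] by auto
  have h0_L: "h0 \<notin> l_inf"
  proof
    assume "h0 \<in> l_inf"
    hence "h0 \<in> vec.span {v0}" using h0_l v0(2) assms(11) by auto
    then obtain a where "h0 = a *s v0" by (auto simp: vec.span_singleton)
    moreover from this have "a \<noteq> 0" using h0(1) by auto
    ultimately have "H = P_inf" using h0(2) v0(2) by (simp add: span_singleton_scale)
    thus False using assms(19) by simp
  qed
  \<comment> \<open>The head is represented by a vector of \<open>\<mu>\<close>, so that its image
    under the map is \<open>base_point h\<close>.\<close>
  obtain h d where h: "d \<noteq> 0" "h = d *s h0"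
    and h_mu: "\<And>z a. z \<in> l_inf \<Longrightarrow> a *s h + z \<in> \<mu> \<longleftrightarrow> a \<in> range emb"
    by (rule head_representative[OF L assms(7,8) h0_L]) (rule that, assumption+)
  have H: "H = vec.span {h}" using h h0(2) by (simp add: span_singleton_scale)
  have h_L: "h \<notin> l_inf"
  proof
    assume "h \<in> l_inf"
    hence "inverse d *s h \<in> l_inf" by (rule vec.subspace_scale[OF Lsub])
    thus False using h h0_L by simp
  qed
  have h_l: "h \<in> l" using h(2) h0_l l by (auto simp: pg_subspace_def intro: vec.subspace_scale)
  have h_v0: "h \<notin> vec.span {v0}" using h_L h_l v0(2) assms(11) by auto
  note line = pg_line_eq[OF l v0_in(1) h_l v0(1) h_v0]
  obtain \<theta> c where \<theta>: "aut \<theta>" "\<exists>i. \<forall>x. x ^ q = (\<theta> ^^ i) x" and c: "c \<noteq> 0"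
    "\<And>x. x \<in> l_inf \<Longrightarrow> \<sigma> (\<iota> x) = c *s \<iota> x" "\<And>x y. \<sigma> (x + y) = \<sigma> x + \<sigma> y"
    "\<And>a x. \<sigma> (a *s x) = \<theta> a *s \<sigma> x"
    by (rule generator_companion[OF L assms(14,15)]) (rule that, assumption+)
  \<comment> \<open>The vector \<open>v0\<close> spanning \<open>P_inf\<close> serves both lines:
    with \<open>v1\<close> it is a basis of \<open>l_inf\<close> for the design, and with
    \<open>h\<close> a basis of \<open>l\<close> for the club.\<close>
  interpret ind: indicator_line emb q t \<theta> l_inf \<iota> \<sigma> \<nu> v0 v1 c
    using \<theta> c L v0(1) v0_in v1 assms(13,14,16)
    by unfold_locales (auto simp: subgeometry_embedding_def sub_scale_def)
  obtain \<tau> E where "design emb q t \<theta> \<iota> \<sigma> \<nu> (vec.span {v0}) \<tau> v0 E c" using ind.design_exists .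
  hence design: "design emb q t \<theta> \<iota> \<sigma> \<nu> P_inf \<tau> v0 E c" by (simp only: v0(2))
  interpret design emb q t \<theta> \<iota> \<sigma> \<nu> P_inf \<tau> v0 E c by (rule design)
  interpret club_cone emb q t \<theta> \<iota> \<sigma> \<nu> P_inf \<tau> v0 E c l h \<mu>
  proof
    show "l = {a *s h + b *s v0 | a b. True}" 
      unfolding line(1) by (rule Collect_cong) (metis add.commute)
    show "a = 0 \<and> b = 0" if "a *s h + b *s v0 = 0" for a b using line(2)[of b a] that by (simp add: add.commute)
    show "a *s h + b *s v0 \<in> \<mu> \<longleftrightarrow> a \<in> range emb" for a b
      using h_mu[of "b *s v0" a] v0_in(2) Lsub by (simp add: vec.subspace_scale)
  qed
  have "abb_map \<mu> H = base_point h" using abb_aff[of 0] by (simp add: H aff_0)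
  thus ?thesis
    using club_iff[OF assms(17) assms(5)] cone_iff[OF assms(17) assms(5)]
    by (auto simp: H p_span assms(12))
qed

end
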